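(* Let $\Omega=\mathbb{T}$, let $\nu,\alpha_1,\alpha_2,\alpha_3,\alpha_4>0$, and consider the Kolmogorov system $$\left\{\begin{array}{l} \partial_tu+u\,\partial_xu-\nu\,\partial_x\left(\dfrac{k}{\omega}\,\partial_xu\right)=0\\[1ex] \partial_t\omega+u\,\partial_x\omega-\alpha_1\,\partial_x\left(\dfrac{k}{\omega}\,\partial_x\omega\right)=-\alpha_2\,\omega^2\\[1ex] \partial_tk+u\,\partial_xk-\alpha_3\,\partial_x\left(\dfrac{k}{\omega}\,\partial_xk\right)=-k\,\omega+\alpha_4\,\dfrac{k}{\omega}\,|\partial_xu|^2 \end{array}\right.$$ for $t\geq0$ and $x\in\Omega$. There exist smooth initial data $(u_0,\omega_0,k_0)$ such that the corresponding solutions $(u,\omega,k)$ to this system blow up in finite time.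
   Context: $\mathbb{T}=[-\pi,\pi]/\sim$ is the one-dimensional torus, where $\sim$ identifies $-\pi$ and $\pi$. Admissible initial data are triplets $(u_0,\omega_0,k_0)$ with $u_0,\omega_0,k_0\in H^m(\Omega)$ for an integer $m\geq2$, $0<\omega_*\leq\omega_0\leq\omega^*$ for some constants $\omega_*,\omega^*$, $k_0\geq0$ and $\sqrt{k_0}\in H^m(\Omega)$. For such data, the corresponding solution is the (unique) solution $(u,\omega,k)$ with $(u,\omega,k)_{|t=0}=(u_0,\omega_0,k_0)$, $\omega>0$, $k\geq0$, $u,\omega,\sqrt{k}\in L^\infty([0,T];H^m(\Omega))\cap\bigcap_{s<m}C([0,T];H^s(\Omega))$ and $\sqrt{k/\omega}\,\partial_x^{m+1}u,\ \sqrt{k/\omega}\,\partial_x^{m+1}\omega,\ \sqrt{k/\omega}\,\partial_x^{m+1}\sqrt{k}\in L^2([0,T];L^2(\Omega))$, for all $T$ smaller than its lifespan $T^*\in(0,+\infty]$ (the supremum of the times $T$ for which such a solution exists on $[0,T]\times\Omega$). The lifespan does not depend on $m$. "Blows up in finite time" means $T^*<+\infty$. *)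

theory Defs
  imports "HOL-Analysis.Analysis"
begin

section \<open>Functions on the torus\<close>

text \<open>
  Functions on the torus are \<open>2 * pi\<close>-periodic functions on the real line, and integrals over the
  torus are integrals over one period.
\<close>

definition periodic :: "(real \<Rightarrow> 'a) \<Rightarrow> bool" where
  "periodic f \<longleftrightarrow> (\<forall>x. f (x + 2 * pi) = f x)"

definition smooth_torus :: "(real \<Rightarrow> real) \<Rightarrow> bool" where
  "smooth_torus f \<longleftrightarrow> periodic f \<and> (\<forall>n. ((deriv ^^ n) f) differentiable_on UNIV)"

definition L2_torus :: "(real \<Rightarrow> real) \<Rightarrow> bool" where
  "L2_torus f \<longleftrightarrow> periodic f \<and> f \<in> borel_measurable borel \<and>
     set_integrable lborel {-pi..pi} (\<lambda>x. (f x)\<^sup>2)"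

definition fourier_coeff :: "(real \<Rightarrow> real) \<Rightarrow> int \<Rightarrow> complex" where
  "fourier_coeff f n =
     (LINT x:{-pi..pi}|lborel. of_real (f x) * cis (- (of_int n * x))) / of_real (2 * pi)"

text \<open>
  The Sobolev space \<open>H\<^sup>s\<close> of the torus for real \<open>s \<ge> 0\<close>, where all its elements are square
  integrable functions.
\<close>

definition sobolev :: "real \<Rightarrow> (real \<Rightarrow> real) \<Rightarrow> bool" where
  "sobolev s f \<longleftrightarrow> L2_torus f \<and>
     (\<lambda>n::int. (1 + (of_int n)\<^sup>2) powr s * (cmod (fourier_coeff f n))\<^sup>2) summable_on UNIV"

definition sobolev_norm :: "real \<Rightarrow> (real \<Rightarrow> real) \<Rightarrow> real" where
  "sobolev_norm s f =
     sqrt (\<Sum>\<^sub>\<infinity>n::int. (1 + (of_int n)\<^sup>2) powr s * (cmod (fourier_coeff f n))\<^sup>2)"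

definition weak_deriv :: "nat \<Rightarrow> (real \<Rightarrow> real) \<Rightarrow> (real \<Rightarrow> real) \<Rightarrow> bool" where
  "weak_deriv m f h \<longleftrightarrow> (\<forall>\<phi>. smooth_torus \<phi> \<longrightarrow>
     (LINT x:{-pi..pi}|lborel. h x * \<phi> x) =
     (- 1) ^ m * (LINT x:{-pi..pi}|lborel. f x * (deriv ^^ m) \<phi> x))"

text \<open>
  \<open>weighted_deriv m a f g\<close> means that \<open>g\<close> is the distribution \<open>a \<partial>\<^sub>x\<^sup>m\<^sup>+\<^sup>1 f\<close>, for \<open>f\<close> in \<open>H\<^sup>m\<close> and a
  continuously differentiable weight \<open>a\<close>. As \<open>\<partial>\<^sub>x\<^sup>m\<^sup>+\<^sup>1 f\<close> is in general only in \<open>H\<^sup>-\<^sup>1\<close>, the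
  product is the one defined by duality: its action on \<open>\<phi>\<close> is the action of
  \<open>\<partial>\<^sub>x\<^sup>m\<^sup>+\<^sup>1 f\<close> on \<open>a \<phi>\<close>, that is, minus the integral of \<open>\<partial>\<^sub>x\<^sup>m f\<close> against \<open>\<partial>\<^sub>x(a \<phi>)\<close>.
\<close>

definition weighted_deriv ::
    "nat \<Rightarrow> (real \<Rightarrow> real) \<Rightarrow> (real \<Rightarrow> real) \<Rightarrow> (real \<Rightarrow> real) \<Rightarrow> bool" where
  "weighted_deriv m a f g \<longleftrightarrow> (\<exists>h. L2_torus h \<and> weak_deriv m f h \<and>
     (\<forall>\<phi>. smooth_torus \<phi> \<longrightarrow>
        (LINT x:{-pi..pi}|lborel. g x * \<phi> x) =
        - (LINT x:{-pi..pi}|lborel. h x * deriv (\<lambda>y. a y * \<phi> y) x)))"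


section \<open>Functions of time and space\<close>

text \<open>Such a function is curried: \<open>u t\<close> is the function on the torus at time \<open>t\<close>.\<close>

definition C_sobolev :: "real \<Rightarrow> real \<Rightarrow> (real \<Rightarrow> real \<Rightarrow> real) \<Rightarrow> bool" where
  "C_sobolev s T u \<longleftrightarrow> (\<forall>t\<in>{0..T}. sobolev s (u t) \<and>
     ((\<lambda>t'. sobolev_norm s (\<lambda>x. u t' x - u t x)) \<longlongrightarrow> 0) (at t within {0..T}))"

text \<open>
  Measurability in time is required of each Fourier coefficient. Since \<open>H\<^sup>s\<close> is a separable Hilbert
  space, this is the same as strong measurability with values in \<open>H\<^sup>s\<close> (Pettis).
\<close>

definition Linf_sobolev :: "real \<Rightarrow> real \<Rightarrow> (real \<Rightarrow> real \<Rightarrow> real) \<Rightarrow> bool" where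
  "Linf_sobolev s T u \<longleftrightarrow>
     (\<forall>n. set_borel_measurable lborel {0..T} (\<lambda>t. fourier_coeff (u t) n)) \<and>
     (\<exists>C. AE t in lborel. t \<in> {0..T} \<longrightarrow> sobolev s (u t) \<and> sobolev_norm s (u t) \<le> C)"

definition weighted_L2 ::
    "nat \<Rightarrow> real \<Rightarrow> (real \<Rightarrow> real \<Rightarrow> real) \<Rightarrow> (real \<Rightarrow> real \<Rightarrow> real) \<Rightarrow> bool" where
  "weighted_L2 m T a f \<longleftrightarrow> (\<exists>g :: real \<Rightarrow> real \<Rightarrow> real.
     (\<lambda>(t, x). g t x) \<in> borel_measurable borel \<and>
     set_integrable lborel ({0..T} \<times> {-pi..pi}) (\<lambda>(t, x). (g t x)\<^sup>2) \<and>
     (AE t in lborel. t \<in> {0..T} \<longrightarrow> weighted_deriv m (a t) (f t) (g t)))"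

text \<open>
  Every element of \<open>H\<^sup>s\<close> with \<open>s > 1/2\<close> has a unique continuous representative, and this is the
  representative that is used; for \<open>s > 3/2\<close> it is continuously differentiable.
\<close>

definition regular :: "nat \<Rightarrow> real \<Rightarrow> (real \<Rightarrow> real \<Rightarrow> real) \<Rightarrow> (real \<Rightarrow> real \<Rightarrow> real) \<Rightarrow> bool" where
  "regular m T a f \<longleftrightarrow>
     (\<forall>t\<in>{0..T}. continuous_on UNIV (f t)) \<and>
     Linf_sobolev (real m) T f \<and>
     (\<forall>s. 0 \<le> s \<and> s < real m \<longrightarrow> C_sobolev s T f) \<and>
     weighted_L2 m T a f"


section \<open>Equations in the sense of distributions\<close>

definition partial_t :: "(real \<times> real \<Rightarrow> real) \<Rightarrow> real \<times> real \<Rightarrow> real" where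
  "partial_t \<phi> = (\<lambda>(t, x). deriv (\<lambda>s. \<phi> (s, x)) t)"

definition partial_x :: "(real \<times> real \<Rightarrow> real) \<Rightarrow> real \<times> real \<Rightarrow> real" where
  "partial_x \<phi> = (\<lambda>(t, x). deriv (\<lambda>y. \<phi> (t, y)) x)"

text \<open>
  Test functions on \<open>(0,T)\<close> times the torus. Smoothness: all iterated partial derivatives, in any
  order, are (totally) differentiable.
\<close>

definition test_fun :: "real \<Rightarrow> (real \<times> real \<Rightarrow> real) \<Rightarrow> bool" where
  "test_fun T \<phi> \<longleftrightarrow>
     (\<forall>Ds. set Ds \<subseteq> {partial_t, partial_x} \<longrightarrow> (foldr (\<lambda>D g. D g) Ds \<phi>) differentiable_on UNIV) \<and>
     (\<forall>t. periodic (\<lambda>x. \<phi> (t, x))) \<and>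
     (\<exists>a b. 0 < a \<and> b < T \<and> (\<forall>t x. t \<notin> {a..b} \<longrightarrow> \<phi> (t, x) = 0))"

text \<open>\<open>distr_eq T f g h\<close>: the equation \<open>\<partial>\<^sub>t f + g = \<partial>\<^sub>x h\<close> on \<open>(0,T)\<close> times the torus.\<close>

definition distr_eq ::
    "real \<Rightarrow> (real \<Rightarrow> real \<Rightarrow> real) \<Rightarrow> (real \<Rightarrow> real \<Rightarrow> real) \<Rightarrow> (real \<Rightarrow> real \<Rightarrow> real) \<Rightarrow> bool" where
  "distr_eq T f g h \<longleftrightarrow> (\<forall>\<phi>. test_fun T \<phi> \<longrightarrow>
     (let F = (\<lambda>(t, x). - f t x * partial_t \<phi> (t, x) + g t x * \<phi> (t, x) + h t x * partial_x \<phi> (t, x))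
      in set_integrable lborel ({0..T} \<times> {-pi..pi}) F \<and>
         (LINT p:{0..T} \<times> {-pi..pi}|lborel. F p) = 0))"


section \<open>The Kolmogorov system\<close>

definition admissible ::
    "nat \<Rightarrow> (real \<Rightarrow> real) \<Rightarrow> (real \<Rightarrow> real) \<Rightarrow> (real \<Rightarrow> real) \<Rightarrow> bool" where
  "admissible m u0 \<omega>0 k0 \<longleftrightarrow>
     continuous_on UNIV u0 \<and> continuous_on UNIV \<omega>0 \<and> continuous_on UNIV k0 \<and>
     sobolev (real m) u0 \<and> sobolev (real m) \<omega>0 \<and> sobolev (real m) k0 \<and>
     (\<exists>wl wu. 0 < wl \<and> (\<forall>x. wl \<le> \<omega>0 x \<and> \<omega>0 x \<le> wu)) \<and>
     (\<forall>x. 0 \<le> k0 x) \<and> sobolev (real m) (\<lambda>x. sqrt (k0 x))"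

definition kolmogorov_solution ::
    "real \<Rightarrow> real \<Rightarrow> real \<Rightarrow> real \<Rightarrow> real \<Rightarrow> nat \<Rightarrow> real \<Rightarrow>
     (real \<Rightarrow> real) \<Rightarrow> (real \<Rightarrow> real) \<Rightarrow> (real \<Rightarrow> real) \<Rightarrow>
     (real \<Rightarrow> real \<Rightarrow> real) \<Rightarrow> (real \<Rightarrow> real \<Rightarrow> real) \<Rightarrow> (real \<Rightarrow> real \<Rightarrow> real) \<Rightarrow> bool" where
  "kolmogorov_solution \<nu> \<alpha>1 \<alpha>2 \<alpha>3 \<alpha>4 m T u0 \<omega>0 k0 u \<omega> k \<longleftrightarrow>
     u 0 = u0 \<and> \<omega> 0 = \<omega>0 \<and> k 0 = k0 \<and>
     (\<forall>t\<in>{0..T}. \<forall>x. 0 < \<omega> t x \<and> 0 \<le> k t x) \<and>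
     (let a = (\<lambda>t x. sqrt (k t x / \<omega> t x)) in
        regular m T a u \<and> regular m T a \<omega> \<and> regular m T a (\<lambda>t x. sqrt (k t x))) \<and>
     distr_eq T u
       (\<lambda>t x. u t x * deriv (u t) x)
       (\<lambda>t x. \<nu> * (k t x / \<omega> t x * deriv (u t) x)) \<and>
     distr_eq T \<omega>
       (\<lambda>t x. u t x * deriv (\<omega> t) x + \<alpha>2 * (\<omega> t x)\<^sup>2)
       (\<lambda>t x. \<alpha>1 * (k t x / \<omega> t x * deriv (\<omega> t) x)) \<and>
     distr_eq T k
       (\<lambda>t x. u t x * deriv (k t) x + k t x * \<omega> t x
                - \<alpha>4 * (k t x / \<omega> t x * \<bar>deriv (u t) x\<bar>\<^sup>2))
       (\<lambda>t x. \<alpha>3 * (k t x / \<omega> t x * deriv (k t) x))"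

definition lifespan ::
    "real \<Rightarrow> real \<Rightarrow> real \<Rightarrow> real \<Rightarrow> real \<Rightarrow> nat \<Rightarrow>
     (real \<Rightarrow> real) \<Rightarrow> (real \<Rightarrow> real) \<Rightarrow> (real \<Rightarrow> real) \<Rightarrow> ereal" where
  "lifespan \<nu> \<alpha>1 \<alpha>2 \<alpha>3 \<alpha>4 m u0 \<omega>0 k0 =
     Sup (ereal ` {T. 0 < T \<and> (\<exists>u \<omega> k. kolmogorov_solution \<nu> \<alpha>1 \<alpha>2 \<alpha>3 \<alpha>4 m T u0 \<omega>0 k0 u \<omega> k)})"

end

theory Submission
  imports Defs
begin

text \<open>
  Take \<open>u\<^sub>0 = sin\<close>, \<open>\<omega>\<^sub>0 = 1\<close>, \<open>k\<^sub>0 = 0\<close>. Integrating the third equation over the torus gives a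
  Gronwall inequality for the integral of \<open>k\<close>, so \<open>k\<close> stays zero, the diffusion disappears and \<open>u\<close> solves
  Burgers' equation. It is therefore constant along the lines \<open>x\<^sub>0 + t sin x\<^sub>0\<close>, and those that start
  from \<open>\<pi>/2\<close> and \<open>3\<pi>/2\<close> with the values \<open>1\<close> and \<open>-1\<close> meet at time \<open>\<pi>/2\<close>. Before time 1 the lines form a
  diffeomorphism of the torus, whose inverse gives a smooth solution, with \<open>\<omega> = 1/(1 + \<alpha>\<^sub>2 t)\<close>.
\<close>

section \<open>Fourier series on the torus\<close>

text \<open>The lifespan is a supremum over all weak solutions of the Sobolev class, so its
  finiteness requires an argument about an arbitrary solution; no uniqueness theorem is invoked.
  Classical reasoning becomes possible because m \<ge> 2 leaves room for an exponent below m and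
  above 3/2: continuity in time with values in that Sobolev space makes the functions and their
  x-derivatives jointly continuous. The equations are then integrated in time, a form without second
  x-derivatives: testing with 1 removes the flux from the equation for k, and k = 0 removes it from
  the equation for u. The gradient of the Burgers solution blows up already at time 1, but the usual
  computation along a line differentiates the equation once more. Two explicit lines crossing later
  give a weaker bound that needs only C^1, and an upper bound is enough. The supremum of an empty
  set of times is -\<infinity>, which is trivially below \<infinity>; hence the construction of an
  actual solution for a short time. There k = 0 makes the weight sqrt(k/\<omega>) vanish, so zero
  serves as the weighted derivative of order m + 1.\<close>

lemma periodic_D: "periodic f \<Longrightarrow> f (x + 2 * pi) = f x"
  by (simp add: periodic_def)

lemma periodic_shift_int:
  assumes "periodic f"
  shows "f (x + 2 * pi * of_int n) = f x"
proof -
  have nat_case: "f (y + 2 * pi * real m) = f y" for y m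
  proof (induction m)
    case (Suc m)
    have "f (y + 2 * pi * real (Suc m)) = f (y + 2 * pi * real m + 2 * pi)"
      by (simp add: algebra_simps)
    then show ?case using Suc periodic_D[OF assms] by simp
  qed simp
  show ?thesis
  proof (cases "n \<ge> 0")
    case True
    then show ?thesis using nat_case[of x "nat n"] by simp
  next
    case False
    then show ?thesis using nat_case[of "x + 2 * pi * of_int n" "nat (- n)"] by simp
  qed
qed

lemma periodic_representative:
  obtains n :: int where "x + 2 * pi * of_int n \<in> {-pi..pi}"
proof -
  define n where "n = - \<lfloor>(x + pi) / (2 * pi)\<rfloor>"
  have "of_int (- n) \<le> (x + pi) / (2 * pi)" "(x + pi) / (2 * pi) < of_int (- n) + 1"
    by (simp_all add: n_def)
  then have "of_int (- n) * (2 * pi) \<le> x + pi" "x + pi < (of_int (- n) + 1) * (2 * pi)"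
    by (simp_all add: pos_le_divide_eq pos_divide_less_eq)
  then have "x + 2 * pi * of_int n \<in> {-pi..pi}"
    by (simp add: algebra_simps)
  then show ?thesis by (rule that)
qed

lemma periodic_all_iff:
  assumes "periodic f"
  shows "(\<forall>x. P (f x)) \<longleftrightarrow> (\<forall>x\<in>{-pi..pi}. P (f x))"
  by (metis assms periodic_representative periodic_shift_int)

lemma set_integrable_continuous:
  fixes f :: "'a::euclidean_space \<Rightarrow> 'b::euclidean_space"
  assumes "compact S" "continuous_on S f"
  shows "set_integrable lborel S f"
  using borel_integrable_compact[OF assms] by (simp add: set_integrable_def)

lemma LINT_continuous:
  fixes f :: "'a::euclidean_space \<Rightarrow> 'b::euclidean_space"
  assumes "compact S" "continuous_on S f"
  shows "(LINT x:S|lborel. f x) = integral S f"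
  using set_borel_integral_eq_integral(2)[OF set_integrable_continuous[OF assms]] .

lemma fourier_coeff_integral:
  assumes "continuous_on {-pi..pi} f"
  shows "fourier_coeff f n =
    integral {-pi..pi} (\<lambda>x. of_real (f x) * cis (- (of_int n * x))) / of_real (2 * pi)"
  unfolding fourier_coeff_def
  by (subst LINT_continuous) (auto intro!: continuous_intros assms)

text \<open>Generated by monomials and sums rather than given by a coefficient sequence, so that
  integrals against a fixed function reduce to monomials by rule induction.\<close>

inductive trig_poly :: "(real \<Rightarrow> complex) \<Rightarrow> bool" where
  monom: "trig_poly (\<lambda>x. c * cis (of_int n * x))"
| add: "trig_poly p \<Longrightarrow> trig_poly q \<Longrightarrow> trig_poly (\<lambda>x. p x + q x)"

lemma trig_poly_mult:
  assumes "trig_poly p" "trig_poly q"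
  shows "trig_poly (\<lambda>x. p x * q x)"
  using assms
proof (induction p)
  case (monom c n)
  from monom.prems show ?case
  proof (induction q)
    case (monom d m)
    have "(\<lambda>x. c * cis (of_int n * x) * (d * cis (of_int m * x))) =
      (\<lambda>x. (c * d) * cis (of_int (n + m) * x))"
      by (simp add: fun_eq_iff cis_mult[symmetric] distrib_right)
    then show ?case by (metis trig_poly.monom)
  next
    case (add p q)
    then show ?case using trig_poly.add by (simp add: distrib_left)
  qed
next
  case (add p q)
  then show ?case using trig_poly.add by (simp add: distrib_right)
qed

lemma trig_poly_const: "trig_poly (\<lambda>x. c)"
  using trig_poly.monom[of c 0] by simp

text \<open>Real polynomial functions are generated by real-linear functionals. On the unit circle
  such a functional is a combination of \<open>cos x\<close> and \<open>sin x\<close>, hence of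
  \<open>cis x\<close> and \<open>cis (- x)\<close>. This links Stone-Weierstrass on the circle to
  trigonometric polynomials.\<close>

lemma trig_poly_real_polynomial_function:
  fixes P :: "complex \<Rightarrow> real"
  assumes "real_polynomial_function P"
  shows "trig_poly (\<lambda>x. of_real (P (cis x)))"
  using assms
proof induction
  case (linear f)
  have lin: "f (cis x) = f 1 * cos x + f \<i> * sin x" for x
  proof -
    interpret f: bounded_linear f by fact
    have "cis x = cos x *\<^sub>R 1 + sin x *\<^sub>R \<i>" by (simp add: complex_eq_iff)
    then show ?thesis by (simp add: f.add f.scale)
  qed
  have "of_real (f (cis x)) = (of_real (f 1) - \<i> * of_real (f \<i>)) / 2 * cis (of_int 1 * x) +
      (of_real (f 1) + \<i> * of_real (f \<i>)) / 2 * cis (of_int (-1) * x)" for x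
    unfolding lin by (simp add: complex_eq_iff field_simps)
  then have "(\<lambda>x. of_real (f (cis x))) =
      (\<lambda>x. (of_real (f 1) - \<i> * of_real (f \<i>)) / 2 * cis (of_int 1 * x) +
      (of_real (f 1) + \<i> * of_real (f \<i>)) / 2 * cis (of_int (-1) * x))"
    by (rule ext)
  then show ?case
    by (simp only: trig_poly.add[OF trig_poly.monom trig_poly.monom])
next
  case (const c)
  show ?case by (rule trig_poly_const)
next
  case (add f g)
  then show ?case using trig_poly.add by simp
next
  case (mult f g)
  then show ?case using trig_poly_mult by simp
qed

lemma trig_poly_continuous: "trig_poly p \<Longrightarrow> continuous_on A p"
  by (induction rule: trig_poly.induct) (auto intro!: continuous_intros)

lemma integral_mult_trig_poly_eq_0:
  fixes v :: "real \<Rightarrow> complex"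
  assumes "trig_poly p" and "continuous_on {-pi..pi} v"
    and "\<And>n. integral {-pi..pi} (\<lambda>x. v x * cis (of_int n * x)) = 0"
  shows "integral {-pi..pi} (\<lambda>x. v x * p x) = 0"
  using assms(1)
proof induction
  case (monom c n)
  have "integral {-pi..pi} (\<lambda>x. v x * (c * cis (of_int n * x))) =
      integral {-pi..pi} (\<lambda>x. c * (v x * cis (of_int n * x)))"
    by (simp add: mult_ac)
  also have "\<dots> = 0"
    by (subst integral_mult_right) (simp add: assms(3))
  finally show ?case .
next
  case (add p q)
  have "(\<lambda>x. v x * p x) integrable_on {-pi..pi}" "(\<lambda>x. v x * q x) integrable_on {-pi..pi}"
    using add.hyps assms(2)
    by (auto intro!: integrable_continuous_interval continuous_on_mult[OF assms(2)]
        simp: trig_poly_continuous)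
  then show ?case using add
    by (simp add: distrib_left integral_add)
qed

text \<open>The function is transported to the unit circle through \<open>Arg\<close>, and
  Stone-Weierstrass is applied there.\<close>

lemma periodic_approx_trig_poly:
  fixes v :: "real \<Rightarrow> real"
  assumes "continuous_on UNIV v" "periodic v" "e > 0"
  obtains p where "trig_poly (\<lambda>x. of_real (p x))" "\<And>x. x \<in> {-pi..pi} \<Longrightarrow> \<bar>v x - p x\<bar> < e"
proof -
  define S where "S = sphere (0::complex) 1"
  define F where "F z = v (Arg z)" for z
  have F_cis: "F (cis x) = v x" if "x \<in> {-pi..pi}" for x
  proof (cases "x = -pi")
    case True
    have "cis x = -1" using True by (simp add: complex_eq_iff)
    then have "Arg (cis x) = pi" by (simp add: Arg_eq_pi)
    then show ?thesis using periodic_D[OF assms(2), of "-pi"] True by (simp add: F_def)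
  next
    case False
    then show ?thesis using that by (simp add: F_def Arg_cis)
  qed
  have vimage: "S \<inter> F -` C = cis ` ({-pi..pi} \<inter> v -` C)" for C
  proof (intro equalityI subsetI)
    fix z assume z: "z \<in> S \<inter> F -` C"
    then have "z = cis (Arg z)" using rcis_cmod_Arg[of z] by (simp add: S_def rcis_def)
    moreover have "Arg z \<in> {-pi..pi} \<inter> v -` C"
      using z Arg_bounded[of z] by (auto simp: F_def)
    ultimately show "z \<in> cis ` ({-pi..pi} \<inter> v -` C)" by blast
  next
    fix z assume "z \<in> cis ` ({-pi..pi} \<inter> v -` C)"
    then show "z \<in> S \<inter> F -` C" using F_cis by (auto simp: S_def)
  qed
  have "closed S" by (simp add: S_def)
  \<comment> \<open>\<open>Arg\<close> jumps at -1, so \<open>F\<close> is not a composition of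
    continuous maps. Its closed preimages are images under \<open>cis\<close> of compact subsets of
    the closed period; periodicity of \<open>v\<close> makes the two ends agree.\<close>
  have "continuous_on S F"
    unfolding continuous_on_closed_vimage[OF \<open>closed S\<close>]
  proof (intro allI impI)
    fix C :: "real set" assume "closed C"
    then have "compact ({-pi..pi} \<inter> v -` C)"
      using continuous_closed_vimage[of C v] assms(1)
      by (simp add: compact_Int_closed continuous_on_eq_continuous_at)
    then have "compact (cis ` ({-pi..pi} \<inter> v -` C))"
      by (rule compact_continuous_image[rotated]) (auto intro!: continuous_intros)
    then show "closed (F -` C \<inter> S)"
      by (metis vimage compact_imp_closed Int_commute)
  qed
  moreover have "compact S" by (simp add: S_def)
  ultimately obtain P where P: "real_polynomial_function P" "\<And>z. z \<in> S \<Longrightarrow> \<bar>F z - P z\<bar> < e"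
    using Stone_Weierstrass_real_polynomial_function[of S F e] assms(3) by blast
  show ?thesis
  proof (rule that)
    show "trig_poly (\<lambda>x. of_real (P (cis x)))"
      by (rule trig_poly_real_polynomial_function) fact
    show "\<bar>v x - P (cis x)\<bar> < e" if "x \<in> {-pi..pi}" for x
      using P(2)[of "cis x"] F_cis[OF that] by (simp add: S_def)
  qed
qed

text \<open>Let w be the real part of \<open>v\<close>. It is orthogonal to every real trigonometric
  polynomial p, so the integral of w^2 equals that of w (w - p), which is at most e times the
  integral of |w| for any e > 0. The complex form is needed because the function tested later is
  \<open>f\<close> minus the sum of its Fourier series, not yet known to be real.\<close>

lemma fourier_unique_Re:
  fixes v :: "real \<Rightarrow> complex"
  assumes cont: "continuous_on UNIV v" and per: "periodic v"
    and zero: "\<And>n. integral {-pi..pi} (\<lambda>x. v x * cis (of_int n * x)) = 0"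
  shows "Re (v x) = 0"
proof -
  define w where "w x = Re (v x)" for x
  have w_cont: "continuous_on A w" for A
    unfolding w_def by (intro continuous_intros continuous_on_subset[OF cont]) auto
  have w_per: "periodic w" using per by (simp add: periodic_def w_def)
  define I where "I = integral {-pi..pi} (\<lambda>x. \<bar>w x\<bar>)"
  define J where "J = integral {-pi..pi} (\<lambda>x. (w x)\<^sup>2)"
  have "I \<ge> 0" unfolding I_def by (rule integral_nonneg) (auto intro!: integrable_continuous_interval continuous_intros w_cont)
  have J: "J \<le> e * I" if e: "e > 0" for e
  proof -
    obtain p where p: "trig_poly (\<lambda>x. of_real (p x))" "\<And>x. x \<in> {-pi..pi} \<Longrightarrow> \<bar>w x - p x\<bar> < e"
      using periodic_approx_trig_poly[OF w_cont[of UNIV] w_per e] by blast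
    have p_cont: "continuous_on {-pi..pi} p"
      using continuous_on_Re[OF trig_poly_continuous[OF p(1)]] by simp
    have v_cont: "continuous_on {-pi..pi} v" using cont continuous_on_subset by blast
    have 0: "integral {-pi..pi} (\<lambda>x. v x * of_real (p x)) = 0"
      by (rule integral_mult_trig_poly_eq_0[OF p(1) v_cont zero])
    have "(\<lambda>x. v x * of_real (p x)) integrable_on {-pi..pi}"
      by (intro integrable_continuous_interval continuous_intros v_cont p_cont)
    from integral_linear[OF this bounded_linear_Re]
    have wp: "integral {-pi..pi} (\<lambda>x. w x * p x) = 0"
      by (simp add: 0 o_def w_def)
    have "J = integral {-pi..pi} (\<lambda>x. (w x)\<^sup>2 - w x * p x)"
      unfolding J_def
      by (subst integral_diff)
         (auto intro!: integrable_continuous_interval continuous_intros w_cont p_cont simp: wp)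
    also have "\<dots> \<le> integral {-pi..pi} (\<lambda>x. e * \<bar>w x\<bar>)"
    proof (rule integral_le)
      fix x assume "x \<in> {-pi..pi}"
      have "(w x)\<^sup>2 - w x * p x = w x * (w x - p x)" by (simp add: power2_eq_square algebra_simps)
      also have "\<dots> \<le> \<bar>w x\<bar> * \<bar>w x - p x\<bar>" by (metis abs_ge_self abs_mult)
      also have "\<dots> \<le> \<bar>w x\<bar> * e" using p(2)[OF \<open>x \<in> _\<close>] by (intro mult_left_mono) auto
      finally show "(w x)\<^sup>2 - w x * p x \<le> e * \<bar>w x\<bar>" by (simp add: mult.commute)
    qed (auto intro!: integrable_continuous_interval continuous_intros w_cont p_cont)
    also have "\<dots> = e * I" by (simp add: I_def)
    finally show ?thesis .
  qed
  have "J \<le> 0"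
  proof (rule ccontr)
    assume "\<not> J \<le> 0"
    \<comment> \<open>The summand 1 keeps the chosen e well defined when \<open>I\<close>
      vanishes.\<close>
    have "J \<le> J / (2 * (I + 1)) * I"
      using \<open>\<not> J \<le> 0\<close> \<open>I \<ge> 0\<close> by (intro J divide_pos_pos) auto
    also have "\<dots> \<le> J / 2" using \<open>\<not> J \<le> 0\<close> \<open>I \<ge> 0\<close> by (simp add: field_simps)
    finally show False using \<open>\<not> J \<le> 0\<close> by simp
  qed
  moreover have "J \<ge> 0" unfolding J_def
    by (rule integral_nonneg) (auto intro!: integrable_continuous_interval continuous_intros w_cont)
  ultimately have "J = 0" by simp
  have J0: "((\<lambda>x. (w x)\<^sup>2) has_integral 0) {-pi..pi}"
    unfolding \<open>J = 0\<close>[symmetric] J_def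
    by (rule integrable_integral) (auto intro!: integrable_continuous_interval continuous_intros w_cont)
  have "\<forall>x\<in>{-pi..pi}. w x = 0"
  proof
    fix x assume x: "x \<in> {-pi..pi}"
    have "(w x)\<^sup>2 = 0"
      by (rule has_integral_0_cbox_imp_0[of "-pi" pi "\<lambda>x. (w x)\<^sup>2"])
         (use x J0 in \<open>auto intro!: continuous_intros w_cont simp: box_real not_le\<close>)
    then show "w x = 0" by simp
  qed
  then show ?thesis
    using periodic_all_iff[OF w_per, of "\<lambda>y. y = 0"] by (auto simp: w_def)
qed

lemma fourier_unique:
  fixes v :: "real \<Rightarrow> real"
  assumes "continuous_on UNIV v" and "periodic v"
    and "\<And>n. fourier_coeff v n = 0"
  shows "v x = 0"
proof -
  have "Re (complex_of_real (v x)) = 0"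
  proof (rule fourier_unique_Re[of "\<lambda>x. of_real (v x)" x])
    fix n
    show "integral {-pi..pi} (\<lambda>x. complex_of_real (v x) * cis (of_int n * x)) = 0"
      using assms(3)[of "-n"] continuous_on_subset[OF assms(1), of "{-pi..pi}"]
      by (simp add: fourier_coeff_integral)
  qed (use assms in \<open>auto intro!: continuous_intros simp: periodic_def\<close>)
  then show ?thesis by simp
qed

section \<open>Termwise differentiation of Fourier series\<close>

lemma integral_cis_period:
  "integral {-pi..pi} (\<lambda>x. cis (of_int n * x)) = (if n = 0 then of_real (2 * pi) else 0)"
proof (cases "n = 0")
  case True
  have "integral {-pi..pi} (\<lambda>x. 1 :: complex) = of_real (2 * pi)"
    by (simp add: scaleR_conv_of_real)
  then show ?thesis using True by simp
next
  case False
  have "((\<lambda>x. cis (of_int n * x)) has_integral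
     (cis (of_int n * pi) / (\<i> * of_int n) - cis (of_int n * (-pi)) / (\<i> * of_int n))) {-pi..pi}"
  proof (rule fundamental_theorem_of_calculus)
    fix x
    have "((\<lambda>z. exp (\<i> * of_int n * z) / (\<i> * of_int n)) has_field_derivative
        exp (\<i> * of_int n * of_real x)) (at (of_real x))"
      using False by (auto intro!: derivative_eq_intros)
    from has_vector_derivative_real_field[OF this, of "{-pi..pi}"]
    show "((\<lambda>x. cis (of_int n * x) / (\<i> * of_int n)) has_vector_derivative cis (of_int n * x))
        (at x within {-pi..pi})"
      by (simp add: cis_conv_exp mult.assoc)
  qed simp
  moreover have "cis (of_int n * pi) = cis (of_int n * (-pi))"
    by (simp add: complex_eq_iff sin_zero_iff_int2)
  ultimately show ?thesis using False by (auto dest: integral_unique)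
qed

text \<open>The Japanese bracket of n: the Sobolev weight of order s is its power 2 s, and one
  derivative costs at most one factor of it.\<close>

definition japanese :: "int \<Rightarrow> real" where
  "japanese n = sqrt (1 + (of_int n)\<^sup>2)"

lemma japanese_ge: "1 \<le> japanese n" "\<bar>of_int n\<bar> \<le> japanese n"
  by (auto simp: japanese_def intro: real_le_rsqrt)

lemma japanese_pos [simp]: "0 < japanese n" "0 \<le> japanese n"
  using japanese_ge(1)[of n] by auto

text \<open>The majorant \<open>japanese n * cmod (fourier_coeff f n)\<close> dominates both the
  terms of the Fourier series and their derivatives, so the series converges uniformly to a C^1
  function. That sum has the coefficients of \<open>f\<close> and equals \<open>f\<close> by
  uniqueness; the same majorant yields both bounds by \<open>B\<close>.\<close>

lemma fourier_series_C1:
  assumes cont: "continuous_on UNIV f" and per: "periodic f"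
    and sum: "(\<lambda>n. japanese n * cmod (fourier_coeff f n)) summable_on UNIV"
  defines "B \<equiv> \<Sum>\<^sub>\<infinity>n. japanese n * cmod (fourier_coeff f n)"
  obtains f' where "continuous_on UNIV f'" "\<And>x. (f has_real_derivative f' x) (at x)"
    "\<And>x. \<bar>f x\<bar> \<le> B" "\<And>x. \<bar>f' x\<bar> \<le> B"
proof -
  \<comment> \<open>The M-test and termwise differentiation concern series over the naturals, so the
    integers are enumerated; absolute convergence makes the order irrelevant.\<close>
  define d where "d k = int_decode k" for k
  define a where "a k = fourier_coeff f (d k)" for k
  define M where "M k = japanese (d k) * cmod (a k)" for k
  have bij: "bij_betw d UNIV UNIV" unfolding d_def by (rule bij_int_decode)
  have M_nonneg: "M k \<ge> 0" for k by (simp add: M_def)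
  have M_sum_on: "M summable_on UNIV"
    using summable_on_reindex_bij_betw[OF bij, of "\<lambda>n. japanese n * cmod (fourier_coeff f n)"] sum
    by (simp add: M_def[abs_def] a_def)
  then have M_sum: "summable M"
    using summable_on_UNIV_nonneg_real_iff[of M] M_nonneg by blast
  have "infsum M UNIV = B"
    using infsum_reindex_bij_betw[OF bij, of "\<lambda>n. japanese n * cmod (fourier_coeff f n)"]
    by (simp add: M_def[abs_def] a_def B_def)
  then have M_suminf: "suminf M = B"
    using M_sum_on M_nonneg by (metis has_sum_imp_sums has_sum_infsum sums_unique)
  define g where "g k x = a k * cis (of_int (d k) * x)" for k x
  \<comment> \<open>Differentiating multiplies \<open>g k x\<close> by i times \<open>d k\<close>,
    and the real part of i z is minus the imaginary part of z.\<close>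
  define g' where "g' k x = - of_int (d k) * Im (g k x)" for k x
  have g_bound: "norm (g k x) \<le> M k" for k x
    using mult_right_mono[OF japanese_ge(1)[of "d k"], of "cmod (a k)"]
    by (simp add: g_def M_def norm_mult)
  have g'_bound: "norm (g' k x) \<le> M k" for k x
  proof -
    have "norm (g' k x) = \<bar>of_int (d k)\<bar> * \<bar>Im (g k x)\<bar>" by (simp add: g'_def abs_mult)
    also have "\<dots> \<le> japanese (d k) * cmod (a k)"
      using abs_Im_le_cmod[of "g k x"] japanese_ge(2)[of "d k"]
      by (intro mult_mono) (auto simp: g_def norm_mult)
    finally show ?thesis by (simp add: M_def)
  qed
  have g_unif: "uniform_limit A (\<lambda>n x. \<Sum>i<n. g i x) (\<lambda>x. \<Sum>i. g i x) sequentially" for A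
    by (rule Weierstrass_m_test[OF g_bound M_sum])
  have g'_unif: "uniform_limit A (\<lambda>n x. \<Sum>i<n. g' i x) (\<lambda>x. \<Sum>i. g' i x) sequentially" for A
    by (rule Weierstrass_m_test[OF g'_bound M_sum])
  define G where "G x = (\<Sum>i. g i x)" for x
  have g_cont: "continuous_on A (g k)" for A k
    unfolding g_def by (intro continuous_intros)
  have G_cont: "continuous_on A G" for A
    unfolding G_def
    by (rule uniform_limit_theorem[OF _ g_unif]) (auto intro!: always_eventually continuous_intros g_cont)
  have g'_cont: "continuous_on UNIV (\<lambda>x. \<Sum>i. g' i x)"
    by (rule uniform_limit_theorem[OF _ g'_unif])
       (auto intro!: always_eventually continuous_intros g_cont simp: g'_def)
  have g_per: "periodic (g k)" for k
    using cis_multiple_2pi[of "of_int (d k)"]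
    by (simp add: periodic_def g_def distrib_left cis_mult[symmetric] mult_ac)
  have g_summable: "summable (\<lambda>k. g k x)" for x
    by (rule summable_comparison_test'[OF M_sum g_bound])
  have G_coeff: "integral {-pi..pi} (\<lambda>x. G x * cis (of_int n * x)) = of_real (2 * pi) * fourier_coeff f (- n)"
    for n
  proof -
    have bdd: "bounded (range (\<lambda>x. cis (of_int n * x)))" by (rule boundedI[of _ 1]) auto
    have "uniform_limit {-pi..pi} (\<lambda>N x. (\<Sum>i<N. g i x) * cis (of_int n * x))
        (\<lambda>x. G x * cis (of_int n * x)) sequentially"
      unfolding G_def
    proof (rule uniform_lim_mult[OF g_unif uniform_limit_const])
      show "bounded ((\<lambda>x. \<Sum>i. g i x) ` {-pi..pi})"
        using compact_imp_bounded[OF compact_continuous_image[OF G_cont compact_Icc]]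
        by (simp add: G_def[abs_def])
      show "bounded ((\<lambda>x. cis (of_int n * x)) ` {-pi..pi})"
        using bdd by (rule bounded_subset) auto
    qed
    then obtain I J where IJ: "\<And>N. ((\<lambda>x. (\<Sum>i<N. g i x) * cis (of_int n * x)) has_integral I N) {-pi..pi}"
       "((\<lambda>x. G x * cis (of_int n * x)) has_integral J) {-pi..pi}" "I \<longlonglongrightarrow> J"
      by (rule uniform_limit_integral) (auto intro!: continuous_intros g_cont)
    have gint: "((\<lambda>x. g i x * cis (of_int n * x)) has_integral
        (if d i = - n then of_real (2 * pi) * a i else 0)) {-pi..pi}" for i
    proof -
      have eq: "(\<lambda>x. g i x * cis (of_int n * x)) = (\<lambda>x. a i * cis (of_int (d i + n) * x))"
        by (simp add: g_def fun_eq_iff distrib_right cis_mult[symmetric])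
      have "((\<lambda>x. cis (of_int (d i + n) * x)) has_integral
         (if d i + n = 0 then of_real (2 * pi) else 0)) {-pi..pi}"
        unfolding integral_cis_period[symmetric]
        by (intro integrable_integral integrable_continuous_interval continuous_intros)
      from has_integral_mult_right[OF this, of "a i"] show ?thesis
        unfolding eq by (simp add: add_eq_0_iff2 mult.commute split: if_splits)
    qed
    have "I N = (\<Sum>i<N. if d i = - n then of_real (2 * pi) * a i else 0)" for N
    proof (rule has_integral_unique[OF IJ(1)])
      show "((\<lambda>x. (\<Sum>i<N. g i x) * cis (of_int n * x)) has_integral
          (\<Sum>i<N. if d i = - n then of_real (2 * pi) * a i else 0)) {-pi..pi}"
        unfolding sum_distrib_right by (rule has_integral_sum) (simp_all only: finite_lessThan gint)
    qed
    moreover have "d i = - n \<longleftrightarrow> i = int_encode (- n)" for i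
      unfolding d_def by (metis int_decode_inverse int_encode_inverse)
    \<comment> \<open>By orthogonality only the index of - n contributes, so the integrals of the
      partial sums are constant from there on. The sign comes from pairing with
      \<open>cis (n x)\<close>, while the coefficients are defined with the conjugate.\<close>
    ultimately have I_eq: "I N = of_real (2 * pi) * fourier_coeff f (- n)" if "N > int_encode (- n)" for N
      using that by (simp add: a_def d_def)
    have "eventually (\<lambda>N. I N = of_real (2 * pi) * fourier_coeff f (- n)) sequentially"
      using eventually_gt_at_top[of "int_encode (- n)"] by eventually_elim (rule I_eq)
    then have "I \<longlonglongrightarrow> of_real (2 * pi) * fourier_coeff f (- n)"
      by (rule tendsto_eventually)
    then have "J = of_real (2 * pi) * fourier_coeff f (- n)"
      using IJ(3) LIMSEQ_unique by blast
    then show ?thesis using IJ(2) by (simp add: integral_unique)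
  qed
  have f_eq: "f x = Re (G x)" for x
  proof -
    have "Re (of_real (f x) - G x) = 0"
    proof (rule fourier_unique_Re[of "\<lambda>x. of_real (f x) - G x" x])
      show "continuous_on UNIV (\<lambda>x. of_real (f x) - G x)"
        by (intro continuous_intros cont G_cont)
      show "periodic (\<lambda>x. complex_of_real (f x) - G x)"
        using per g_per by (simp add: periodic_def G_def)
      fix n
      have fc: "continuous_on {-pi..pi} f" using cont continuous_on_subset by blast
      have "integral {-pi..pi} (\<lambda>x. (of_real (f x) - G x) * cis (of_int n * x)) =
         integral {-pi..pi} (\<lambda>x. of_real (f x) * cis (of_int n * x))
         - integral {-pi..pi} (\<lambda>x. G x * cis (of_int n * x))"
        unfolding left_diff_distrib
        by (intro integral_diff integrable_continuous_interval continuous_intros fc G_cont)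
      also have "integral {-pi..pi} (\<lambda>x. of_real (f x) * cis (of_int n * x)) =
         of_real (2 * pi) * fourier_coeff f (- n)"
        by (simp add: fourier_coeff_integral[OF fc])
      finally show "integral {-pi..pi} (\<lambda>x. (of_real (f x) - G x) * cis (of_int n * x)) = 0"
        by (simp add: G_coeff)
    qed
    then show ?thesis by simp
  qed
  have f_series: "f = (\<lambda>x. \<Sum>k. Re (g k x))"
    by (simp add: fun_eq_iff f_eq G_def Re_suminf g_summable)
  have f_bound: "\<bar>f x\<bar> \<le> B" for x
  proof -
    have "\<bar>f x\<bar> \<le> norm (G x)" by (simp add: f_eq abs_Re_le_cmod)
    also have "\<dots> \<le> suminf M" unfolding G_def
      by (rule norm_suminf_le[OF g_bound M_sum])
    finally show ?thesis by (simp add: M_suminf)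
  qed
  have f'_bound: "\<bar>\<Sum>k. g' k x\<bar> \<le> B" for x
    using norm_suminf_le[of "\<lambda>k. g' k x" M, OF g'_bound M_sum] by (simp add: M_suminf)
  have "(f has_real_derivative (\<Sum>k. g' k x)) (at x)" for x
    unfolding f_series
  proof (rule has_field_derivative_series'(2)[where S = UNIV and ?x0.0 = 0])
    show "((\<lambda>x. Re (g k x)) has_real_derivative g' k x) (at x within UNIV)" for k x
      unfolding g_def g'_def by (auto intro!: derivative_eq_intros simp: algebra_simps)
    show "uniformly_convergent_on UNIV (\<lambda>n x. \<Sum>i<n. g' i x)"
      using g'_unif uniformly_convergent_on_def by blast
    show "summable (\<lambda>k. Re (g k 0))"
      by (rule summable_Re[OF g_summable])
  qed auto
  with g'_cont f_bound f'_bound show ?thesis by (intro that)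
qed

section \<open>Sobolev embedding and joint continuity in time and space\<close>

lemma summable_japanese_powr: "(\<lambda>n. japanese n powr (- 3 / 2)) summable_on UNIV"
proof -
  have sum_nat: "summable (\<lambda>k. japanese (int k) powr (- 3 / 2))"
  proof (rule summable_comparison_test')
    show "summable (\<lambda>k. real k powr (- 3 / 2))" by (simp add: summable_real_powr_iff)
    show "norm (japanese (int k) powr (- 3 / 2)) \<le> real k powr (- 3 / 2)" if "k \<ge> 1" for k
      using that japanese_ge(2)[of "int k"] by (auto intro!: powr_mono2')
  qed
  then have nat: "(\<lambda>k. japanese (int k) powr (- 3 / 2)) summable_on UNIV"
    by (subst summable_on_UNIV_nonneg_real_iff) auto
  have "(\<lambda>n. japanese n powr (- 3 / 2)) summable_on (range int)"
    by (subst summable_on_reindex) (use nat in \<open>auto simp: o_def\<close>)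
  moreover have "(\<lambda>n. japanese n powr (- 3 / 2)) summable_on (range (\<lambda>k. - int k))"
    by (subst summable_on_reindex) (use nat in \<open>auto simp: o_def inj_def japanese_def\<close>)
  ultimately have "(\<lambda>n. japanese n powr (- 3 / 2)) summable_on (range int \<union> range (\<lambda>k. - int k))"
    by (rule summable_on_union)
  moreover have "range int \<union> range (\<lambda>k. - int k) = UNIV"
    by (auto simp: image_iff) (metis int_cases2)
  ultimately show ?thesis by simp
qed

text \<open>The l^2 norm of the -3/4 powers of the bracket, where -3/4 = 1 - 7/4. It is the
  Cauchy-Schwarz constant of the embedding, and it returns later when Sobolev norms are bounded by
  decay of coefficients.\<close>

definition embedding_const :: real where
  "embedding_const = sqrt (\<Sum>\<^sub>\<infinity>n. japanese n powr (- 3 / 2))"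

text \<open>The exponent \<open>7/4\<close> lies between \<open>3/2\<close>, the embedding threshold, and every \<open>m \<ge> 2\<close>.\<close>

lemma sobolev_embedding_sum:
  assumes "sobolev (7/4) f"
  shows "(\<lambda>n. japanese n * cmod (fourier_coeff f n)) summable_on UNIV"
    and "(\<Sum>\<^sub>\<infinity>n. japanese n * cmod (fourier_coeff f n)) \<le> embedding_const * sobolev_norm (7/4) f"
proof -
  define c where "c n = cmod (fourier_coeff f n)" for n
  define q where "q n = (1 + (of_int n)\<^sup>2) powr (7/4) * (c n)\<^sup>2" for n :: int
  have q: "q summable_on UNIV" using assms by (simp add: sobolev_def q_def[abs_def] c_def)
  have jsq: "1 + (of_int n)\<^sup>2 = (japanese n)\<^sup>2" for n by (simp add: japanese_def)
  have qj: "q n = (japanese n powr (7/4) * c n)\<^sup>2" for n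
    by (simp add: q_def jsq power_mult_distrib) (simp add: power2_eq_square powr_mult)
  have bound: "(\<Sum>n\<in>F. japanese n * c n) \<le> embedding_const * sobolev_norm (7/4) f" if "finite F" for F
  proof -
    \<comment> \<open>One derivative is split as -3/4 + 7/4: the first factor is square summable
      over the integers, the second is the Sobolev weight of order 7/4.\<close>
    have "(\<Sum>n\<in>F. japanese n * c n) = (\<Sum>n\<in>F. japanese n powr (-3/4) * (japanese n powr (7/4) * c n))"
      by (simp add: mult.assoc[symmetric] powr_add[symmetric])
    also have "\<dots> \<le> sqrt (\<Sum>n\<in>F. (japanese n powr (-3/4))\<^sup>2) * sqrt (\<Sum>n\<in>F. (japanese n powr (7/4) * c n)\<^sup>2)"
      using Cauchy_Schwarz_ineq_sum[of "\<lambda>n. japanese n powr (-3/4)" "\<lambda>n. japanese n powr (7/4) * c n" F]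
      by (simp add: real_le_rsqrt real_sqrt_mult[symmetric])
    also have "(\<Sum>n\<in>F. (japanese n powr (-3/4))\<^sup>2) = (\<Sum>n\<in>F. japanese n powr (- 3 / 2))"
      by (simp add: power2_eq_square powr_add[symmetric])
    also have "sqrt \<dots> * sqrt (\<Sum>n\<in>F. (japanese n powr (7/4) * c n)\<^sup>2) \<le>
        embedding_const * sobolev_norm (7/4) f"
      unfolding embedding_const_def sobolev_norm_def
    proof (intro mult_mono real_sqrt_le_mono)
      show "(\<Sum>n\<in>F. japanese n powr (- 3 / 2)) \<le> (\<Sum>\<^sub>\<infinity>n. japanese n powr (- 3 / 2))"
        by (rule finite_sum_le_infsum[OF summable_japanese_powr that]) auto
      show "(\<Sum>n\<in>F. (japanese n powr (7/4) * c n)\<^sup>2) \<le>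
          (\<Sum>\<^sub>\<infinity>n. (1 + (real_of_int n)\<^sup>2) powr (7/4) * (cmod (fourier_coeff f n))\<^sup>2)"
        unfolding qj[symmetric]
        using finite_sum_le_infsum[OF q that] by (simp add: q_def[abs_def] c_def)
    qed (auto intro!: sum_nonneg infsum_nonneg)
    finally show ?thesis .
  qed
  show s: "(\<lambda>n. japanese n * cmod (fourier_coeff f n)) summable_on UNIV"
    by (rule nonneg_bdd_above_summable_on) (use bound in \<open>auto intro!: bdd_aboveI2 simp: c_def\<close>)
  show "(\<Sum>\<^sub>\<infinity>n. japanese n * cmod (fourier_coeff f n)) \<le> embedding_const * sobolev_norm (7/4) f"
    by (rule infsum_le_finite_sums[OF s]) (use bound in \<open>auto simp: c_def\<close>)
qed

text \<open>Fourier coefficients determine a function only almost everywhere; the assumed continuity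
  selects the representative for which pointwise statements hold.\<close>

lemma sobolev_embedding:
  assumes "continuous_on UNIV f" and "sobolev (7/4) f"
  shows "(f has_real_derivative deriv f x) (at x)"
    and "continuous_on UNIV (deriv f)"
    and "\<bar>f x\<bar> \<le> embedding_const * sobolev_norm (7/4) f"
    and "\<bar>deriv f x\<bar> \<le> embedding_const * sobolev_norm (7/4) f"
proof -
  have per: "periodic f" using assms(2) by (simp add: sobolev_def L2_torus_def)
  obtain f' where f': "continuous_on UNIV f'" "\<And>x. (f has_real_derivative f' x) (at x)"
    "\<And>x. \<bar>f x\<bar> \<le> (\<Sum>\<^sub>\<infinity>n. japanese n * cmod (fourier_coeff f n))"
    "\<And>x. \<bar>f' x\<bar> \<le> (\<Sum>\<^sub>\<infinity>n. japanese n * cmod (fourier_coeff f n))"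
    using fourier_series_C1[OF assms(1) per sobolev_embedding_sum(1)[OF assms(2)]] by metis
  have deriv: "deriv f = f'" using f'(2) by (auto intro: DERIV_imp_deriv)
  show "(f has_real_derivative deriv f x) (at x)" "continuous_on UNIV (deriv f)"
    using f' deriv by auto
  show "\<bar>f x\<bar> \<le> embedding_const * sobolev_norm (7/4) f"
    "\<bar>deriv f x\<bar> \<le> embedding_const * sobolev_norm (7/4) f"
    using f'(3,4)[of x] sobolev_embedding_sum(2)[OF assms(2)] deriv by auto
qed

lemma L2_torus_continuous:
  assumes "continuous_on UNIV f" "periodic f"
  shows "L2_torus f"
  unfolding L2_torus_def
  using assms borel_measurable_continuous_onI[of f]
  by (auto intro!: set_integrable_continuous continuous_intros intro: continuous_on_subset)

lemma fourier_coeff_diff: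
  assumes "continuous_on UNIV f" "continuous_on UNIV g"
  shows "fourier_coeff (\<lambda>x. f x - g x) n = fourier_coeff f n - fourier_coeff g n"
proof -
  have c: "continuous_on {-pi..pi} f" "continuous_on {-pi..pi} g"
    using assms continuous_on_subset by blast+
  show ?thesis
    by (simp add: fourier_coeff_integral c continuous_on_diff left_diff_distrib diff_divide_distrib)
       (subst integral_diff, auto intro!: integrable_continuous_interval continuous_intros c simp: diff_divide_distrib)
qed

text \<open>Membership has to be known separately: outside the space the infinite sum defaults to 0,
  so a small \<open>sobolev_norm\<close> of a difference would carry no information by
  itself.\<close>

lemma sobolev_diff:
  assumes "continuous_on UNIV f" "continuous_on UNIV g" "sobolev s f" "sobolev s g"
  shows "sobolev s (\<lambda>x. f x - g x)"
  unfolding sobolev_def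
proof
  show "L2_torus (\<lambda>x. f x - g x)"
    using assms by (intro L2_torus_continuous continuous_intros)
      (auto simp: sobolev_def L2_torus_def periodic_def)
  let ?w = "\<lambda>n::int. (1 + (real_of_int n)\<^sup>2) powr s"
  have "(\<lambda>n. 2 * (?w n * (cmod (fourier_coeff f n))\<^sup>2) + 2 * (?w n * (cmod (fourier_coeff g n))\<^sup>2)) summable_on UNIV"
    using assms(3,4) by (intro summable_on_add summable_on_cmult_right) (auto simp: sobolev_def)
  then show "(\<lambda>n. ?w n * (cmod (fourier_coeff (\<lambda>x. f x - g x) n))\<^sup>2) summable_on UNIV"
  proof (rule summable_on_comparison_test)
    fix n
    let ?a = "fourier_coeff f n" and ?b = "fourier_coeff g n"
    have "(cmod (?a - ?b))\<^sup>2 \<le> (cmod ?a + cmod ?b)\<^sup>2"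
      by (intro power_mono norm_triangle_ineq4) auto
    also have "\<dots> \<le> 2 * (cmod ?a)\<^sup>2 + 2 * (cmod ?b)\<^sup>2"
      using sum_squares_bound[of "cmod ?a" "cmod ?b"] by (simp add: power2_sum)
    finally have "?w n * (cmod (?a - ?b))\<^sup>2 \<le> ?w n * (2 * (cmod ?a)\<^sup>2 + 2 * (cmod ?b)\<^sup>2)"
      by (intro mult_left_mono) auto
    then show "?w n * (cmod (fourier_coeff (\<lambda>x. f x - g x) n))\<^sup>2 \<le>
        2 * (?w n * (cmod ?a)\<^sup>2) + 2 * (?w n * (cmod ?b)\<^sup>2)"
      by (simp add: fourier_coeff_diff assms(1,2) algebra_simps)
  qed auto
qed

lemma continuous_on_Times_uniform:
  fixes f :: "real \<Rightarrow> real \<Rightarrow> real"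
  assumes cont: "\<And>t. t \<in> A \<Longrightarrow> continuous_on UNIV (f t)"
    and unif: "\<And>t. t \<in> A \<Longrightarrow> uniform_limit UNIV f (f t) (at t within A)"
  shows "continuous_on (A \<times> UNIV) (\<lambda>(t, x). f t x)"
  unfolding continuous_on_iff
proof (intro ballI allI impI)
  fix p :: "real \<times> real" and e :: real
  assume "p \<in> A \<times> UNIV" and e: "e > 0"
  then obtain t x where p: "p = (t, x)" and t: "t \<in> A" by auto
  have "eventually (\<lambda>t'. \<forall>y. dist (f t' y) (f t y) < e / 2) (at t within A)"
    using uniform_limitD[OF unif[OF t], of "e/2"] e by simp
  then obtain d1 where d1: "d1 > 0" "\<And>t' y. t' \<in> A \<Longrightarrow> t' \<noteq> t \<Longrightarrow> dist t' t < d1 \<Longrightarrow> dist (f t' y) (f t y) < e / 2"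
    unfolding eventually_at by auto
  obtain d2 where d2: "d2 > 0" "\<And>y. dist y x < d2 \<Longrightarrow> dist (f t y) (f t x) < e / 2"
    using cont[OF t, unfolded continuous_on_iff, rule_format, of x "e/2"] e by auto
  show "\<exists>d>0. \<forall>x'\<in>A \<times> UNIV. dist x' p < d \<longrightarrow>
      dist (case x' of (t, x) \<Rightarrow> f t x) (case p of (t, x) \<Rightarrow> f t x) < e"
    unfolding p
  proof (intro exI[of _ "min d1 d2"] conjI ballI impI; clarsimp)
    fix t' y assume t': "t' \<in> A" and close: "dist (t', y) (t, x) < d1" "dist (t', y) (t, x) < d2"
    have "dist t' t < d1" "dist y x < d2"
      using dist_fst_le[of "(t', y)" "(t, x)"] dist_snd_le[of "(t', y)" "(t, x)"] close by auto
    moreover have "dist (f t' y) (f t y) < e / 2"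
      using d1(2)[OF t'] e \<open>dist t' t < d1\<close> by (cases "t' = t") auto
    ultimately show "dist (f t' y) (f t x) < e"
      using d2(2)[of y] dist_triangle[of "f t' y" "f t x" "f t y"] by simp
  qed (use d1 d2 in auto)
qed

text \<open>The embedding is applied to the difference of two time slices. Its norm of order 7/4
  bounds the difference and the difference of the x-derivatives uniformly in x, so both converge
  uniformly as time varies.\<close>

lemma C_sobolev_embedding:
  assumes conts: "\<forall>t\<in>{0..T}. continuous_on UNIV (f t)" and C: "C_sobolev (7/4) T f"
  shows "continuous_on ({0..T} \<times> UNIV) (\<lambda>(t, x). f t x)"
    and "continuous_on ({0..T} \<times> UNIV) (\<lambda>(t, x). deriv (f t) x)"
    and "\<And>t x. t \<in> {0..T} \<Longrightarrow> (f t has_real_derivative deriv (f t) x) (at x)"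
    and "\<And>t. t \<in> {0..T} \<Longrightarrow> periodic (f t)"
proof -
  have cont: "continuous_on UNIV (f t)" if "t \<in> {0..T}" for t
    using conts that by blast
  have sob: "sobolev (7/4) (f t)" if "t \<in> {0..T}" for t
    using C that by (simp add: C_sobolev_def)
  show "(f t has_real_derivative deriv (f t) x) (at x)" if "t \<in> {0..T}" for t x
    by (rule sobolev_embedding(1)[OF cont[OF that] sob[OF that]])
  note der = this
  show "periodic (f t)" if "t \<in> {0..T}" for t
    using sob[OF that] by (simp add: sobolev_def L2_torus_def)
  define N where "N t t' = embedding_const * sobolev_norm (7/4) (\<lambda>x. f t' x - f t x)" for t t'
  have bounds: "\<bar>f t' x - f t x\<bar> \<le> N t t'" "\<bar>deriv (f t') x - deriv (f t) x\<bar> \<le> N t t'"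
    if "t \<in> {0..T}" "t' \<in> {0..T}" for t t' x
  proof -
    have 1: "continuous_on UNIV (\<lambda>x. f t' x - f t x)"
      using cont that by (intro continuous_intros) auto
    have 2: "sobolev (7/4) (\<lambda>x. f t' x - f t x)"
      using that by (intro sobolev_diff cont sob)
    have "deriv (\<lambda>x. f t' x - f t x) x = deriv (f t') x - deriv (f t) x"
      using der that by (intro DERIV_imp_deriv DERIV_diff) auto
    then show "\<bar>f t' x - f t x\<bar> \<le> N t t'" "\<bar>deriv (f t') x - deriv (f t) x\<bar> \<le> N t t'"
      using sobolev_embedding(3,4)[OF 1 2, of x] by (auto simp: N_def)
  qed
  have N_lim: "(N t \<longlongrightarrow> 0) (at t within {0..T})" if "t \<in> {0..T}" for t
    unfolding N_def using C that by (intro tendsto_mult_right_zero) (simp add: C_sobolev_def)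
  have unif: "uniform_limit UNIV h (h t) (at t within {0..T})"
    if h: "\<And>t t' x. t \<in> {0..T} \<Longrightarrow> t' \<in> {0..T} \<Longrightarrow> \<bar>h t' x - h t x\<bar> \<le> N t t'" and t: "t \<in> {0..T}"
    for h :: "real \<Rightarrow> real \<Rightarrow> real" and t
  proof (rule uniform_limitI)
    fix e :: real assume "e > 0"
    then have "eventually (\<lambda>t'. N t t' < e) (at t within {0..T})"
      using order_tendstoD(2)[OF N_lim[OF t]] by blast
    moreover have "eventually (\<lambda>t'. t' \<in> {0..T}) (at t within {0..T})"
      by (auto simp: eventually_at_filter)
    ultimately show "\<forall>\<^sub>F t' in at t within {0..T}. \<forall>x\<in>UNIV. dist (h t' x) (h t x) < e"
    proof eventually_elim
      case (elim t')
      then show ?case using h[OF t, of t'] by (auto simp: dist_real_def intro: le_less_trans)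
    qed
  qed
  show "continuous_on ({0..T} \<times> UNIV) (\<lambda>(t, x). f t x)"
    by (intro continuous_on_Times_uniform cont unif bounds)
  show "continuous_on ({0..T} \<times> UNIV) (\<lambda>(t, x). deriv (f t) x)"
    by (intro continuous_on_Times_uniform unif bounds sobolev_embedding(2) cont sob)
qed

section \<open>Smooth test functions\<close>

text \<open>The derivative is an existential witness instead of an iterate of \<open>deriv\<close>:
  closure proofs then supply an explicit derivative and recurse on it.\<close>

primrec times_differentiable :: "nat \<Rightarrow> (real \<Rightarrow> real) \<Rightarrow> bool" where
  "times_differentiable 0 f \<longleftrightarrow> True"
| "times_differentiable (Suc n) f \<longleftrightarrow>
     (\<exists>f'. (\<forall>x. (f has_real_derivative f' x) (at x)) \<and> times_differentiable n f')"

definition smooth :: "(real \<Rightarrow> real) \<Rightarrow> bool" where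
  "smooth f \<longleftrightarrow> (\<forall>n. times_differentiable n f)"

lemma times_differentiable_SucI:
  "(\<And>x. (f has_real_derivative f' x) (at x)) \<Longrightarrow> times_differentiable n f' \<Longrightarrow>
    times_differentiable (Suc n) f"
  by auto

lemma times_differentiable_Suc_D: "times_differentiable (Suc n) f \<Longrightarrow> times_differentiable n f"
proof (induction n arbitrary: f)
  case (Suc n)
  then show ?case by (metis times_differentiable.simps(2))
qed simp

lemma times_differentiable_const: "times_differentiable n (\<lambda>x. c)"
proof (induction n arbitrary: c)
  case (Suc n)
  show ?case by (rule times_differentiable_SucI[OF _ Suc[of 0]]) simp
qed simp

lemma times_differentiable_add:
  "times_differentiable n f \<Longrightarrow> times_differentiable n g \<Longrightarrow> times_differentiable n (\<lambda>x. f x + g x)"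
proof (induction n arbitrary: f g)
  case (Suc n)
  then obtain f' g' where "\<And>x. (f has_real_derivative f' x) (at x)" "times_differentiable n f'"
    "\<And>x. (g has_real_derivative g' x) (at x)" "times_differentiable n g'" by auto
  then show ?case
    by (intro times_differentiable_SucI[where f' = "\<lambda>x. f' x + g' x"] Suc.IH DERIV_add)
qed simp

lemma times_differentiable_mult:
  "times_differentiable n f \<Longrightarrow> times_differentiable n g \<Longrightarrow> times_differentiable n (\<lambda>x. f x * g x)"
proof (induction n arbitrary: f g)
  case (Suc n)
  then obtain f' g' where "\<And>x. (f has_real_derivative f' x) (at x)" "times_differentiable n f'"
    "\<And>x. (g has_real_derivative g' x) (at x)" "times_differentiable n g'" by auto
  moreover have "times_differentiable n f" "times_differentiable n g"
    using Suc.prems times_differentiable_Suc_D by auto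
  ultimately show ?case
    by (intro times_differentiable_SucI[where f' = "\<lambda>x. f' x * g x + g' x * f x"]
        times_differentiable_add Suc.IH DERIV_mult)
qed simp

lemma times_differentiable_inverse:
  "times_differentiable n f \<Longrightarrow> (\<And>x. f x \<noteq> 0) \<Longrightarrow> times_differentiable n (\<lambda>x. inverse (f x))"
proof (induction n arbitrary: f)
  case (Suc n)
  then obtain f' where f': "\<And>x. (f has_real_derivative f' x) (at x)" "times_differentiable n f'" by auto
  have "times_differentiable n (\<lambda>x. inverse (f x))"
    using Suc.IH[OF times_differentiable_Suc_D[OF Suc.prems(1)]] Suc.prems(2) .
  then have "times_differentiable n (\<lambda>x. - 1 * (f' x * (inverse (f x) * inverse (f x))))"
    by (intro times_differentiable_mult times_differentiable_const f')
  moreover have "((\<lambda>x. inverse (f x)) has_real_derivative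
      - 1 * (f' x * (inverse (f x) * inverse (f x)))) (at x)" for x
    using DERIV_inverse'[OF f'(1)[of x] Suc.prems(2)] by (simp add: mult_ac)
  ultimately show ?case by (rule times_differentiable_SucI[rotated])
qed simp

lemma times_differentiable_affine:
  "times_differentiable n f \<Longrightarrow> times_differentiable n (\<lambda>x. f (a * x + b))"
proof (induction n arbitrary: f)
  case (Suc n)
  then obtain f' where f': "\<And>x. (f has_real_derivative f' x) (at x)" "times_differentiable n f'" by auto
  have "((\<lambda>x. f (a * x + b)) has_real_derivative f' (a * x + b) * a) (at x)" for x
    by (rule DERIV_chain2[OF f'(1)]) (auto intro!: derivative_eq_intros)
  then show ?case
    by (rule times_differentiable_SucI) (intro times_differentiable_mult times_differentiable_const Suc.IH f')
qed simp

text \<open>The derivative of sine is sine with its phase shifted by \<open>pi / 2\<close>; leaving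
  the phase arbitrary closes the induction without treating cosine.\<close>

lemma times_differentiable_sin: "times_differentiable n (\<lambda>x. sin (a * x + b))"
proof (induction n arbitrary: b)
  case (Suc n)
  have "((\<lambda>x. sin (a * x + b)) has_real_derivative a * sin (a * x + (b + pi / 2))) (at x)" for x
    by (auto intro!: derivative_eq_intros simp: sin_add cos_add algebra_simps)
  then show ?case
    by (rule times_differentiable_SucI) (intro times_differentiable_mult times_differentiable_const Suc)
qed simp

lemma smooth_const: "smooth (\<lambda>x. c)"
  and smooth_add: "smooth f \<Longrightarrow> smooth g \<Longrightarrow> smooth (\<lambda>x. f x + g x)"
  and smooth_mult: "smooth f \<Longrightarrow> smooth g \<Longrightarrow> smooth (\<lambda>x. f x * g x)"
  and smooth_inverse: "smooth f \<Longrightarrow> (\<And>x. f x \<noteq> 0) \<Longrightarrow> smooth (\<lambda>x. inverse (f x))"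
  and smooth_affine: "smooth f \<Longrightarrow> smooth (\<lambda>x. f (a * x + b))"
  and smooth_sin_affine: "smooth (\<lambda>x. sin (a * x + b))"
  by (simp_all add: smooth_def times_differentiable_const times_differentiable_add
      times_differentiable_mult times_differentiable_inverse times_differentiable_affine
      times_differentiable_sin)

lemma smooth_DERIV:
  assumes "smooth f"
  shows "(f has_real_derivative deriv f x) (at x)"
  using assms times_differentiable.simps(2)[of 0 f] by (auto simp: smooth_def DERIV_deriv_iff_real_differentiable real_differentiable_def simp del: times_differentiable.simps)

lemma smooth_deriv:
  assumes "smooth f"
  shows "smooth (deriv f)"
  unfolding smooth_def
proof
  fix n
  have "times_differentiable (Suc n) f" using assms by (simp add: smooth_def del: times_differentiable.simps)
  then obtain f' where f': "\<And>x. (f has_real_derivative f' x) (at x)" "times_differentiable n f'" by auto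
  then have "deriv f = f'" by (auto intro: DERIV_imp_deriv)
  then show "times_differentiable n (deriv f)" using f' by simp
qed

lemma smooth_continuous: "smooth f \<Longrightarrow> continuous_on A f"
  using smooth_DERIV DERIV_isCont by (blast intro: continuous_at_imp_continuous_on)

lemma periodic_deriv:
  fixes f :: "real \<Rightarrow> real"
  assumes "periodic f"
  shows "periodic (deriv f)"
proof -
  have "(f has_real_derivative D) (at (x + 2 * pi)) \<longleftrightarrow> (f has_real_derivative D) (at x)" for D x
    using DERIV_shift[of f D x "2 * pi"] periodic_D[OF assms] by simp
  then show ?thesis by (simp add: periodic_def deriv_def)
qed

lemma smooth_torus_iff: "smooth_torus f \<longleftrightarrow> periodic f \<and> smooth f"
proof
  assume f: "smooth_torus f"
  have "times_differentiable k ((deriv ^^ n) f)" for k n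
  proof (induction k arbitrary: n)
    case (Suc k)
    have "((deriv ^^ n) f) differentiable_on UNIV" using f by (simp add: smooth_torus_def)
    then have "((deriv ^^ n) f has_real_derivative (deriv ^^ Suc n) f x) (at x)" for x
      by (simp add: differentiable_on_def DERIV_deriv_iff_real_differentiable)
    then show ?case using Suc times_differentiable_SucI by blast
  qed simp
  from this[of _ 0] show "periodic f \<and> smooth f"
    using f by (simp add: smooth_torus_def smooth_def)
next
  assume f: "periodic f \<and> smooth f"
  then have "smooth ((deriv ^^ n) f)" for n by (induction n) (auto intro: smooth_deriv)
  then show "smooth_torus f"
    using f smooth_DERIV unfolding smooth_torus_def differentiable_on_def
    by (auto simp: real_differentiable_def)
qed

text \<open>The functions \<open>x\<^sup>-\<^sup>k exp (-1/x)\<close>, extended by zero: their span is closed under differentiation.\<close>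

definition flat :: "nat \<Rightarrow> real \<Rightarrow> real" where
  "flat k x = (if x > 0 then inverse x ^ k * exp (- inverse x) else 0)"

lemma flat_nonneg: "flat k x \<ge> 0"
  by (simp add: flat_def)

lemma tendsto_flat_0: "(flat k \<longlongrightarrow> 0) (at_right 0)"
proof -
  have "((\<lambda>y::real. y ^ k / exp y) \<longlongrightarrow> 0) at_top"
    by (rule tendsto_power_div_exp_0)
  from filterlim_compose[OF this filterlim_inverse_at_top_right]
  have "((\<lambda>x::real. inverse x ^ k / exp (inverse x)) \<longlongrightarrow> 0) (at_right 0)" .
  moreover have "eventually (\<lambda>x. inverse x ^ k / exp (inverse x) = flat k x) (at_right 0)"
    using eventually_at_right_less[of 0]
    by eventually_elim (simp add: flat_def exp_minus divide_inverse)
  ultimately show ?thesis by (rule Lim_transform_eventually)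
qed

lemma flat_DERIV:
  "(flat k has_real_derivative - real k * flat (k + 1) x + flat (k + 2) x) (at x)"
proof (cases x "0::real" rule: linorder_cases)
  case less
  have "((\<lambda>x. 0) has_real_derivative 0) (at x)" by simp
  then have "(flat k has_real_derivative 0) (at x)"
    by (rule has_field_derivative_transform_within_open[where S = "{..<0}"])
       (use less in \<open>auto simp: flat_def\<close>)
  then show ?thesis using less by (simp add: flat_def)
next
  case greater
  have "((\<lambda>x. inverse x ^ k * exp (- inverse x)) has_real_derivative
      real k * inverse x ^ (k - 1) * (- (inverse x)\<^sup>2) * exp (- inverse x) +
      exp (- inverse x) * (inverse x)\<^sup>2 * inverse x ^ k) (at x)"
    using greater by (auto intro!: derivative_eq_intros simp: power2_eq_square)
  moreover have "real k * inverse x ^ (k - 1) * (- (inverse x)\<^sup>2) * exp (- inverse x) +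
      exp (- inverse x) * (inverse x)\<^sup>2 * inverse x ^ k = - real k * flat (k + 1) x + flat (k + 2) x"
    using greater by (cases k) (simp_all add: flat_def power2_eq_square algebra_simps)
  ultimately have "((\<lambda>x. inverse x ^ k * exp (- inverse x)) has_real_derivative
      - real k * flat (k + 1) x + flat (k + 2) x) (at x)"
    by simp
  then show ?thesis
    by (rule has_field_derivative_transform_within_open[where S = "{0<..}"])
       (use greater in \<open>auto simp: flat_def\<close>)
next
  \<comment> \<open>At the origin the difference quotient of \<open>flat k\<close> is zero from the
    left and \<open>flat (k + 1)\<close> from the right, which tends to zero because the exponential
    beats every power.\<close>
  case equal
  have "((\<lambda>h. (flat k (0 + h) - flat k 0) / h) \<longlongrightarrow> 0) (at 0)"
    unfolding filterlim_at_split
  proof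
    have "eventually (\<lambda>h. 0 = (flat k (0 + h) - flat k 0) / h) (at_left 0)"
      by (auto simp: eventually_at_filter flat_def)
    then show "((\<lambda>h. (flat k (0 + h) - flat k 0) / h) \<longlongrightarrow> 0) (at_left 0)"
      by (rule Lim_transform_eventually[OF tendsto_const])
    have "eventually (\<lambda>h. flat (k + 1) h = (flat k (0 + h) - flat k 0) / h) (at_right 0)"
      using eventually_at_right_less[of 0]
      by eventually_elim (simp add: flat_def divide_inverse)
    then show "((\<lambda>h. (flat k (0 + h) - flat k 0) / h) \<longlongrightarrow> 0) (at_right 0)"
      by (rule Lim_transform_eventually[OF tendsto_flat_0])
  qed
  then show ?thesis using equal by (simp add: DERIV_def flat_def)
qed

lemma smooth_flat: "smooth (flat k)"
proof -
  have "times_differentiable n (flat k)" for n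
  proof (induction n arbitrary: k)
    case (Suc n)
    show ?case
      by (rule times_differentiable_SucI[OF flat_DERIV])
         (intro times_differentiable_add times_differentiable_mult times_differentiable_const Suc)
  qed simp
  then show ?thesis by (simp add: smooth_def)
qed

text \<open>The standard smooth transition between the constants 0 and 1 across the unit interval.
  Its rescaled derivatives are nonnegative bumps of integral one, used below as an approximate
  identity.\<close>

definition smooth_step :: "real \<Rightarrow> real" where
  "smooth_step x = flat 0 x * inverse (flat 0 x + flat 0 (1 - x))"

lemma flat_denominator_pos: "flat 0 x + flat 0 (1 - x) > 0"
  by (auto simp: flat_def intro: add_pos_pos)

lemma smooth_smooth_step: "smooth smooth_step"
  unfolding smooth_step_def[abs_def]
  using smooth_affine[OF smooth_flat, of 0 "-1" 1] flat_denominator_pos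
  by (intro smooth_mult smooth_inverse smooth_add smooth_flat) (auto simp: less_imp_neq[symmetric])

lemma smooth_step_eq: "x \<le> 0 \<Longrightarrow> smooth_step x = 0" "x \<ge> 1 \<Longrightarrow> smooth_step x = 1"
  by (auto simp: smooth_step_def flat_def)

lemma deriv_smooth_step_nonneg: "deriv smooth_step x \<ge> 0"
proof -
  define D where "D = flat 0 x + flat 0 (1 - x)"
  have "D > 0" unfolding D_def by (rule flat_denominator_pos)
  have f1: "(flat 0 has_real_derivative flat 2 y) (at y)" for y
    using flat_DERIV[of 0 y] by (simp add: numeral_2_eq_2)
  have f2: "((\<lambda>x. flat 0 (1 - x)) has_real_derivative - flat 2 (1 - x)) (at x)"
  proof -
    have "((\<lambda>x. 1 - x) has_real_derivative - 1) (at x)" by (auto intro!: derivative_eq_intros)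
    from DERIV_chain2[where f = "flat 0", OF f1 this] show ?thesis by simp
  qed
  have "(smooth_step has_real_derivative
      flat 2 x * inverse D + flat 0 x * (- ((flat 2 x - flat 2 (1 - x)) / D\<^sup>2))) (at x)"
    unfolding smooth_step_def[abs_def] D_def
    using flat_denominator_pos[of x]
    by (auto intro!: derivative_eq_intros f1 f2 simp: divide_inverse power2_eq_square)
  then have "deriv smooth_step x = flat 2 x * inverse D + flat 0 x * (- ((flat 2 x - flat 2 (1 - x)) / D\<^sup>2))"
    by (rule DERIV_imp_deriv)
  also have "\<dots> = (flat 2 x * flat 0 (1 - x) + flat 0 x * flat 2 (1 - x)) / D\<^sup>2"
    using \<open>D > 0\<close> by (simp add: field_simps power2_eq_square) (simp add: D_def algebra_simps)
  also have "\<dots> \<ge> 0" by (simp add: flat_nonneg)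
  finally show ?thesis .
qed

lemma deriv_smooth_step_eq_0:
  assumes "x \<notin> {0..1}"
  shows "deriv smooth_step x = 0"
proof (cases "x < 0")
  case True
  have "(smooth_step has_real_derivative 0) (at x)"
    by (rule has_field_derivative_transform_within_open[where S = "{..<0}" and f = "\<lambda>x. 0"])
       (use True in \<open>auto simp: smooth_step_eq\<close>)
  then show ?thesis by (rule DERIV_imp_deriv)
next
  case False
  have "(smooth_step has_real_derivative 0) (at x)"
    by (rule has_field_derivative_transform_within_open[where S = "{1<..}" and f = "\<lambda>x. 1"])
       (use False assms in \<open>auto simp: smooth_step_eq\<close>)
  then show ?thesis by (rule DERIV_imp_deriv)
qed

section \<open>Test functions in product form\<close>

lemma partial_product:
  assumes "smooth \<eta>" "smooth \<psi>"
  shows "partial_t (\<lambda>(t, x). \<eta> t * \<psi> x) = (\<lambda>(t, x). deriv \<eta> t * \<psi> x)"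
    and "partial_x (\<lambda>(t, x). \<eta> t * \<psi> x) = (\<lambda>(t, x). \<eta> t * deriv \<psi> x)"
  using smooth_DERIV[OF assms(1)] smooth_DERIV[OF assms(2)]
  by (auto simp: partial_t_def partial_x_def fun_eq_iff intro!: DERIV_imp_deriv derivative_eq_intros)

lemma product_differentiable:
  assumes "smooth \<eta>" "smooth \<psi>"
  shows "(\<lambda>(t, x). \<eta> t * \<psi> x) differentiable_on UNIV"
proof -
  have "((\<lambda>p. \<eta> (fst p) * \<psi> (snd p)) has_derivative
      (\<lambda>h. \<eta> (fst p) * (deriv \<psi> (snd p) * snd h) + (deriv \<eta> (fst p) * fst h) * \<psi> (snd p))) (at p)" for p
    by (intro has_derivative_mult
        has_derivative_compose[OF has_derivative_fst[OF has_derivative_ident] smooth_DERIV[OF assms(1), unfolded has_field_derivative_def]]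
        has_derivative_compose[OF has_derivative_snd[OF has_derivative_ident] smooth_DERIV[OF assms(2), unfolded has_field_derivative_def]])
  then show ?thesis
    unfolding differentiable_on_def differentiable_def case_prod_beta by blast
qed

text \<open>Either partial derivative of a product of a smooth function of time and one of space is
  again such a product. Induction over the list of derivatives thus reduces all of them to total
  differentiability of products.\<close>

lemma test_fun_product:
  assumes "smooth \<eta>" "smooth \<psi>" "periodic \<psi>"
    and "0 < a" "b < T" "\<And>t. t \<notin> {a..b} \<Longrightarrow> \<eta> t = 0"
  shows "test_fun T (\<lambda>(t, x). \<eta> t * \<psi> x)"
  unfolding test_fun_def
proof (intro conjI allI impI)
  fix Ds assume "set Ds \<subseteq> {partial_t, partial_x}"
  then have "\<exists>\<eta>' \<psi>'. smooth \<eta>' \<and> smooth \<psi>' \<and>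
      foldr (\<lambda>D g. D g) Ds (\<lambda>(t, x). \<eta> t * \<psi> x) = (\<lambda>(t, x). \<eta>' t * \<psi>' x)"
  proof (induction Ds)
    case Nil
    then show ?case using assms by auto
  next
    case (Cons D Ds)
    then obtain \<eta>' \<psi>' where "smooth \<eta>'" "smooth \<psi>'"
      "foldr (\<lambda>D g. D g) Ds (\<lambda>(t, x). \<eta> t * \<psi> x) = (\<lambda>(t, x). \<eta>' t * \<psi>' x)" by auto
    moreover have "D = partial_t \<or> D = partial_x" using Cons.prems by auto
    ultimately show ?case
      using partial_product[of \<eta>' \<psi>'] smooth_deriv by (auto; metis)
  qed
  then show "foldr (\<lambda>D g. D g) Ds (\<lambda>(t, x). \<eta> t * \<psi> x) differentiable_on UNIV"
    using product_differentiable by metis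
next
  show "periodic (\<lambda>x. case (t, x) of (t, x) \<Rightarrow> \<eta> t * \<psi> x)" for t
    using assms(3) by (simp add: periodic_def)
  show "\<exists>a b. 0 < a \<and> b < T \<and> (\<forall>t x. t \<notin> {a..b} \<longrightarrow> (case (t, x) of (t, x) \<Rightarrow> \<eta> t * \<psi> x) = 0)"
    by (intro exI[of _ a] exI[of _ b] conjI assms(4,5)) (simp add: assms(6))
qed

section \<open>Weak formulation integrated in time\<close>

lemma integral_deriv_smooth_step:
  assumes "0 < a" "\<epsilon> > 0" "a + \<epsilon> \<le> T"
  shows "((\<lambda>t. deriv smooth_step ((t - a) / \<epsilon>) / \<epsilon>) has_integral 1) {0..T}"
proof -
  have "((\<lambda>t. deriv smooth_step ((t - a) / \<epsilon>) / \<epsilon>) has_integral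
      smooth_step ((T - a) / \<epsilon>) - smooth_step ((0 - a) / \<epsilon>)) {0..T}"
  proof (rule fundamental_theorem_of_calculus)
    fix t
    have "((\<lambda>t. smooth_step ((t - a) / \<epsilon>)) has_real_derivative deriv smooth_step ((t - a) / \<epsilon>) * (1 / \<epsilon>)) (at t within {0..T})"
      by (rule DERIV_chain2[OF smooth_DERIV[OF smooth_smooth_step]])
         (use assms in \<open>auto intro!: derivative_eq_intros\<close>)
    then show "((\<lambda>t. smooth_step ((t - a) / \<epsilon>)) has_vector_derivative deriv smooth_step ((t - a) / \<epsilon>) / \<epsilon>) (at t within {0..T})"
      by (simp add: has_real_derivative_iff_has_vector_derivative)
  qed (use assms in simp)
  moreover have "smooth_step ((T - a) / \<epsilon>) = 1" "smooth_step ((0 - a) / \<epsilon>) = 0"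
    using assms by (auto intro!: smooth_step_eq simp: field_simps)
  ultimately show ?thesis by simp
qed

text \<open>The test function is the difference of two smooth steps starting at \<open>a\<close> and
  \<open>b\<close>: its derivative is a unit bump near \<open>a\<close> minus one near
  \<open>b\<close>, so the vanishing integral is close to \<open>F a - F b\<close>. Only one
  inequality is proved; the other follows by passing to \<open>- F\<close>.\<close>

lemma du_Bois_Reymond_le:
  fixes F :: "real \<Rightarrow> real"
  assumes cont: "continuous_on {0..T} F"
    and weak: "\<And>\<eta> a b. smooth \<eta> \<Longrightarrow> 0 < a \<Longrightarrow> b < T \<Longrightarrow> (\<And>t. t \<notin> {a..b} \<Longrightarrow> \<eta> t = 0) \<Longrightarrow>
      integral {0..T} (\<lambda>t. F t * deriv \<eta> t) = 0"
    and ab: "0 < a" "a < b" "b < T"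
  shows "F a \<le> F b"
proof (rule ccontr)
  assume "\<not> F a \<le> F b"
  \<comment> \<open>A third: each bump may lose up to \<open>d\<close>, and the integral is still at
    least \<open>d > 0\<close>.\<close>
  define d where "d = (F a - F b) / 3"
  have "d > 0" using \<open>\<not> F a \<le> F b\<close> by (simp add: d_def)
  obtain d1 where d1: "d1 > 0" "\<And>t. t \<in> {0..T} \<Longrightarrow> dist t a < d1 \<Longrightarrow> dist (F t) (F a) < d"
    using cont[unfolded continuous_on_iff, rule_format, of a d] ab \<open>d > 0\<close> by auto
  obtain d2 where d2: "d2 > 0" "\<And>t. t \<in> {0..T} \<Longrightarrow> dist t b < d2 \<Longrightarrow> dist (F t) (F b) < d"
    using cont[unfolded continuous_on_iff, rule_format, of b d] ab \<open>d > 0\<close> by auto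
  define \<epsilon> where "\<epsilon> = min (min d1 d2) (T - b) / 2"
  have \<epsilon>: "\<epsilon> > 0" "\<epsilon> < d1" "\<epsilon> < d2" "b + \<epsilon> < T"
  proof -
    define m where "m = min (min d1 d2) (T - b)"
    have "m > 0" "m \<le> d1" "m \<le> d2" "m \<le> T - b" using d1(1) d2(1) ab by (auto simp: m_def)
    then show "\<epsilon> > 0" "\<epsilon> < d1" "\<epsilon> < d2" "b + \<epsilon> < T"
      using d1(1) d2(1) ab unfolding \<epsilon>_def m_def[symmetric] by auto
  qed
  define p where "p c t = deriv smooth_step ((t - c) / \<epsilon>) / \<epsilon>" for c t
  have p_nonneg: "p c t \<ge> 0" for c t using \<epsilon> deriv_smooth_step_nonneg by (simp add: p_def)
  have p_0: "p c t = 0" if "t \<notin> {c..c + \<epsilon>}" for c t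
    unfolding p_def using that \<epsilon> by (subst deriv_smooth_step_eq_0) (auto simp: field_simps)
  have p_cont: "continuous_on {0..T} (p c)" for c
    unfolding p_def using \<epsilon>
    by (intro continuous_intros continuous_on_compose2[OF smooth_continuous[OF smooth_deriv[OF smooth_smooth_step], of UNIV]]) auto
  have int_p: "(p a has_integral 1) {0..T}" "(p b has_integral 1) {0..T}"
    unfolding p_def using ab \<epsilon> by (auto intro!: integral_deriv_smooth_step)
  define \<eta> where "\<eta> t = smooth_step ((t - a) / \<epsilon>) - smooth_step ((t - b) / \<epsilon>)" for t
  have step: "smooth (\<lambda>t. smooth_step ((t - c) / \<epsilon>))" for c
    using smooth_affine[OF smooth_smooth_step, of "1 / \<epsilon>" "- c / \<epsilon>"] by (simp add: diff_divide_distrib)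
  have "smooth \<eta>"
    unfolding \<eta>_def using smooth_add[OF step[of a] smooth_mult[OF smooth_const[of "-1"] step[of b]]] by simp
  moreover have "\<eta> t = 0" if "t \<notin> {a..b + \<epsilon>}" for t
  proof (cases "t < a")
    case True
    then show ?thesis unfolding \<eta>_def using ab \<epsilon>
      by (subst (1 2) smooth_step_eq(1)) (auto simp: field_simps)
  next
    case False
    then show ?thesis unfolding \<eta>_def using ab \<epsilon> that
      by (subst (1 2) smooth_step_eq(2)) (auto simp: field_simps)
  qed
  ultimately have 0: "integral {0..T} (\<lambda>t. F t * deriv \<eta> t) = 0"
    using ab \<epsilon> by (intro weak[of \<eta> a "b + \<epsilon>"]) auto
  have "((\<lambda>t. smooth_step ((t - c) / \<epsilon>)) has_real_derivative p c t) (at t)" for c t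
  proof -
    have "((\<lambda>t. (t - c) / \<epsilon>) has_real_derivative 1 / \<epsilon>) (at t)"
      using \<epsilon> by (auto intro!: derivative_eq_intros)
    from DERIV_chain2[OF smooth_DERIV[OF smooth_smooth_step] this] show ?thesis by (simp add: p_def)
  qed
  then have \<eta>': "deriv \<eta> t = p a t - p b t" for t
    unfolding \<eta>_def by (intro DERIV_imp_deriv DERIV_diff)
  have "((\<lambda>t. (F a - d) * p a t - (F b + d) * p b t) has_integral ((F a - d) * 1 - (F b + d) * 1)) {0..T}"
    by (intro has_integral_diff has_integral_mult_right int_p)
  then have "(F a - d) * 1 - (F b + d) * 1 \<le> integral {0..T} (\<lambda>t. F t * deriv \<eta> t)"
  proof (rule has_integral_le)
    show "((\<lambda>t. F t * deriv \<eta> t) has_integral integral {0..T} (\<lambda>t. F t * deriv \<eta> t)) {0..T}"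
      unfolding \<eta>' by (intro integrable_integral integrable_continuous_interval continuous_intros cont p_cont)
    fix t assume t: "t \<in> {0..T}"
    have "(F a - d) * p a t \<le> F t * p a t"
    proof (cases "t \<in> {a..a + \<epsilon>}")
      case True
      then show ?thesis using d1(2)[OF t] \<epsilon> p_nonneg[of a t]
        by (intro mult_right_mono) (auto simp: dist_real_def)
    qed (simp add: p_0)
    moreover have "F t * p b t \<le> (F b + d) * p b t"
    proof (cases "t \<in> {b..b + \<epsilon>}")
      case True
      then show ?thesis using d2(2)[OF t] \<epsilon> p_nonneg[of b t]
        by (intro mult_right_mono) (auto simp: dist_real_def)
    qed (simp add: p_0)
    ultimately show "(F a - d) * p a t - (F b + d) * p b t \<le> F t * deriv \<eta> t"
      by (simp add: \<eta>' right_diff_distrib)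
  qed
  then show False using 0 \<open>d > 0\<close> by (simp add: d_def field_simps)
qed

text \<open>Every interior point is compared with the midpoint. Test functions vanish near both
  ends, so the value at time 0 is reached only through continuity up to the boundary.\<close>

lemma du_Bois_Reymond:
  fixes F :: "real \<Rightarrow> real"
  assumes "T > 0" and cont: "continuous_on {0..T} F"
    and weak: "\<And>\<eta> a b. smooth \<eta> \<Longrightarrow> 0 < a \<Longrightarrow> b < T \<Longrightarrow> (\<And>t. t \<notin> {a..b} \<Longrightarrow> \<eta> t = 0) \<Longrightarrow>
      integral {0..T} (\<lambda>t. F t * deriv \<eta> t) = 0"
    and t: "t \<in> {0..T}"
  shows "F t = F 0"
proof -
  have le: "F a \<le> F b" if "0 < a" "a < b" "b < T" for a b
    by (rule du_Bois_Reymond_le[OF cont weak that])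
  have ge: "F a \<ge> F b" if "0 < a" "a < b" "b < T" for a b
  proof -
    have "- F a \<le> - F b"
    proof (rule du_Bois_Reymond_le[of T "\<lambda>t. - F t", OF _ _ that])
      show "continuous_on {0..T} (\<lambda>t. - F t)" by (intro continuous_intros cont)
      fix \<eta> a b assume "smooth \<eta>" "0 < a" "b < T" "\<And>t. t \<notin> {a..b} \<Longrightarrow> \<eta> t = 0"
      from weak[OF this] show "integral {0..T} (\<lambda>t. - F t * deriv \<eta> t) = 0" by simp
    qed
    then show ?thesis by simp
  qed
  have eq: "F s = F (T / 2)" if "s \<in> {0<..<T}" for s
    using le[of s "T/2"] le[of "T/2" s] ge[of s "T/2"] ge[of "T/2" s] that \<open>T > 0\<close>
    by (cases s "T/2" rule: linorder_cases) auto
  have closure: "closure {0<..<T} = {0..T}" using \<open>T > 0\<close> by simp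
  have "F s = F (T / 2)" if "s \<in> {0..T}" for s
    using continuous_constant_on_closure[of "{0<..<T}" F "F (T / 2)" s] cont eq that
    unfolding closure by blast
  from this[OF t] this[of 0] show ?thesis using \<open>T > 0\<close> by simp
qed

lemma cbox_times: "{0..T} \<times> {-pi..pi} = cbox (0, -pi) (T :: real, pi)"
  by (simp only: cbox_Pair_eq) (simp only: cbox_interval)

lemma continuous_on_Times_swap:
  assumes "continuous_on ({0..T} \<times> UNIV) (\<lambda>(t, x). f t x)" "t \<in> {0..T}"
  shows "continuous_on A (f t)"
proof -
  have cont: "continuous_on A (\<lambda>x. (t, x))" by (intro continuous_intros)
  have sub: "(\<lambda>x. (t, x)) ` A \<subseteq> {0..T} \<times> UNIV" using assms(2) by auto
  show ?thesis using continuous_on_compose2[OF assms(1) cont sub] by simp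
qed

lemma continuous_on_space_integral:
  fixes f :: "real \<Rightarrow> real \<Rightarrow> real"
  assumes "continuous_on ({0..T} \<times> UNIV) (\<lambda>(t, x). f t x)"
  shows "continuous_on {0..T} (\<lambda>t. integral {-pi..pi} (f t))"
proof -
  have "continuous_on ({0..T} \<times> cbox (-pi) pi) (\<lambda>(t, x). f t x)"
    by (rule continuous_on_subset[OF assms]) auto
  from integral_continuous_on_param[OF this] show ?thesis by (simp add: cbox_interval)
qed

text \<open>Let A(t) be the pairing of \<open>f t\<close> with \<psi> and B(s) the inner integral on
  the right. Products of a time cutoff and \<psi> as test functions say that A' = - B weakly on the
  open interval. Hence A plus a primitive of B is constant, and continuity brings in the initial
  datum.\<close>

lemma distr_eq_integrated:
  fixes f g h :: "real \<Rightarrow> real \<Rightarrow> real"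
  assumes T: "T > 0"
    and f: "continuous_on ({0..T} \<times> UNIV) (\<lambda>(t, x). f t x)"
    and g: "continuous_on ({0..T} \<times> UNIV) (\<lambda>(t, x). g t x)"
    and h: "continuous_on ({0..T} \<times> UNIV) (\<lambda>(t, x). h t x)"
    and eq: "distr_eq T f g h" and \<psi>: "smooth \<psi>" "periodic \<psi>" and t: "t \<in> {0..T}"
  shows "integral {-pi..pi} (\<lambda>x. f t x * \<psi> x) = integral {-pi..pi} (\<lambda>x. f 0 x * \<psi> x) -
    integral {0..t} (\<lambda>s. integral {-pi..pi} (\<lambda>x. g s x * \<psi> x + h s x * deriv \<psi> x))"
proof -
  have cont2: "continuous_on ({0..T} \<times> UNIV) (\<lambda>(t, x). \<phi> x)" if "continuous_on UNIV \<phi>" for \<phi> :: "real \<Rightarrow> real"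
    unfolding case_prod_beta by (intro continuous_on_compose2[OF that] continuous_intros) auto
  note \<psi>c = cont2[OF smooth_continuous[OF \<psi>(1)]] cont2[OF smooth_continuous[OF smooth_deriv[OF \<psi>(1)]]]
  define A where "A t = integral {-pi..pi} (\<lambda>x. f t x * \<psi> x)" for t
  define B where "B s = integral {-pi..pi} (\<lambda>x. g s x * \<psi> x + h s x * deriv \<psi> x)" for s
  define P where "P t = integral {0..t} B" for t
  have A_cont: "continuous_on {0..T} A"
    unfolding A_def using f \<psi>c
    by (intro continuous_on_space_integral) (simp add: case_prod_beta continuous_on_mult)
  have B_cont: "continuous_on {0..T} B"
    unfolding B_def using g h \<psi>c
    by (intro continuous_on_space_integral) (simp add: case_prod_beta continuous_on_mult continuous_on_add)
  have P_deriv: "(P has_real_derivative B t) (at t within {0..T})" if "t \<in> {0..T}" for t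
    unfolding P_def by (rule integral_has_real_derivative[OF B_cont that])
  have P_cont: "continuous_on {0..T} P"
    unfolding continuous_on_eq_continuous_within by (intro ballI DERIV_continuous[OF P_deriv])
  have "A t + P t = A 0 + P 0"
  proof (rule du_Bois_Reymond[where F = "\<lambda>t. A t + P t", OF T _ _ t])
    show "continuous_on {0..T} (\<lambda>t. A t + P t)" by (intro continuous_intros A_cont P_cont)
    fix \<eta> a b assume \<eta>: "smooth \<eta>" "0 < a" "b < T" "\<And>t. t \<notin> {a..b} \<Longrightarrow> \<eta> t = 0"
    have \<eta>_cont: "continuous_on S \<eta>" "continuous_on S (deriv \<eta>)" for S
      using smooth_continuous \<eta>(1) smooth_deriv by auto
    have "test_fun T (\<lambda>(t, x). \<eta> t * \<psi> x)"
      by (rule test_fun_product[OF \<eta>(1) \<psi> \<eta>(2-4)])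
    from eq[unfolded distr_eq_def, rule_format, OF this]
    have 1: "(LINT p:{0..T} \<times> {-pi..pi}|lborel. (case p of (t, x) \<Rightarrow>
        - f t x * (deriv \<eta> t * \<psi> x) + g t x * (\<eta> t * \<psi> x) + h t x * (\<eta> t * deriv \<psi> x))) = 0"
      by (simp add: Let_def partial_product[OF \<eta>(1) \<psi>(1)])
    have cont: "continuous_on ({0..T} \<times> {-pi..pi}) (\<lambda>(t, x).
        - f t x * (deriv \<eta> t * \<psi> x) + g t x * (\<eta> t * \<psi> x) + h t x * (\<eta> t * deriv \<psi> x))"
    proof -
      have fst_cont: "continuous_on ({0..T} \<times> UNIV) (\<lambda>p. \<phi> (fst p))"
        if "continuous_on UNIV \<phi>" for \<phi> :: "real \<Rightarrow> real"
        by (intro continuous_on_compose2[OF that] continuous_intros) auto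
      have "continuous_on ({0..T} \<times> UNIV) (\<lambda>p. - f (fst p) (snd p) * (deriv \<eta> (fst p) * \<psi> (snd p)) +
          g (fst p) (snd p) * (\<eta> (fst p) * \<psi> (snd p)) + h (fst p) (snd p) * (\<eta> (fst p) * deriv \<psi> (snd p)))"
        using f g h \<psi>c fst_cont[OF \<eta>_cont(1)] fst_cont[OF \<eta>_cont(2)] unfolding case_prod_beta
        by (intro continuous_on_add continuous_on_mult continuous_on_minus)
      then show ?thesis unfolding case_prod_beta by (rule continuous_on_subset) auto
    qed
    have "0 = integral {0..T} (\<lambda>t. integral {-pi..pi} (\<lambda>x.
        - f t x * (deriv \<eta> t * \<psi> x) + g t x * (\<eta> t * \<psi> x) + h t x * (\<eta> t * deriv \<psi> x)))"
      using 1 cont integral_prod_continuous[of 0 "-pi" T pi, OF cont[unfolded cbox_times]]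
      by (subst (asm) LINT_continuous) (auto simp: compact_Times cbox_times cbox_interval)
    also have "\<dots> = integral {0..T} (\<lambda>t. \<eta> t * B t - deriv \<eta> t * A t)"
    proof (rule integral_cong)
      fix t assume t: "t \<in> {0..T}"
      note c = continuous_on_Times_swap[OF f t] continuous_on_Times_swap[OF g t]
        continuous_on_Times_swap[OF h t] smooth_continuous[OF \<psi>(1)] smooth_continuous[OF smooth_deriv[OF \<psi>(1)]]
      have "integral {-pi..pi} (\<lambda>x.
        - f t x * (deriv \<eta> t * \<psi> x) + g t x * (\<eta> t * \<psi> x) + h t x * (\<eta> t * deriv \<psi> x)) =
        integral {-pi..pi} (\<lambda>x. \<eta> t * (g t x * \<psi> x + h t x * deriv \<psi> x) - deriv \<eta> t * (f t x * \<psi> x))"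
        by (simp add: algebra_simps)
      also have "\<dots> = \<eta> t * B t - deriv \<eta> t * A t"
        unfolding A_def B_def
        by (subst integral_diff) (auto intro!: integrable_continuous_interval continuous_intros c)
      finally show "integral {-pi..pi} (\<lambda>x.
        - f t x * (deriv \<eta> t * \<psi> x) + g t x * (\<eta> t * \<psi> x) + h t x * (\<eta> t * deriv \<psi> x)) =
        \<eta> t * B t - deriv \<eta> t * A t" .
    qed
    finally have 2: "integral {0..T} (\<lambda>t. \<eta> t * B t - deriv \<eta> t * A t) = 0" by simp
    \<comment> \<open>Integration by parts in time replaces \<open>B\<close> by its primitive
      \<open>P\<close>; the boundary terms vanish since \<eta> is zero at both ends.\<close>
    have "((\<lambda>t. \<eta> t * B t + deriv \<eta> t * P t) has_integral (\<eta> T * P T - \<eta> 0 * P 0)) {0..T}"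
    proof (rule fundamental_theorem_of_calculus)
      fix t assume "t \<in> {0..T}"
      have "((\<lambda>t. \<eta> t * P t) has_real_derivative (deriv \<eta> t * P t + B t * \<eta> t)) (at t within {0..T})"
        by (intro DERIV_mult P_deriv has_field_derivative_at_within[OF smooth_DERIV[OF \<eta>(1)]]) fact
      then show "((\<lambda>t. \<eta> t * P t) has_vector_derivative \<eta> t * B t + deriv \<eta> t * P t) (at t within {0..T})"
        by (simp add: has_real_derivative_iff_has_vector_derivative add.commute mult.commute)
    qed (use T in simp)
    moreover have "\<eta> T = 0" "\<eta> 0 = 0" using \<eta> by auto
    ultimately have 3: "integral {0..T} (\<lambda>t. \<eta> t * B t + deriv \<eta> t * P t) = 0"
      by (simp add: integral_unique)
    have "integral {0..T} (\<lambda>t. (A t + P t) * deriv \<eta> t) =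
        integral {0..T} (\<lambda>t. (\<eta> t * B t + deriv \<eta> t * P t) - (\<eta> t * B t - deriv \<eta> t * A t))"
      by (simp add: algebra_simps)
    also have "\<dots> = 0"
      by (subst integral_diff)
         (auto intro!: integrable_continuous_interval continuous_intros A_cont B_cont P_cont \<eta>_cont simp: 2 3)
    finally show "integral {0..T} (\<lambda>t. (A t + P t) * deriv \<eta> t) = 0" .
  qed
  then show ?thesis by (simp add: A_def B_def[abs_def] P_def)
qed

section \<open>Breakdown of solutions\<close>

text \<open>Integrating factor \<open>exp (- C * s)\<close>. It serves twice: for the squared
  deviation along a characteristic and for the total mass of k.\<close>

lemma Gronwall_nonpos:
  fixes K K' :: "real \<Rightarrow> real"
  assumes deriv: "\<And>t. t \<in> {0..T} \<Longrightarrow> (K has_real_derivative K' t) (at t within {0..T})"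
    and le: "\<And>t. t \<in> {0..T} \<Longrightarrow> K' t \<le> C * K t"
    and init: "K 0 \<le> 0" and t: "t \<in> {0..T}"
  shows "K t \<le> 0"
proof -
  define G where "G s = K s * exp (- C * s)" for s
  have G: "(G has_real_derivative (K' s - C * K s) * exp (- C * s)) (at s within {0..T})"
    if "s \<in> {0..T}" for s
    unfolding G_def using deriv[OF that]
    by (auto intro!: derivative_eq_intros simp: algebra_simps)
  have "G t \<le> G 0"
  proof (rule DERIV_nonpos_imp_decreasing_open[of 0 t G])
    show "0 \<le> t" using t by simp
    show "\<exists>y. (G has_real_derivative y) (at s) \<and> y \<le> 0" if "0 < s" "s < t" for s
    proof (intro exI conjI)
      have s: "s \<in> {0..T}" "s \<in> {0<..<T}" using that t by auto
      show "(G has_real_derivative (K' s - C * K s) * exp (- C * s)) (at s)"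
        using G[OF s(1)] at_within_Icc_at[of 0 s T] s(2) by simp
      show "(K' s - C * K s) * exp (- C * s) \<le> 0"
        using le[OF s(1)] by (simp add: mult_le_0_iff)
    qed
    have "continuous_on {0..T} G"
      unfolding continuous_on_eq_continuous_within by (intro ballI DERIV_continuous[OF G])
    then show "continuous_on {0..t} G" using t by (auto elim: continuous_on_subset)
  qed
  also have "\<dots> \<le> 0" using init by (simp add: G_def)
  finally show ?thesis by (simp add: G_def mult_le_0_iff)
qed

text \<open>Instead of solving x' = u(t, x), the straight line with the initial speed c is taken,
  and z = u - c is followed along it. The equation gives z' = - (u - c) u_x = - z b, where b is
  \<open>ux\<close> on the line; this is linear with bounded coefficient and z(0) = 0.\<close>

lemma burgers_characteristic:
  fixes u ux :: "real \<Rightarrow> real \<Rightarrow> real"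
  assumes u_t: "\<And>t x. t \<in> {0..T} \<Longrightarrow> ((\<lambda>t. u t x) has_real_derivative - (u t x * ux t x)) (at t within {0..T})"
    and u_x: "\<And>t x. t \<in> {0..T} \<Longrightarrow> (u t has_real_derivative ux t x) (at x)"
    and ux: "continuous_on ({0..T} \<times> UNIV) (\<lambda>(t, x). ux t x)"
    and t: "t \<in> {0..T}"
  shows "u t (x0 + t * u 0 x0) = u 0 x0"
proof -
  define c where "c = u 0 x0"
  define z where "z t = u t (x0 + t * c) - c" for t
  define b where "b t = ux t (x0 + t * c)" for t
  have path: "continuous_on {0..T} (\<lambda>t. (t, x0 + t * c))" by (intro continuous_intros)
  have path_img: "(\<lambda>t. (t, x0 + t * c)) ` {0..T} \<subseteq> {0..T} \<times> UNIV" by auto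
  have "continuous_on {0..T} b"
    unfolding b_def using continuous_on_compose2[OF ux path path_img] by simp
  then have "bounded (b ` {0..T})"
    by (intro compact_imp_bounded compact_continuous_image compact_Icc)
  then obtain B where B: "\<And>s. s \<in> {0..T} \<Longrightarrow> \<bar>b s\<bar> \<le> B"
    unfolding bounded_real by blast
  \<comment> \<open>The chain rule along a slanted line needs the total derivative. Existence of the
    time derivative and joint continuity of the space derivative suffice for it.\<close>
  have total: "((\<lambda>(t, x). u t x) has_derivative (\<lambda>(h, y). (- (u (fst p) (snd p) * ux (fst p) (snd p))) * h + (ux (fst p) (snd p) *\<^sub>R id_blinfun) y))
      (at p within {0..T} \<times> UNIV)" if p: "p \<in> {0..T} \<times> UNIV" for p
  proof -
    obtain s x where p: "p = (s, x)" "s \<in> {0..T}" using p by auto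
    show ?thesis unfolding p fst_conv snd_conv
    proof (rule has_derivative_partialsI[where fy = "\<lambda>t x. ux t x *\<^sub>R id_blinfun"])
      show "((\<lambda>t. u t x) has_derivative (*) (- (u s x * ux s x))) (at s within {0..T})"
        using u_t[OF p(2)] by (simp add: has_field_derivative_def)
      show "(u t has_derivative blinfun_apply (ux t y *\<^sub>R id_blinfun)) (at y within UNIV)" if "t \<in> {0..T}" for t y
        using u_x[OF that] by (simp add: has_field_derivative_def blinfun.scaleR_left[abs_def])
      have "continuous_on ({0..T} \<times> UNIV) (\<lambda>(t, x). ux t x *\<^sub>R (id_blinfun :: real \<Rightarrow>\<^sub>L real))"
        using ux unfolding case_prod_beta by (intro continuous_intros)
      then show "continuous (at (s, x) within {0..T} \<times> UNIV) (\<lambda>(t, x). ux t x *\<^sub>R (id_blinfun :: real \<Rightarrow>\<^sub>L real))"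
        using p(2) by (simp add: continuous_on_eq_continuous_within)
    qed auto
  qed
  have z': "(z has_real_derivative - z s * b s) (at s within {0..T})" if s: "s \<in> {0..T}" for s
  proof -
    have "((\<lambda>t. (t, x0 + t * c)) has_derivative (\<lambda>h. (h, h * c))) (at s within {0..T})"
      by (auto intro!: derivative_eq_intros)
    from has_derivative_in_compose2[OF total path_img s this]
    have "((\<lambda>t. u t (x0 + t * c)) has_derivative (\<lambda>h. h * (- z s * b s))) (at s within {0..T})"
      by (simp add: z_def b_def blinfun.scaleR_left algebra_simps)
    then have "((\<lambda>t. u t (x0 + t * c)) has_real_derivative - z s * b s) (at s within {0..T})"
      by (rule has_derivative_imp_has_field_derivative) simp
    from DERIV_diff[OF this DERIV_const[of c]] show ?thesis by (simp add: z_def[abs_def])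
  qed
  \<comment> \<open>\<open>z\<close> may change sign, so Gronwall is applied to its square, with a
    doubled constant.\<close>
  have "(z t)\<^sup>2 \<le> 0"
  proof (rule Gronwall_nonpos[where K = "\<lambda>t. (z t)\<^sup>2" and C = "2 * B", OF _ _ _ t])
    show "((\<lambda>t. (z t)\<^sup>2) has_real_derivative 2 * z s * (- z s * b s)) (at s within {0..T})" if "s \<in> {0..T}" for s
      using z'[OF that] by (auto intro!: derivative_eq_intros)
    show "2 * z s * (- z s * b s) \<le> 2 * B * (z s)\<^sup>2" if "s \<in> {0..T}" for s
    proof -
      have "(- b s) * (2 * (z s)\<^sup>2) \<le> B * (2 * (z s)\<^sup>2)"
        using B[OF that] by (intro mult_right_mono) auto
      then show ?thesis by (simp add: power2_eq_square algebra_simps)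
    qed
    show "(z 0)\<^sup>2 \<le> 0" by (simp add: z_def c_def)
  qed
  then show ?thesis by (simp add: z_def c_def)
qed

lemma nonneg_integral_nonpos_imp_zero:
  fixes f :: "real \<Rightarrow> real"
  assumes "continuous_on UNIV f" "periodic f" "\<And>x. f x \<ge> 0" "integral {-pi..pi} f \<le> 0"
  shows "f x = 0"
proof -
  have int: "f integrable_on {-pi..pi}"
    by (rule integrable_continuous_interval) (rule continuous_on_subset[OF assms(1)], simp)
  have "integral {-pi..pi} f = 0"
    by (rule antisym[OF assms(4)]) (rule integral_nonneg[OF int assms(3)])
  then have 0: "(f has_integral 0) {-pi..pi}" using integrable_integral[OF int] by simp
  have "\<forall>y\<in>{-pi..pi}. f y = 0"
  proof
    fix y :: real assume "y \<in> {-pi..pi}"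
    then show "f y = 0"
      using has_integral_0_cbox_imp_0[of "-pi" pi f] 0 assms(3) continuous_on_subset[OF assms(1), of "{-pi..pi}"]
      by (simp add: cbox_interval not_le)
  qed
  then show ?thesis using periodic_all_iff[OF assms(2), of "\<lambda>y. y = 0"] by blast
qed

text \<open>The real and imaginary parts of the exponentials are themselves smooth periodic test
  functions, so the hypothesis forces every Fourier coefficient to vanish.\<close>

lemma smooth_periodic_unique:
  fixes v :: "real \<Rightarrow> real"
  assumes "continuous_on UNIV v" "periodic v"
    and zero: "\<And>\<psi>. smooth \<psi> \<Longrightarrow> periodic \<psi> \<Longrightarrow> integral {-pi..pi} (\<lambda>x. v x * \<psi> x) = 0"
  shows "v x = 0"
proof (rule fourier_unique[OF assms(1,2)])
  fix n :: int
  have c: "continuous_on {-pi..pi} v" using assms(1) continuous_on_subset by blast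
  have per: "cos (of_int n * (x + 2 * pi)) = cos (of_int n * x)"
    "sin (of_int n * (x + 2 * pi)) = sin (of_int n * x)" for x
  proof -
    have "periodic (cos :: real \<Rightarrow> real)" "periodic (sin :: real \<Rightarrow> real)" by (simp_all add: periodic_def)
    note this[THEN periodic_shift_int, of "of_int n * x" n]
    then show "cos (of_int n * (x + 2 * pi)) = cos (of_int n * x)"
      "sin (of_int n * (x + 2 * pi)) = sin (of_int n * x)"
      by (simp_all add: algebra_simps)
  qed
  have cos0: "integral {-pi..pi} (\<lambda>x. v x * cos (of_int n * x)) = 0"
    using smooth_sin_affine[of "of_int n" "pi / 2"] per by (intro zero) (simp_all add: periodic_def sin_add)
  have sin0: "integral {-pi..pi} (\<lambda>x. v x * sin (of_int n * x)) = 0"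
    using smooth_sin_affine[of "of_int n" 0] per by (intro zero) (simp_all add: periodic_def)
  have int: "(\<lambda>x. of_real (v x) * cis (- (of_int n * x))) integrable_on {-pi..pi}"
    by (intro integrable_continuous_interval continuous_intros c)
  have "integral {-pi..pi} (\<lambda>x. of_real (v x) * cis (- (of_int n * x))) = 0"
    using integral_linear[OF int bounded_linear_Re] integral_linear[OF int bounded_linear_Im] cos0 sin0
    by (simp add: complex_eq_iff o_def)
  then show "fourier_coeff v n = 0" by (simp add: fourier_coeff_integral[OF c])
qed

text \<open>Without flux, the integrated identity and Fubini say that \<open>u t x - u 0 x\<close>
  plus the time integral of \<open>g\<close> is orthogonal to all smooth periodic functions of x.
  This function is continuous and periodic, hence zero at every x, and the fundamental theorem of
  calculus can be used pointwise.\<close>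

lemma classical_from_distr_eq:
  fixes u g :: "real \<Rightarrow> real \<Rightarrow> real"
  assumes T: "T > 0"
    and u: "continuous_on ({0..T} \<times> UNIV) (\<lambda>(t, x). u t x)"
    and g: "continuous_on ({0..T} \<times> UNIV) (\<lambda>(t, x). g t x)"
    and per: "\<And>t. t \<in> {0..T} \<Longrightarrow> periodic (u t)" "\<And>t. t \<in> {0..T} \<Longrightarrow> periodic (g t)"
    and eq: "distr_eq T u g h" and h: "\<And>t x. t \<in> {0..T} \<Longrightarrow> h t x = 0"
    and t: "t \<in> {0..T}"
  shows "((\<lambda>t. u t x) has_real_derivative - g t x) (at t within {0..T})"
proof -
  have hc: "continuous_on ({0..T} \<times> UNIV) (\<lambda>(t, x). h t x)"
    by (rule continuous_on_eq[of _ "\<lambda>_. 0"]) (auto simp: h)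
  have gx: "continuous_on ({0..t} \<times> UNIV) (\<lambda>(s, x). g s x)" if "t \<in> {0..T}" for t
    by (rule continuous_on_subset[OF g]) (use that in auto)
  have gt: "continuous_on {0..t} (\<lambda>s. g s x)" if "t \<in> {0..T}" for t x
  proof -
    have cont: "continuous_on {0..t} (\<lambda>s. (s, x))" by (intro continuous_intros)
    have sub: "(\<lambda>s. (s, x)) ` {0..t} \<subseteq> {0..T} \<times> UNIV" using that by auto
    show ?thesis using continuous_on_compose2[OF g cont sub] by simp
  qed
  have int: "u t x = u 0 x - integral {0..t} (\<lambda>s. g s x)" if t: "t \<in> {0..T}" for t x
  proof -
    define v where "v x = u t x - u 0 x + integral {0..t} (\<lambda>s. g s x)" for x
    have 0: "0 \<in> {0..T}" using T by simp
    have swapped: "continuous_on (A \<times> cbox 0 t) (\<lambda>(x, s). g s x)" for A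
    proof -
      have cont: "continuous_on (A \<times> cbox 0 t) (\<lambda>p. (snd p, fst p))" by (intro continuous_intros)
      have sub: "(\<lambda>p. (snd p, fst p)) ` (A \<times> cbox 0 t) \<subseteq> {0..T} \<times> UNIV" using t by auto
      show ?thesis using continuous_on_compose2[OF g cont sub] by (simp add: case_prod_beta)
    qed
    have int_cont: "continuous_on A (\<lambda>x. integral {0..t} (\<lambda>s. g s x))" for A
      using integral_continuous_on_param[OF swapped] by (simp add: cbox_interval)
    have v_cont: "continuous_on UNIV v"
      unfolding v_def
      by (intro continuous_intros continuous_on_Times_swap[OF u] t 0 int_cont)
    have "v x = 0"
    proof (rule smooth_periodic_unique[OF v_cont])
      have "integral {0..t} (\<lambda>s. g s (x + 2 * pi)) = integral {0..t} (\<lambda>s. g s x)" for x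
        using t by (intro integral_cong periodic_D[OF per(2)]) auto
      then show "periodic v"
        using periodic_D[OF per(1)[OF t]] periodic_D[OF per(1)[OF 0]] by (simp add: periodic_def v_def)
      fix \<psi> assume \<psi>: "smooth \<psi>" "periodic \<psi>"
      have \<psi>c: "continuous_on A \<psi>" for A by (rule smooth_continuous[OF \<psi>(1)])
      have c: "continuous_on {-pi..pi} (u t)" "continuous_on {-pi..pi} (u 0)"
        by (intro continuous_on_Times_swap[OF u] t 0)+
      have "integral {-pi..pi} (\<lambda>x. integral {0..t} (\<lambda>s. g s x) * \<psi> x) =
          integral {-pi..pi} (\<lambda>x. integral {0..t} (\<lambda>s. g s x * \<psi> x))"
        by simp
      also have "\<dots> = integral {0..t} (\<lambda>s. integral {-pi..pi} (\<lambda>x. g s x * \<psi> x))"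
      proof -
        have "continuous_on (cbox (-pi, 0) (pi, t)) (\<lambda>(x, s). g s x * \<psi> x)"
          unfolding cbox_Pair_eq using swapped[of "cbox (-pi) pi"] unfolding case_prod_beta
          by (intro continuous_on_mult continuous_on_compose2[OF \<psi>c[of UNIV]] continuous_intros) auto
        from integral_swap_continuous[OF this] show ?thesis by (simp add: cbox_interval)
      qed
      also have "\<dots> = integral {0..t} (\<lambda>s. integral {-pi..pi} (\<lambda>x. g s x * \<psi> x + h s x * deriv \<psi> x))"
        using t by (intro integral_cong) (auto simp: h)
      also have "\<dots> = integral {-pi..pi} (\<lambda>x. u 0 x * \<psi> x) - integral {-pi..pi} (\<lambda>x. u t x * \<psi> x)"
        using distr_eq_integrated[OF T u g hc eq \<psi> t] by simp
      finally have 1: "integral {-pi..pi} (\<lambda>x. integral {0..t} (\<lambda>s. g s x) * \<psi> x) =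
          integral {-pi..pi} (\<lambda>x. u 0 x * \<psi> x) - integral {-pi..pi} (\<lambda>x. u t x * \<psi> x)" .
      have i: "(\<lambda>x. u t x * \<psi> x) integrable_on {-pi..pi}" "(\<lambda>x. u 0 x * \<psi> x) integrable_on {-pi..pi}"
        "(\<lambda>x. integral {0..t} (\<lambda>s. g s x) * \<psi> x) integrable_on {-pi..pi}"
        by (intro integrable_continuous_interval continuous_on_mult c \<psi>c int_cont)+
      show "integral {-pi..pi} (\<lambda>x. v x * \<psi> x) = 0"
        unfolding v_def distrib_right left_diff_distrib
        by (subst integral_add[OF integrable_diff[OF i(1,2)] i(3)], subst integral_diff[OF i(1,2)]) (simp add: 1)
    qed
    then show ?thesis by (simp add: v_def)
  qed
  have "((\<lambda>t. integral {0..t} (\<lambda>s. g s x)) has_real_derivative g t x) (at t within {0..T})"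
    using T by (intro integral_has_real_derivative gt t) auto
  then have "((\<lambda>t. u 0 x - integral {0..t} (\<lambda>s. g s x)) has_real_derivative - g t x) (at t within {0..T})"
    by (auto intro!: derivative_eq_intros)
  then show ?thesis
    by (rule has_field_derivative_transform_within[OF _ zero_less_one t]) (rule int[symmetric])
qed

text \<open>The test function 1 kills the diffusion. Integrating the transport term by parts then
  gives K' as the integral of (r - \<omega>) k with r = u_x + \<alpha>4 |u_x|^2 / \<omega>. As
  \<omega> is continuous and positive on a compact set, r is bounded; since k and \<omega> are
  nonnegative, K' \<le> C K follows, with K(0) = 0.\<close>

lemma k_remains_zero:
  fixes u \<omega> k :: "real \<Rightarrow> real \<Rightarrow> real"
  assumes T: "T > 0"
    and u: "continuous_on ({0..T} \<times> UNIV) (\<lambda>(t, x). u t x)"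
      "continuous_on ({0..T} \<times> UNIV) (\<lambda>(t, x). deriv (u t) x)"
      "\<And>t x. t \<in> {0..T} \<Longrightarrow> (u t has_real_derivative deriv (u t) x) (at x)"
      "\<And>t. t \<in> {0..T} \<Longrightarrow> periodic (u t)"
    and \<omega>: "continuous_on ({0..T} \<times> UNIV) (\<lambda>(t, x). \<omega> t x)" "\<And>t x. t \<in> {0..T} \<Longrightarrow> \<omega> t x > 0"
    and k: "continuous_on ({0..T} \<times> UNIV) (\<lambda>(t, x). k t x)"
      "continuous_on ({0..T} \<times> UNIV) (\<lambda>(t, x). deriv (k t) x)"
      "\<And>t x. t \<in> {0..T} \<Longrightarrow> (k t has_real_derivative deriv (k t) x) (at x)"
      "\<And>t. t \<in> {0..T} \<Longrightarrow> periodic (k t)"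
      "\<And>t x. t \<in> {0..T} \<Longrightarrow> k t x \<ge> 0" "\<And>x. k 0 x = 0"
    and eq: "distr_eq T k
       (\<lambda>t x. u t x * deriv (k t) x + k t x * \<omega> t x
                - \<alpha>4 * (k t x / \<omega> t x * \<bar>deriv (u t) x\<bar>\<^sup>2))
       (\<lambda>t x. \<alpha>3 * (k t x / \<omega> t x * deriv (k t) x))"
    and t: "t \<in> {0..T}"
  shows "k t x = 0"
proof -
  define g where "g t x = u t x * deriv (k t) x + k t x * \<omega> t x
                - \<alpha>4 * (k t x / \<omega> t x * \<bar>deriv (u t) x\<bar>\<^sup>2)" for t x
  define h where "h t x = \<alpha>3 * (k t x / \<omega> t x * deriv (k t) x)" for t x
  note conts = u(1,2) \<omega>(1) k(1,2)
  have \<omega>_nz: "\<forall>p\<in>{0..T} \<times> UNIV. \<omega> (fst p) (snd p) \<noteq> 0" by (auto simp: \<omega>(2) less_imp_neq[symmetric])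
  have g_cont: "continuous_on ({0..T} \<times> UNIV) (\<lambda>(t, x). g t x)"
    using conts \<omega>_nz unfolding g_def case_prod_beta by (intro continuous_intros)
  have h_cont: "continuous_on ({0..T} \<times> UNIV) (\<lambda>(t, x). h t x)"
    using conts \<omega>_nz unfolding h_def case_prod_beta by (intro continuous_intros)
  have eq': "distr_eq T k g h" using eq by (simp add: g_def[abs_def] h_def[abs_def])
  define K where "K t = integral {-pi..pi} (k t)" for t
  define M where "M t = integral {-pi..pi} (g t)" for t
  have M_cont: "continuous_on {0..T} M" unfolding M_def by (rule continuous_on_space_integral[OF g_cont])
  have K_eq: "K t = - integral {0..t} M" if "t \<in> {0..T}" for t
  proof -
    have "periodic (\<lambda>x. 1 :: real)" by (simp add: periodic_def)
    from distr_eq_integrated[OF T k(1) g_cont h_cont eq' smooth_const this that]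
    show ?thesis by (simp add: K_def M_def[abs_def] k(6))
  qed
  have K': "(K has_real_derivative - M t) (at t within {0..T})" if "t \<in> {0..T}" for t
  proof (rule has_field_derivative_transform_within[OF _ zero_less_one that K_eq[symmetric]])
    show "((\<lambda>t. - integral {0..t} M) has_real_derivative - M t) (at t within {0..T})"
      by (intro DERIV_minus integral_has_real_derivative M_cont that)
  qed
  define r where "r t x = deriv (u t) x + \<alpha>4 * (\<bar>deriv (u t) x\<bar>\<^sup>2 / \<omega> t x)" for t x
  have "continuous_on ({0..T} \<times> UNIV) (\<lambda>p. r (fst p) (snd p))"
    using conts \<omega>_nz unfolding r_def case_prod_beta by (intro continuous_intros)
  then have "continuous_on ({0..T} \<times> {-pi..pi}) (\<lambda>p. r (fst p) (snd p))"
    by (rule continuous_on_subset) auto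
  then have "bounded ((\<lambda>p. r (fst p) (snd p)) ` ({0..T} \<times> {-pi..pi}))"
    by (intro compact_imp_bounded compact_continuous_image compact_Times compact_Icc)
  then obtain C where C_img: "\<forall>y \<in> (\<lambda>p. r (fst p) (snd p)) ` ({0..T} \<times> {-pi..pi}). \<bar>y\<bar> \<le> C"
    unfolding bounded_real by (elim exE)
  have C: "\<bar>r t x\<bar> \<le> C" if "t \<in> {0..T}" "x \<in> {-pi..pi}" for t x
  proof -
    have "r t x \<in> (\<lambda>p. r (fst p) (snd p)) ` ({0..T} \<times> {-pi..pi})"
      by (rule image_eqI[of _ _ "(t, x)"]) (use that in simp_all)
    then show ?thesis by (rule bspec[OF C_img])
  qed
  have K_le: "- M t \<le> C * K t" if t: "t \<in> {0..T}" for t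
  proof -
    have ct: "continuous_on A (u t)" "continuous_on A (\<lambda>x. deriv (u t) x)" "continuous_on A (k t)"
      "continuous_on A (\<lambda>x. deriv (k t) x)" "continuous_on A (\<lambda>x. g t x)" for A
      by (rule continuous_on_Times_swap[OF _ t], rule u k g_cont)+
    have "((\<lambda>x. u t x * deriv (k t) x + deriv (u t) x * k t x) has_integral
       (u t pi * k t pi - u t (-pi) * k t (-pi))) {-pi..pi}"
    proof (rule fundamental_theorem_of_calculus)
      fix x
      have "((\<lambda>x. u t x * k t x) has_real_derivative (deriv (u t) x * k t x + deriv (k t) x * u t x)) (at x within {-pi..pi})"
        by (rule DERIV_mult[OF has_field_derivative_at_within[OF u(3)[OF t]] has_field_derivative_at_within[OF k(3)[OF t]]])
      then show "((\<lambda>x. u t x * k t x) has_vector_derivative u t x * deriv (k t) x + deriv (u t) x * k t x) (at x within {-pi..pi})"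
        by (simp add: has_real_derivative_iff_has_vector_derivative algebra_simps)
    qed simp
    moreover have "u t pi = u t (-pi)" "k t pi = k t (-pi)"
      using periodic_D[OF u(4)[OF t], of "-pi"] periodic_D[OF k(4)[OF t], of "-pi"] by auto
    ultimately have parts: "integral {-pi..pi} (\<lambda>x. u t x * deriv (k t) x + deriv (u t) x * k t x) = 0"
      by (simp add: integral_unique)
    \<comment> \<open>Adding the vanishing integral \<open>parts\<close> cancels the term with
      \<open>deriv (k t)\<close>, for which no bound in terms of k is at hand.\<close>
    have "- M t = integral {-pi..pi} (\<lambda>x. u t x * deriv (k t) x + deriv (u t) x * k t x) - integral {-pi..pi} (g t)"
      by (simp add: parts M_def)
    also have "\<dots> = integral {-pi..pi} (\<lambda>x. u t x * deriv (k t) x + deriv (u t) x * k t x - g t x)"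
      by (rule integral_diff[symmetric]) (auto intro!: integrable_continuous_interval continuous_intros ct)
    also have "\<dots> \<le> integral {-pi..pi} (\<lambda>x. C * k t x)"
    proof (rule integral_le)
      fix x :: real assume x: "x \<in> {-pi..pi}"
      have "u t x * deriv (k t) x + deriv (u t) x * k t x - g t x = r t x * k t x - k t x * \<omega> t x"
        by (simp add: g_def r_def algebra_simps)
      also have "\<dots> \<le> r t x * k t x" using k(5)[OF t] \<omega>(2)[OF t] by (simp add: less_imp_le)
      also have "\<dots> \<le> C * k t x" using C[OF t x] k(5)[OF t] by (intro mult_right_mono) auto
      finally show "u t x * deriv (k t) x + deriv (u t) x * k t x - g t x \<le> C * k t x" .
    qed (auto intro!: integrable_continuous_interval continuous_intros ct)
    also have "\<dots> = C * K t" by (simp add: K_def)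
    finally show ?thesis .
  qed
  have "k 0 = (\<lambda>x. 0)" by (simp add: fun_eq_iff k(6))
  then have "K t \<le> 0"
    by (intro Gronwall_nonpos[OF K' K_le _ t]) (simp_all add: K_def)
  then show ?thesis
    by (intro nonneg_integral_nonpos_imp_zero[of "k t"] continuous_on_Times_swap[OF k(1) t] k(4,5)[OF t]) (simp add: K_def)
qed

lemma no_solution_beyond_collision:
  assumes sol: "kolmogorov_solution \<nu> \<alpha>1 \<alpha>2 \<alpha>3 \<alpha>4 m T sin (\<lambda>x. 1) (\<lambda>x. 0) u \<omega> k"
    and m: "m \<ge> 2"
  shows "T < pi / 2"
proof (rule ccontr)
  assume "\<not> T < pi / 2"
  then have T: "T \<ge> pi / 2" "T > 0" using pi_gt_zero by linarith+
  define q where "q t x = sqrt (k t x)" for t x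
  note s = sol[unfolded kolmogorov_solution_def Let_def]
  have init: "u 0 = sin" "k 0 = (\<lambda>x. 0)" and pos: "\<And>t x. t \<in> {0..T} \<Longrightarrow> 0 < \<omega> t x"
    "\<And>t x. t \<in> {0..T} \<Longrightarrow> 0 \<le> k t x"
    using s by auto
  \<comment> \<open>Continuity in time is available only for exponents strictly below m; 7/4 < 2
    \<le> m.\<close>
  have reg: "\<forall>t\<in>{0..T}. continuous_on UNIV (f t)" "C_sobolev (7/4) T f" if "regular m T a f" for a f
    using that m unfolding regular_def by auto
  define a where "a = (\<lambda>t x. sqrt (k t x / \<omega> t x))"
  have r: "regular m T a u" "regular m T a \<omega>" "regular m T a q"
    using s unfolding q_def[abs_def] a_def by blast+
  note u = C_sobolev_embedding[OF reg(1)[OF r(1)] reg(2)[OF r(1)]]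
  note \<omega> = C_sobolev_embedding[OF reg(1)[OF r(2)] reg(2)[OF r(2)]]
  note q = C_sobolev_embedding[OF reg(1)[OF r(3)] reg(2)[OF r(3)]]
  \<comment> \<open>The solution class controls \<open>sqrt k\<close>, not k itself, so k is
    differentiated as the square of q.\<close>
  have kq: "k t = (\<lambda>x. (q t x)\<^sup>2)" if "t \<in> {0..T}" for t using pos(2)[OF that] by (simp add: q_def)
  have k': "(k t has_real_derivative 2 * q t x * deriv (q t) x) (at x)" if "t \<in> {0..T}" for t x
    unfolding kq[OF that] using q(3)[OF that] by (auto intro!: derivative_eq_intros)
  have k_deriv: "deriv (k t) x = 2 * q t x * deriv (q t) x" if "t \<in> {0..T}" for t x
    using DERIV_imp_deriv[OF k'[OF that]] .
  have k_zero: "k t x = 0" if "t \<in> {0..T}" for t x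
  proof (rule k_remains_zero[OF T(2) u \<omega>(1) pos(1) _ _ _ _ pos(2) _ _ that])
    have "continuous_on ({0..T} \<times> UNIV) (\<lambda>(t, x). (q t x)\<^sup>2)"
      using q(1) unfolding case_prod_beta by (intro continuous_intros)
    then show "continuous_on ({0..T} \<times> UNIV) (\<lambda>(t, x). k t x)"
      by (rule continuous_on_eq) (auto simp: kq)
    have "continuous_on ({0..T} \<times> UNIV) (\<lambda>(t, x). 2 * q t x * deriv (q t) x)"
      using q(1,2) unfolding case_prod_beta by (intro continuous_intros)
    then show "continuous_on ({0..T} \<times> UNIV) (\<lambda>(t, x). deriv (k t) x)"
      by (rule continuous_on_eq) (auto simp: k_deriv)
    show "(k t has_real_derivative deriv (k t) x) (at x)" if "t \<in> {0..T}" for t x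
      using k'[OF that] k_deriv[OF that] by simp
    show "periodic (k t)" if "t \<in> {0..T}" for t
      using periodic_D[OF q(4)[OF that]] by (simp add: kq[OF that] periodic_def)
    show "distr_eq T k
       (\<lambda>t x. u t x * deriv (k t) x + k t x * \<omega> t x
                - \<alpha>4 * (k t x / \<omega> t x * \<bar>deriv (u t) x\<bar>\<^sup>2))
       (\<lambda>t x. \<alpha>3 * (k t x / \<omega> t x * deriv (k t) x))"
      using s by blast
    show "k 0 x = 0" for x by (simp add: init)
  qed
  have u_t: "((\<lambda>t. u t x) has_real_derivative - (u t x * deriv (u t) x)) (at t within {0..T})"
    if "t \<in> {0..T}" for t x
  proof (rule classical_from_distr_eq[OF T(2) u(1) _ u(4), of "\<lambda>t x. u t x * deriv (u t) x", OF _ _ _ _ _ that])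
    show "continuous_on ({0..T} \<times> UNIV) (\<lambda>(t, x). u t x * deriv (u t) x)"
      using u(1,2) unfolding case_prod_beta by (intro continuous_intros)
    show "periodic (\<lambda>x. u t x * deriv (u t) x)" if "t \<in> {0..T}" for t
      using periodic_D[OF u(4)[OF that]] periodic_D[OF periodic_deriv[OF u(4)[OF that]]] by (simp add: periodic_def)
    show "distr_eq T u (\<lambda>t x. u t x * deriv (u t) x) (\<lambda>t x. \<nu> * (k t x / \<omega> t x * deriv (u t) x))"
      using s by blast
    show "\<nu> * (k t x / \<omega> t x * deriv (u t) x) = 0" if "t \<in> {0..T}" for t x
      by (simp add: k_zero[OF that])
  qed
  have char: "u (pi / 2) (x0 + pi / 2 * sin x0) = sin x0" for x0
    using burgers_characteristic[of T u "\<lambda>t. deriv (u t)" "pi / 2" x0, OF u_t u(3) u(2)] T by (simp add: init)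
  have s3: "sin (3 * pi / 2) = -1"
    using sin_add[of pi "pi / 2"] by (simp add: algebra_simps)
  \<comment> \<open>Both lines are at the point \<open>pi\<close> at time \<open>pi / 2\<close>,
    where u would have to be 1 and -1 at once.\<close>
  show False using char[of "pi / 2"] char[of "3 * pi / 2"] s3 by (simp add: field_simps)
qed

section \<open>Smooth families are regular\<close>

text \<open>In time only continuity of each x-derivative is recorded: \<open>regular\<close> asks
  for no time derivative.\<close>

definition smooth_family :: "real \<Rightarrow> (real \<Rightarrow> real \<Rightarrow> real) \<Rightarrow> bool" where
  "smooth_family T f \<longleftrightarrow> (\<forall>t\<in>{0..T}. periodic (f t) \<and> smooth (f t)) \<and>
     (\<forall>n. continuous_on ({0..T} \<times> UNIV) (\<lambda>(t, x). (deriv ^^ n) (f t) x))"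

text \<open>The operator 1 minus the second derivative, with Fourier multiplier 1 + n^2. A sup bound
  on its powers gives explicit decay of Fourier coefficients.\<close>

definition bessel_op :: "(real \<Rightarrow> real) \<Rightarrow> real \<Rightarrow> real" where
  "bessel_op f x = f x - deriv (deriv f) x"

lemma smooth_diff: "smooth f \<Longrightarrow> smooth g \<Longrightarrow> smooth (\<lambda>x. f x - g x)"
  using smooth_add[of f "\<lambda>x. -1 * g x"] smooth_mult[OF smooth_const[of "-1"], of g] by simp

lemma deriv_diff_smooth: "smooth f \<Longrightarrow> smooth g \<Longrightarrow> deriv (\<lambda>x. f x - g x) = (\<lambda>x. deriv f x - deriv g x)"
  by (rule ext, rule DERIV_imp_deriv, intro DERIV_diff smooth_DERIV)

lemma smooth_funpow_deriv: "smooth f \<Longrightarrow> smooth ((deriv ^^ n) f)"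
  by (induction n) (auto intro: smooth_deriv)

lemma periodic_funpow_deriv: "periodic f \<Longrightarrow> periodic ((deriv ^^ n) (f :: real \<Rightarrow> real))"
  by (induction n) (auto intro: periodic_deriv)

lemma funpow_deriv_diff:
  assumes "smooth f" "smooth g"
  shows "(deriv ^^ n) (\<lambda>x. f x - g x) = (\<lambda>x. (deriv ^^ n) f x - (deriv ^^ n) g x)"
  by (induction n) (simp_all add: deriv_diff_smooth smooth_funpow_deriv assms)

lemma smooth_bessel_op: "smooth f \<Longrightarrow> smooth (bessel_op f)"
  unfolding bessel_op_def[abs_def] by (intro smooth_diff smooth_deriv)

lemma periodic_bessel_op: "periodic f \<Longrightarrow> periodic (bessel_op f)"
  using periodic_D[of f] periodic_D[OF periodic_deriv[OF periodic_deriv], of f]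
  by (simp add: periodic_def bessel_op_def)

lemma smooth_funpow_bessel_op: "smooth f \<Longrightarrow> smooth ((bessel_op ^^ N) f)"
  by (induction N) (auto intro: smooth_bessel_op)

lemma periodic_funpow_bessel_op: "periodic f \<Longrightarrow> periodic ((bessel_op ^^ N) f)"
  by (induction N) (auto intro: periodic_bessel_op)

lemma funpow_bessel_op_diff:
  assumes "smooth f" "smooth g"
  shows "(bessel_op ^^ N) (\<lambda>x. f x - g x) = (\<lambda>x. (bessel_op ^^ N) f x - (bessel_op ^^ N) g x)"
proof (induction N)
  case (Suc N)
  have "bessel_op (\<lambda>x. (bessel_op ^^ N) f x - (bessel_op ^^ N) g x) x =
    bessel_op ((bessel_op ^^ N) f) x - bessel_op ((bessel_op ^^ N) g) x" for x
    by (simp add: bessel_op_def deriv_diff_smooth smooth_deriv smooth_funpow_bessel_op assms)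
  then show ?case by (simp add: Suc fun_eq_iff)
qed simp

lemma smooth_family_bessel_op:
  assumes "smooth_family T f"
  shows "smooth_family T (\<lambda>t. bessel_op (f t))"
  unfolding smooth_family_def
proof (intro conjI allI ballI)
  fix t assume "t \<in> {0..T}"
  then show "periodic (bessel_op (f t))" "smooth (bessel_op (f t))"
    using assms by (auto simp: smooth_family_def smooth_bessel_op periodic_bessel_op)
next
  fix n
  have eq: "(deriv ^^ n) (bessel_op (f t)) x = (deriv ^^ n) (f t) x - (deriv ^^ (n + 2)) (f t) x"
    if "t \<in> {0..T}" for t x
  proof -
    have s: "smooth (f t)" using assms that by (simp add: smooth_family_def)
    show ?thesis
      unfolding bessel_op_def[abs_def] funpow_deriv_diff[OF s smooth_deriv[OF smooth_deriv[OF s]]]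
      by (simp add: funpow_add numeral_2_eq_2 funpow_swap1)
  qed
  have "continuous_on ({0..T} \<times> UNIV) (\<lambda>p. (deriv ^^ n) (f (fst p)) (snd p) - (deriv ^^ (n + 2)) (f (fst p)) (snd p))"
    using assms unfolding smooth_family_def case_prod_beta by (intro continuous_on_diff) blast+
  then show "continuous_on ({0..T} \<times> UNIV) (\<lambda>(t, x). (deriv ^^ n) (bessel_op (f t)) x)"
    by (rule continuous_on_eq) (auto simp: eq simp del: funpow.simps)
qed

lemma smooth_family_funpow_bessel_op:
  "smooth_family T f \<Longrightarrow> smooth_family T (\<lambda>t. (bessel_op ^^ N) (f t))"
  by (induction N) (simp_all add: smooth_family_bessel_op)

section \<open>Sobolev norms of smooth functions\<close>

lemma fourier_coeff_deriv:
  assumes "smooth f" "periodic f"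
  shows "fourier_coeff (deriv f) n = \<i> * of_int n * fourier_coeff f n"
proof -
  have c: "continuous_on A f" "continuous_on A (deriv f)" for A
    using assms smooth_continuous smooth_deriv by auto
  let ?e = "\<lambda>x. cis (- (of_int n * x))"
  have e': "(?e has_vector_derivative - (\<i> * of_int n) * ?e x) (at x)" for x
  proof -
    have "((\<lambda>z. exp (- (\<i> * of_int n * z))) has_field_derivative
        exp (- (\<i> * of_int n * of_real x)) * - (\<i> * of_int n)) (at (of_real x))"
      by (auto intro!: derivative_eq_intros)
    from has_vector_derivative_real_field[OF this] show ?thesis
      by (simp add: cis_conv_exp mult_ac)
  qed
  have "((\<lambda>x. of_real (deriv f x) * ?e x + of_real (f x) * (- (\<i> * of_int n) * ?e x)) has_integral
      (of_real (f pi) * ?e pi - of_real (f (-pi)) * ?e (-pi))) {-pi..pi}"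
  proof (rule fundamental_theorem_of_calculus)
    fix x
    have "((\<lambda>x. of_real (f x) :: complex) has_vector_derivative of_real (deriv f x)) (at x)"
      using smooth_DERIV[OF assms(1)] by (intro has_vector_derivative_of_real) (simp add: has_real_derivative_iff_has_vector_derivative)
    from has_vector_derivative_mult[OF this e']
    show "((\<lambda>x. of_real (f x) * ?e x) has_vector_derivative
        of_real (deriv f x) * ?e x + of_real (f x) * (- (\<i> * of_int n) * ?e x)) (at x within {-pi..pi})"
      by (rule has_vector_derivative_at_within[OF has_vector_derivative_eq_rhs]) simp
  qed simp
  moreover have "f pi = f (-pi)" "?e pi = ?e (-pi)"
    using periodic_D[OF assms(2), of "-pi"] by (auto simp: complex_eq_iff sin_zero_iff_int2)
  ultimately have 0: "integral {-pi..pi} (\<lambda>x. of_real (deriv f x) * ?e x + of_real (f x) * (- (\<i> * of_int n) * ?e x)) = 0"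
    by (simp add: integral_unique)
  have "integral {-pi..pi} (\<lambda>x. of_real (deriv f x) * ?e x) = integral {-pi..pi} (\<lambda>x. \<i> * of_int n * (of_real (f x) * ?e x))"
  proof -
    have "integral {-pi..pi} (\<lambda>x. of_real (deriv f x) * ?e x) =
      integral {-pi..pi} (\<lambda>x. (of_real (deriv f x) * ?e x + of_real (f x) * (- (\<i> * of_int n) * ?e x)) + \<i> * of_int n * (of_real (f x) * ?e x))"
      by (simp add: algebra_simps)
    also have "\<dots> = 0 + integral {-pi..pi} (\<lambda>x. \<i> * of_int n * (of_real (f x) * ?e x))"
      unfolding 0[symmetric]
      by (rule integral_add) (intro integrable_continuous_interval continuous_intros c)+
    finally show ?thesis by simp
  qed
  then show ?thesis
    by (simp add: fourier_coeff_integral c)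
qed

lemma fourier_coeff_bessel_op:
  assumes "smooth f" "periodic f"
  shows "fourier_coeff (bessel_op f) n = of_real ((japanese n)\<^sup>2) * fourier_coeff f n"
proof -
  have "fourier_coeff (bessel_op f) n = fourier_coeff f n - fourier_coeff (deriv (deriv f)) n"
    unfolding bessel_op_def[abs_def] using assms
    by (intro fourier_coeff_diff smooth_continuous smooth_deriv)
  also have "fourier_coeff (deriv (deriv f)) n = \<i> * of_int n * (\<i> * of_int n * fourier_coeff f n)"
    using assms by (simp add: fourier_coeff_deriv smooth_deriv periodic_deriv)
  also have "\<dots> = \<i> * \<i> * ((of_int n)\<^sup>2 * fourier_coeff f n)"
    by (simp only: power2_eq_square mult_ac)
  finally show ?thesis by (simp add: japanese_def algebra_simps)
qed

lemma fourier_coeff_funpow_bessel_op: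
  assumes "smooth f" "periodic f"
  shows "fourier_coeff ((bessel_op ^^ N) f) n = of_real ((japanese n) ^ (2 * N)) * fourier_coeff f n"
  by (induction N)
     (simp_all add: fourier_coeff_bessel_op smooth_funpow_bessel_op periodic_funpow_bessel_op assms
       power2_eq_square mult_ac)

lemma norm_fourier_coeff_le:
  assumes "continuous_on UNIV f" "\<And>x. x \<in> {-pi..pi} \<Longrightarrow> \<bar>f x\<bar> \<le> B"
  shows "cmod (fourier_coeff f n) \<le> B"
proof -
  have c: "continuous_on {-pi..pi} f" using assms(1) continuous_on_subset by blast
  have "norm (integral {-pi..pi} (\<lambda>x. of_real (f x) * cis (- (of_int n * x)))) \<le> B * (pi - (- pi))"
    by (rule integral_bound) (auto intro!: continuous_intros c simp: norm_mult assms(2))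
  then show ?thesis by (simp add: fourier_coeff_integral[OF c] norm_divide field_simps)
qed

text \<open>The sup bound makes the n-th coefficient at most \<open>B\<close> times the bracket to
  the power -2 (m + 1). The Sobolev weight uses up m of these powers; of the remaining m + 2 only
  3/4 is kept, which is already square summable. The bound is linear in \<open>B\<close>, as needed
  for convergence in time.\<close>

lemma sobolev_norm_smooth_le:
  assumes "smooth f" "periodic f" "s \<le> real m"
    and B: "\<And>x. x \<in> {-pi..pi} \<Longrightarrow> \<bar>(bessel_op ^^ (m + 1)) f x\<bar> \<le> B"
  shows "sobolev s f" "sobolev_norm s f \<le> B * embedding_const"
proof -
  have "B \<ge> 0" using B[of 0] by (auto intro: order_trans[OF abs_ge_zero])
  define c where "c n = cmod (fourier_coeff f n)" for n
  let ?q = "\<lambda>n. (1 + (real_of_int n)\<^sup>2) powr s * (cmod (fourier_coeff f n))\<^sup>2"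
  have le: "?q n \<le> B\<^sup>2 * japanese n powr (- 3 / 2)" for n
  proof -
    have "japanese n ^ (2 * (m + 1)) * c n = cmod (fourier_coeff ((bessel_op ^^ (m + 1)) f) n)"
      unfolding fourier_coeff_funpow_bessel_op[OF assms(1,2)] by (simp add: norm_mult norm_power c_def)
    also have "\<dots> \<le> B"
      by (intro norm_fourier_coeff_le B smooth_continuous smooth_funpow_bessel_op assms)
    finally have cB: "japanese n ^ (2 * (m + 1)) * c n \<le> B" .
    have c0: "c n \<ge> 0" by (simp add: c_def)
    have "(1 + (real_of_int n)\<^sup>2) powr s \<le> (1 + (real_of_int n)\<^sup>2) powr real m"
      using assms(3) by (intro powr_mono) auto
    also have "\<dots> = japanese n ^ (2 * m)"
      by (simp add: powr_realpow japanese_def power_mult add_pos_nonneg)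
    finally have "?q n \<le> japanese n ^ (2 * m) * (c n)\<^sup>2"
      unfolding c_def by (intro mult_right_mono) auto
    also have "\<dots> = (japanese n ^ m * c n)\<^sup>2"
      by (simp add: power_mult_distrib power_mult mult.commute)
    also have "\<dots> \<le> (B * japanese n powr (- 3 / 4))\<^sup>2"
    proof (rule power_mono)
      have "japanese n ^ m * c n * japanese n powr (3/4) \<le> japanese n ^ m * c n * japanese n powr (real (m + 2))"
        using c0 japanese_ge(1)[of n] by (intro mult_left_mono powr_mono) auto
      also have "\<dots> = japanese n ^ (2 * (m + 1)) * c n"
      proof -
        have "2 * (m + 1) = m + (m + 2)" by simp
        then show ?thesis unfolding powr_realpow[OF japanese_pos(1)] by (simp only: power_add mult_ac)
      qed
      also note cB
      finally have "japanese n ^ m * c n * japanese n powr (3/4) \<le> B" .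
      then show "japanese n ^ m * c n \<le> B * japanese n powr (- 3 / 4)"
        using less_imp_neq[OF japanese_pos(1)[of n]] by (simp add: powr_minus divide_simps)
      show "0 \<le> japanese n ^ m * c n" using c0 by simp
    qed
    also have "\<dots> = B\<^sup>2 * japanese n powr (- 3 / 2)"
      by (simp add: power_mult_distrib) (simp add: power2_eq_square powr_add[symmetric])
    finally show ?thesis .
  qed
  have sum': "(\<lambda>n. B\<^sup>2 * japanese n powr (- 3 / 2)) summable_on UNIV"
    by (intro summable_on_cmult_right summable_japanese_powr)
  have sum: "?q summable_on UNIV"
    by (rule summable_on_comparison_test[OF sum' le]) auto
  show "sobolev s f"
    unfolding sobolev_def using sum by (simp add: L2_torus_continuous smooth_continuous assms)
  have "sobolev_norm s f \<le> sqrt (\<Sum>\<^sub>\<infinity>n. B\<^sup>2 * japanese n powr (- 3 / 2))"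
    unfolding sobolev_norm_def by (intro real_sqrt_le_mono infsum_mono sum sum' le)
  also have "\<dots> = B * embedding_const"
    using \<open>B \<ge> 0\<close> by (simp add: infsum_cmult_right' real_sqrt_mult embedding_const_def)
  finally show "sobolev_norm s f \<le> B * embedding_const" .
qed

lemma smooth_sobolev:
  assumes "smooth f" "periodic f"
  shows "sobolev (real m) f"
proof -
  have "continuous_on {-pi..pi} ((bessel_op ^^ (m + 1)) f)"
    using assms by (intro smooth_continuous smooth_funpow_bessel_op)
  then have "bounded ((bessel_op ^^ (m + 1)) f ` {-pi..pi})"
    by (intro compact_imp_bounded compact_continuous_image compact_Icc)
  then obtain B where "\<forall>y \<in> (bessel_op ^^ (m + 1)) f ` {-pi..pi}. \<bar>y\<bar> \<le> B"
    unfolding bounded_real by (elim exE)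
  then show ?thesis
    by (intro sobolev_norm_smooth_le(1)[OF assms order_refl]) (erule bspec, erule imageI)
qed

lemma smooth_family_continuous:
  assumes "smooth_family T f"
  shows "continuous_on ({0..T} \<times> UNIV) (\<lambda>(t, x). f t x)"
    and "continuous_on ({0..T} \<times> UNIV) (\<lambda>(t, x). deriv (f t) x)"
  using assms[unfolded smooth_family_def, THEN conjunct2, rule_format, of 0]
    assms[unfolded smooth_family_def, THEN conjunct2, rule_format, of 1] by simp_all

lemma smooth_family_bounded:
  assumes "smooth_family T f"
  shows "\<exists>B. \<forall>t\<in>{0..T}. \<forall>x\<in>{-pi..pi}. \<bar>f t x\<bar> \<le> B"
proof -
  have "continuous_on ({0..T} \<times> {-pi..pi}) (\<lambda>(t, x). f t x)"
    by (rule continuous_on_subset[OF smooth_family_continuous(1)[OF assms]]) auto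
  then have "bounded ((\<lambda>(t, x). f t x) ` ({0..T} \<times> {-pi..pi}))"
    by (intro compact_imp_bounded compact_continuous_image compact_Times compact_Icc)
  then obtain B where B: "\<forall>y \<in> (\<lambda>(t, x). f t x) ` ({0..T} \<times> {-pi..pi}). \<bar>y\<bar> \<le> B"
    unfolding bounded_real by (elim exE)
  have "\<bar>f t x\<bar> \<le> B" if "t \<in> {0..T}" "x \<in> {-pi..pi}" for t x
  proof -
    have "f t x \<in> (\<lambda>(t, x). f t x) ` ({0..T} \<times> {-pi..pi})"
      by (rule image_eqI[of _ _ "(t, x)"]) (use that in simp_all)
    then show ?thesis by (rule bspec[OF B])
  qed
  then show ?thesis by blast
qed

lemma smooth_family_uniform:
  assumes "smooth_family T f" "t \<in> {0..T}" "e > 0"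
  shows "eventually (\<lambda>t'. \<forall>x\<in>{-pi..pi}. \<bar>f t' x - f t x\<bar> \<le> e) (at t within {0..T})"
proof -
  have "continuous_on ({0..T} \<times> {-pi..pi}) (\<lambda>(t, x). f t x)"
    by (rule continuous_on_subset[OF smooth_family_continuous(1)[OF assms(1)]]) auto
  then have "uniformly_continuous_on ({0..T} \<times> {-pi..pi}) (\<lambda>(t, x). f t x)"
    by (intro compact_uniformly_continuous compact_Times compact_Icc)
  then obtain d where d: "d > 0" "\<And>p p'. p \<in> {0..T} \<times> {-pi..pi} \<Longrightarrow> p' \<in> {0..T} \<times> {-pi..pi} \<Longrightarrow>
      dist p' p < d \<Longrightarrow> dist (case p' of (t, x) \<Rightarrow> f t x) (case p of (t, x) \<Rightarrow> f t x) < e"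
    using assms(3) unfolding uniformly_continuous_on_def by blast
  show ?thesis
    unfolding eventually_at
  proof (intro exI[of _ d] conjI d(1) ballI impI)
    fix t' x assume "t' \<in> {0..T}" "t' \<noteq> t \<and> dist t' t < d" "x \<in> {-pi..pi}"
    then show "\<bar>f t' x - f t x\<bar> \<le> e"
      using d(2)[of "(t, x)" "(t', x)"] assms(2) by (simp add: dist_Pair_Pair dist_real_def)
  qed
qed

text \<open>Powers of \<open>bessel_op\<close> are linear and preserve smooth families. The
  difference of two time slices therefore has a uniformly small image under them by uniform
  continuity on a compact set, and so a small Sobolev norm.\<close>

lemma smooth_family_C_sobolev:
  assumes f: "smooth_family T f" and "s \<le> real m"
  shows "C_sobolev s T f"
  unfolding C_sobolev_def
proof (intro ballI conjI)
  fix t assume t: "t \<in> {0..T}"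
  have sm: "smooth (f t)" "periodic (f t)" if "t \<in> {0..T}" for t
    using f that by (auto simp: smooth_family_def)
  note L = smooth_family_funpow_bessel_op[OF f, of "m + 1"]
  obtain B where B: "\<forall>t\<in>{0..T}. \<forall>x\<in>{-pi..pi}. \<bar>(bessel_op ^^ (m + 1)) (f t) x\<bar> \<le> B"
    using smooth_family_bounded[OF L] by (elim exE)
  show "sobolev s (f t)"
    by (rule sobolev_norm_smooth_le(1)[OF sm[OF t] assms(2) bspec[OF bspec[OF B t]]])
  have emb: "embedding_const \<ge> 0" by (simp add: embedding_const_def infsum_nonneg)
  show "((\<lambda>t'. sobolev_norm s (\<lambda>x. f t' x - f t x)) \<longlongrightarrow> 0) (at t within {0..T})"
  proof (rule tendstoI)
    fix e :: real assume e: "e > 0"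
    \<comment> \<open>The summand 1 avoids dividing by zero, and the factor 2 turns the non-strict
      estimates into a strict one.\<close>
    define \<delta> where "\<delta> = e / (2 * (embedding_const + 1))"
    have "\<delta> > 0" using e emb by (simp add: \<delta>_def)
    have "eventually (\<lambda>t'. t' \<in> {0..T}) (at t within {0..T})" by (auto simp: eventually_at_filter)
    with smooth_family_uniform[OF L t \<open>\<delta> > 0\<close>]
    show "eventually (\<lambda>t'. dist (sobolev_norm s (\<lambda>x. f t' x - f t x)) 0 < e) (at t within {0..T})"
    proof eventually_elim
      case (elim t')
      have per: "periodic (\<lambda>x. f t' x - f t x)"
        using periodic_D[OF sm(2)[OF t]] periodic_D[OF sm(2)[OF elim(2)]] by (simp add: periodic_def)
      have "sobolev_norm s (\<lambda>x. f t' x - f t x) \<le> \<delta> * embedding_const"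
        by (rule sobolev_norm_smooth_le(2)[OF smooth_diff[OF sm(1)[OF elim(2)] sm(1)[OF t]] per assms(2)])
           (use elim(1) in \<open>simp only: funpow_bessel_op_diff[OF sm(1)[OF elim(2)] sm(1)[OF t]]\<close>)
      also have "\<dots> \<le> \<delta> * (embedding_const + 1)" using \<open>\<delta> > 0\<close> by simp
      also have "\<dots> = e / 2" using emb by (simp add: \<delta>_def field_simps)
      also have "\<dots> < e" using e by simp
      finally show ?case by (simp add: sobolev_norm_def infsum_nonneg)
    qed
  qed
qed

lemma smooth_family_Linf_sobolev:
  assumes f: "smooth_family T f"
  shows "Linf_sobolev (real m) T f"
  unfolding Linf_sobolev_def
proof (intro conjI allI)
  fix n :: int
  have c: "continuous_on {-pi..pi} (f t)" if "t \<in> {0..T}" for t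
    by (rule continuous_on_Times_swap[OF smooth_family_continuous(1)[OF f] that])
  have "continuous_on ({0..T} \<times> cbox (-pi) pi) (\<lambda>(t, x). f t x)"
    by (rule continuous_on_subset[OF smooth_family_continuous(1)[OF f]]) auto
  then have "continuous_on ({0..T} \<times> cbox (-pi) pi) (\<lambda>(t, x). of_real (f t x) * cis (- (of_int n * x)))"
    unfolding case_prod_beta by (intro continuous_intros)
  from integral_continuous_on_param[OF this]
  have "continuous_on {0..T} (\<lambda>t. integral {-pi..pi} (\<lambda>x. of_real (f t x) * cis (- (of_int n * x))) / of_real (2 * pi))"
    by (intro continuous_intros) (simp_all add: cbox_interval)
  then have "continuous_on {0..T} (\<lambda>t. fourier_coeff (f t) n)"
    by (rule continuous_on_eq) (simp add: fourier_coeff_integral c)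
  then show "set_borel_measurable lborel {0..T} (\<lambda>t. fourier_coeff (f t) n)"
    unfolding set_borel_measurable_def by (simp add: borel_measurable_continuous_on_indicator)
next
  obtain B where B: "\<forall>t\<in>{0..T}. \<forall>x\<in>{-pi..pi}. \<bar>(bessel_op ^^ (m + 1)) (f t) x\<bar> \<le> B"
    using smooth_family_bounded[OF smooth_family_funpow_bessel_op[OF f, of "m + 1"]] by (elim exE)
  have "sobolev (real m) (f t) \<and> sobolev_norm (real m) (f t) \<le> B * embedding_const" if t: "t \<in> {0..T}" for t
    using sobolev_norm_smooth_le[OF _ _ order_refl bspec[OF bspec[OF B t]]] f t by (simp add: smooth_family_def)
  then show "\<exists>C. AE t in lborel. t \<in> {0..T} \<longrightarrow> sobolev (real m) (f t) \<and> sobolev_norm (real m) (f t) \<le> C"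
    by (intro exI[of _ "B * embedding_const"] AE_I2) auto
qed

section \<open>Weak derivatives and distributional equations for smooth families\<close>

lemma integral_deriv_by_parts:
  assumes "smooth f" "periodic f" "smooth g" "periodic g"
  shows "integral {-pi..pi} (\<lambda>x. deriv f x * g x) = - integral {-pi..pi} (\<lambda>x. f x * deriv g x)"
proof -
  have c: "continuous_on A f" "continuous_on A (deriv f)" "continuous_on A g" "continuous_on A (deriv g)" for A
    using assms by (auto intro: smooth_continuous smooth_deriv)
  have "((\<lambda>x. deriv f x * g x + f x * deriv g x) has_integral f pi * g pi - f (-pi) * g (-pi)) {-pi..pi}"
  proof (rule fundamental_theorem_of_calculus)
    fix x
    have "((\<lambda>x. f x * g x) has_real_derivative deriv f x * g x + deriv g x * f x) (at x within {-pi..pi})"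
      using DERIV_mult[OF smooth_DERIV[OF assms(1)] smooth_DERIV[OF assms(3)]]
      by (rule has_field_derivative_at_within)
    then show "((\<lambda>x. f x * g x) has_vector_derivative deriv f x * g x + f x * deriv g x) (at x within {-pi..pi})"
      by (simp add: has_real_derivative_iff_has_vector_derivative mult.commute)
  qed simp
  moreover have "f pi = f (-pi)" "g pi = g (-pi)"
    using periodic_D[OF assms(2), of "-pi"] periodic_D[OF assms(4), of "-pi"] by auto
  ultimately have "integral {-pi..pi} (\<lambda>x. deriv f x * g x + f x * deriv g x) = 0"
    by (simp add: integral_unique)
  moreover have "integral {-pi..pi} (\<lambda>x. deriv f x * g x + f x * deriv g x) =
      integral {-pi..pi} (\<lambda>x. deriv f x * g x) + integral {-pi..pi} (\<lambda>x. f x * deriv g x)"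
    by (intro integral_add integrable_continuous_interval continuous_intros c)
  ultimately show ?thesis by simp
qed

lemma weak_deriv_smooth:
  assumes f: "smooth f" "periodic f"
  shows "weak_deriv m f ((deriv ^^ m) f)"
proof -
  have parts: "integral {-pi..pi} (\<lambda>x. (deriv ^^ m) f x * \<phi> x) =
    (- 1) ^ m * integral {-pi..pi} (\<lambda>x. f x * (deriv ^^ m) \<phi> x)" if "smooth \<phi>" "periodic \<phi>" for \<phi>
    using that
  proof (induction m arbitrary: \<phi>)
    case (Suc m)
    have "integral {-pi..pi} (\<lambda>x. (deriv ^^ Suc m) f x * \<phi> x) =
       - integral {-pi..pi} (\<lambda>x. (deriv ^^ m) f x * deriv \<phi> x)"
      using integral_deriv_by_parts[OF smooth_funpow_deriv[OF f(1)] periodic_funpow_deriv[OF f(2)] Suc.prems] by simp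
    also have "\<dots> = (- 1) ^ Suc m * integral {-pi..pi} (\<lambda>x. f x * (deriv ^^ Suc m) \<phi> x)"
      by (simp add: Suc.IH[OF smooth_deriv[OF Suc.prems(1)] periodic_deriv[OF Suc.prems(2)]] funpow_swap1)
    finally show ?case .
  qed simp
  show ?thesis
    unfolding weak_deriv_def smooth_torus_iff
  proof (intro allI impI)
    fix \<phi> :: "real \<Rightarrow> real" assume \<phi>: "periodic \<phi> \<and> smooth \<phi>"
    have c: "continuous_on {-pi..pi} (\<lambda>x. (deriv ^^ m) f x * \<phi> x)" "continuous_on {-pi..pi} (\<lambda>x. f x * (deriv ^^ m) \<phi> x)"
      using \<phi> f by (auto intro!: smooth_continuous smooth_mult smooth_funpow_deriv)
    show "(LINT x:{-pi..pi}|lborel. (deriv ^^ m) f x * \<phi> x) =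
        (- 1) ^ m * (LINT x:{-pi..pi}|lborel. f x * (deriv ^^ m) \<phi> x)"
      using parts \<phi> by (simp add: LINT_continuous[OF compact_Icc c(1)] LINT_continuous[OF compact_Icc c(2)])
  qed
qed

text \<open>The zero weight is sqrt(k/\<omega>) for k = 0. The weighted derivative is then the zero
  distribution, whatever the derivative of order m is.\<close>

lemma smooth_family_regular:
  assumes f: "smooth_family T f"
  shows "regular m T (\<lambda>t x. 0) f"
proof -
  have sm: "smooth (f t)" "periodic (f t)" if "t \<in> {0..T}" for t
    using f that by (auto simp: smooth_family_def)
  have "weighted_deriv m (\<lambda>x. 0) (f t) (\<lambda>x. 0)" if t: "t \<in> {0..T}" for t
    unfolding weighted_deriv_def
    using sm[OF t] weak_deriv_smooth[OF sm[OF t]]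
    by (intro exI[of _ "(deriv ^^ m) (f t)"])
       (auto simp: L2_torus_continuous smooth_continuous smooth_funpow_deriv periodic_funpow_deriv)
  then have "weighted_L2 m T (\<lambda>t x. 0) f"
    unfolding weighted_L2_def by (intro exI[of _ "\<lambda>t x. 0"]) (auto simp: set_integrable_def)
  then show ?thesis
    unfolding regular_def using sm
    by (auto simp: smooth_continuous smooth_family_Linf_sobolev[OF f] intro: smooth_family_C_sobolev[OF f, of _ m])
qed

lemma smooth_family_const_in_space:
  assumes "continuous_on {0..T} c"
  shows "smooth_family T (\<lambda>t x. c t)"
proof -
  have deriv: "(deriv ^^ n) (\<lambda>x. a) = (\<lambda>x. if n = 0 then a else 0)" for n and a :: real
    by (induction n) auto
  have "continuous_on ({0..T} \<times> UNIV) (\<lambda>p. c (fst p))"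
    by (intro continuous_on_compose2[OF assms] continuous_intros) auto
  then have "continuous_on ({0..T} \<times> UNIV) (\<lambda>p. if n = 0 then c (fst p) else 0)" for n :: nat
    by (cases "n = 0") simp_all
  then have "\<forall>n::nat. continuous_on ({0..T} \<times> UNIV) (\<lambda>p. if n = 0 then c (fst p) else 0)"
    by (rule allI)
  then show ?thesis
    unfolding smooth_family_def deriv case_prod_beta by (simp add: periodic_def smooth_const)
qed

text \<open>For fixed x the integrand is the time derivative of - f \<phi>, because f_t = - g. It
  integrates to zero since \<phi> vanishes at both end times, and integrating in time first by
  Fubini finishes.\<close>

lemma distr_eq_classical:
  fixes f g h :: "real \<Rightarrow> real \<Rightarrow> real"
  assumes T: "T > 0"
    and f: "continuous_on ({0..T} \<times> UNIV) (\<lambda>(t, x). f t x)"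
    and g: "continuous_on ({0..T} \<times> UNIV) (\<lambda>(t, x). g t x)"
    and f': "\<And>t x. t \<in> {0..T} \<Longrightarrow> ((\<lambda>t. f t x) has_real_derivative - g t x) (at t within {0..T})"
    and h: "\<And>t x. h t x = 0"
  shows "distr_eq T f g h"
  unfolding distr_eq_def Let_def
proof (intro allI impI)
  fix \<phi> assume \<phi>: "test_fun T \<phi>"
  have diff: "foldr (\<lambda>D g. D g) Ds \<phi> differentiable_on UNIV" if "set Ds \<subseteq> {partial_t, partial_x}" for Ds
    using \<phi> that unfolding test_fun_def by blast
  have \<phi>_diff: "\<phi> differentiable_on UNIV" using diff[of "[]"] by simp
  have \<phi>_cont: "continuous_on A \<phi>" "continuous_on A (partial_t \<phi>)" for A
    using differentiable_imp_continuous_on[OF \<phi>_diff]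
      differentiable_imp_continuous_on[OF diff[of "[partial_t]"]] continuous_on_subset[OF _ subset_UNIV] by auto
  obtain a b where ab: "0 < a" "b < T" "\<And>t x. t \<notin> {a..b} \<Longrightarrow> \<phi> (t, x) = 0"
    using \<phi> unfolding test_fun_def by blast
  have \<phi>': "((\<lambda>s. \<phi> (s, x)) has_real_derivative partial_t \<phi> (t, x)) (at t)" for t x
  proof -
    have 1: "(\<lambda>s. (s, x)) differentiable (at t)"
      unfolding differentiable_def by (rule exI[of _ "\<lambda>h. (h, 0)"]) (auto intro!: derivative_eq_intros)
    have 2: "\<phi> differentiable (at (t, x))" using \<phi>_diff by (simp add: differentiable_on_def)
    have "(\<lambda>s. \<phi> (s, x)) differentiable (at t)"
      using differentiable_chain_at[OF 1 2] by (simp add: o_def)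
    then show ?thesis by (simp add: partial_t_def DERIV_deriv_iff_real_differentiable)
  qed
  define F where "F t x = - f t x * partial_t \<phi> (t, x) + g t x * \<phi> (t, x)" for t x
  have F_eq: "(\<lambda>(t, x). - f t x * partial_t \<phi> (t, x) + g t x * \<phi> (t, x) + h t x * partial_x \<phi> (t, x)) = (\<lambda>(t, x). F t x)"
    by (simp add: F_def h fun_eq_iff)
  have F_cont: "continuous_on ({0..T} \<times> UNIV) (\<lambda>(t, x). F t x)"
    unfolding F_def case_prod_beta prod.collapse using f g \<phi>_cont unfolding case_prod_beta
    by (intro continuous_on_add continuous_on_mult continuous_on_minus) auto
  then have F_cont': "continuous_on ({0..T} \<times> {-pi..pi}) (\<lambda>(t, x). F t x)"
    by (rule continuous_on_subset) auto
  have comp: "compact ({0..T} \<times> {-pi..pi})" by (intro compact_Times compact_Icc)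
  have inner: "integral {0..T} (\<lambda>t. F t x) = 0" for x
  proof -
    have "((\<lambda>t. F t x) has_integral (- (f T x * \<phi> (T, x)) - - (f 0 x * \<phi> (0, x)))) {0..T}"
    proof (rule fundamental_theorem_of_calculus)
      fix t assume t: "t \<in> {0..T}"
      have "((\<lambda>t. - (f t x * \<phi> (t, x))) has_real_derivative - (- g t x * \<phi> (t, x) + partial_t \<phi> (t, x) * f t x)) (at t within {0..T})"
        by (intro DERIV_minus DERIV_mult f' t) (rule has_field_derivative_at_within[OF \<phi>'])
      then show "((\<lambda>t. - (f t x * \<phi> (t, x))) has_vector_derivative F t x) (at t within {0..T})"
        by (simp add: has_real_derivative_iff_has_vector_derivative F_def algebra_simps)
    qed (use T in simp)
    moreover have "\<phi> (T, x) = 0" "\<phi> (0, x) = 0" using ab by auto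
    ultimately show ?thesis by (simp add: integral_unique)
  qed
  have "(LINT p:{0..T} \<times> {-pi..pi}|lborel. case p of (t, x) \<Rightarrow> F t x) =
      integral (cbox (0, -pi) (T, pi)) (\<lambda>(t, x). F t x)"
    using LINT_continuous[OF comp F_cont'] by (simp only: cbox_times)
  also have "\<dots> = integral {0..T} (\<lambda>t. integral {-pi..pi} (F t))"
    using integral_prod_continuous[OF F_cont'[unfolded cbox_times]] by (simp add: cbox_interval)
  also have "\<dots> = integral {-pi..pi} (\<lambda>x. integral {0..T} (\<lambda>t. F t x))"
    using integral_swap_continuous[OF F_cont'[unfolded cbox_times]] by (simp add: cbox_interval)
  also have "\<dots> = 0" by (simp add: inner)
  finally show "set_integrable lborel ({0..T} \<times> {-pi..pi})
      (\<lambda>(t, x). - f t x * partial_t \<phi> (t, x) + g t x * \<phi> (t, x) + h t x * partial_x \<phi> (t, x)) \<and>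
    (LINT p:{0..T} \<times> {-pi..pi}|lborel. (case p of (t, x) \<Rightarrow>
      - f t x * partial_t \<phi> (t, x) + g t x * \<phi> (t, x) + h t x * partial_x \<phi> (t, x))) = 0"
    unfolding F_eq using set_integrable_continuous[OF comp F_cont'] by simp
qed

section \<open>The smooth solution of Burgers' equation before the collision\<close>

lemma abs_sin_diff_le: "\<bar>sin a - sin b\<bar> \<le> \<bar>a - b :: real\<bar>"
proof -
  have "\<bar>sin a - sin b\<bar> = 2 * \<bar>sin ((a - b) / 2)\<bar> * \<bar>cos ((a + b) / 2)\<bar>"
    by (simp add: sin_diff_sin abs_mult)
  also have "\<dots> \<le> 2 * \<bar>(a - b) / 2\<bar> * 1"
    by (intro mult_mono abs_sin_x_le_abs_x) auto
  finally show ?thesis by simp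
qed

text \<open>The starting point of the characteristic through (t, x). By the intermediate value
  theorem one exists for every real t, so the choice is never arbitrary junk; uniqueness is
  available only for |t| < 1 in general, whence the fixed bound \<tau> < 1 in the context
  below.\<close>

definition foot :: "real \<Rightarrow> real \<Rightarrow> real" where
  "foot t x = (SOME y. y + t * sin y = x)"

lemma foot_eq: "foot t x + t * sin (foot t x) = x"
  unfolding foot_def
proof (rule someI_ex)
  have bound: "\<bar>t * sin y\<bar> \<le> \<bar>t\<bar>" for y
    using mult_left_mono[of "\<bar>sin y\<bar>" 1 "\<bar>t\<bar>"] by (simp add: abs_mult)
  have "\<exists>y\<ge>x - \<bar>t\<bar>. y \<le> x + \<bar>t\<bar> \<and> y + t * sin y = x"
    using bound[of "x - \<bar>t\<bar>"] bound[of "x + \<bar>t\<bar>"]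
    by (intro IVT' continuous_intros) auto
  then show "\<exists>y. y + t * sin y = x" by blast
qed

context
  fixes \<tau> :: real
  assumes \<tau>: "0 < \<tau>" "\<tau> < 1"
begin

text \<open>The foot is the fixed point of y \<mapsto> x - t sin y, a contraction with constant
  \<tau>, which explains the factor 1 / (1 - \<tau>). The bound on time enters only through
  \<open>t\<close>; \<open>t'\<close> may be any real number.\<close>

lemma foot_lipschitz:
  assumes "t \<in> {0..\<tau>}"
  shows "\<bar>foot t x - foot t' x'\<bar> \<le> (\<bar>x - x'\<bar> + \<bar>t - t'\<bar>) / (1 - \<tau>)"
proof -
  define y y' where "y = foot t x" and "y' = foot t' x'"
  have "y - y' = (x - x') - t * (sin y - sin y') - (t - t') * sin y'"
    using foot_eq[of t x] foot_eq[of t' x'] by (simp add: y_def y'_def algebra_simps)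
  then have "\<bar>y - y'\<bar> \<le> \<bar>x - x'\<bar> + \<bar>t * (sin y - sin y')\<bar> + \<bar>(t - t') * sin y'\<bar>" by linarith
  moreover have "\<bar>t * (sin y - sin y')\<bar> \<le> \<tau> * \<bar>y - y'\<bar>"
    unfolding abs_mult using assms \<tau> by (intro mult_mono abs_sin_diff_le) auto
  moreover have "\<bar>(t - t') * sin y'\<bar> \<le> \<bar>t - t'\<bar> * 1"
    unfolding abs_mult by (intro mult_left_mono) auto
  ultimately have "\<bar>y - y'\<bar> * (1 - \<tau>) \<le> \<bar>x - x'\<bar> + \<bar>t - t'\<bar>"
    by (simp add: algebra_simps)
  then show ?thesis using \<tau> by (simp add: y_def y'_def pos_le_divide_eq)
qed

lemma foot_unique:
  assumes "t \<in> {0..\<tau>}" "y + t * sin y = x"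
  shows "foot t x = y"
proof -
  have "foot t x - y = - (t * (sin (foot t x) - sin y))"
    using foot_eq[of t x] assms(2) by (simp add: algebra_simps)
  then have "\<bar>foot t x - y\<bar> = \<bar>t\<bar> * \<bar>sin (foot t x) - sin y\<bar>"
    by (simp add: abs_mult)
  also have "\<dots> \<le> \<tau> * \<bar>foot t x - y\<bar>"
    using assms(1) \<tau> by (intro mult_mono abs_sin_diff_le) auto
  finally have "\<bar>foot t x - y\<bar> * (1 - \<tau>) \<le> 0" by (simp add: algebra_simps)
  then show ?thesis using \<tau> by (simp add: mult_le_0_iff)
qed

lemma foot_continuous: "continuous_on ({0..\<tau>} \<times> UNIV) (\<lambda>p. foot (fst p) (snd p))"
  unfolding continuous_on_def
proof
  fix p :: "real \<times> real" assume p: "p \<in> {0..\<tau>} \<times> UNIV"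
  let ?F = "at p within {0..\<tau>} \<times> UNIV"
  have "((\<lambda>q. (\<bar>snd p - snd q\<bar> + \<bar>fst p - fst q\<bar>) / (1 - \<tau>)) \<longlongrightarrow> (\<bar>snd p - snd p\<bar> + \<bar>fst p - fst p\<bar>) / (1 - \<tau>)) ?F"
    using \<tau> by (intro tendsto_intros) auto
  then have 0: "((\<lambda>q. (\<bar>snd p - snd q\<bar> + \<bar>fst p - fst q\<bar>) / (1 - \<tau>)) \<longlongrightarrow> 0) ?F" by simp
  have "((\<lambda>q. foot (fst q) (snd q) - foot (fst p) (snd p)) \<longlongrightarrow> 0) ?F"
  proof (rule Lim_null_comparison[OF _ 0], rule always_eventually, rule allI)
    fix q :: "real \<times> real"
    show "norm (foot (fst q) (snd q) - foot (fst p) (snd p)) \<le> (\<bar>snd p - snd q\<bar> + \<bar>fst p - fst q\<bar>) / (1 - \<tau>)"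
      using foot_lipschitz[of "fst p" "snd p" "fst q" "snd q"] p by (auto simp: abs_minus_commute)
  qed
  then show "((\<lambda>p. foot (fst p) (snd p)) \<longlongrightarrow> foot (fst p) (snd p)) ?F"
    by (rule LIM_zero_cancel)
qed

lemma foot_periodic:
  assumes "t \<in> {0..\<tau>}"
  shows "foot t (x + 2 * pi) = foot t x + 2 * pi"
  by (rule foot_unique[OF assms]) (use foot_eq[of t x] in simp)

lemma jacobian_pos:
  assumes "t \<in> {0..\<tau>}"
  shows "1 + t * cos y > 0"
proof -
  have "\<bar>t * cos y\<bar> \<le> \<tau> * 1"
    unfolding abs_mult using assms \<tau> by (intro mult_mono) auto
  then show ?thesis using \<tau> by linarith
qed

text \<open>
  Caratheodory's form of the derivative of sine at the foot turns the implicit equation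
  into an explicit formula for the difference quotient.
\<close>

lemma foot_has_derivative_t:
  assumes t: "t \<in> {0..\<tau>}"
  shows "((\<lambda>t. foot t x) has_real_derivative - (sin (foot t x) / (1 + t * cos (foot t x)))) (at t within {0..\<tau>})"
proof -
  define y where "y s = foot s x" for s
  obtain g where g: "\<And>z. sin z - sin (y t) = g z * (z - y t)" "isCont g (y t)" "g (y t) = cos (y t)"
    using DERIV_sin[of "y t"] unfolding CARAT_DERIV by blast
  have path: "continuous_on {0..\<tau>} (\<lambda>s. (s, x))" by (intro continuous_intros)
  have "continuous_on {0..\<tau>} y"
    unfolding y_def using continuous_on_compose2[OF foot_continuous path] by auto
  then have y_lim: "(y \<longlongrightarrow> y t) (at t within {0..\<tau>})" using t by (simp add: continuous_on_def)
  then have gy: "((\<lambda>s. g (y s)) \<longlongrightarrow> cos (y t)) (at t within {0..\<tau>})"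
    using isCont_tendsto_compose[OF g(2)] g(3) by metis
  then have den: "((\<lambda>s. 1 + s * g (y s)) \<longlongrightarrow> 1 + t * cos (y t)) (at t within {0..\<tau>})"
    by (intro tendsto_intros)
  have lim: "((\<lambda>s. - sin (y t) / (1 + s * g (y s))) \<longlongrightarrow> - sin (y t) / (1 + t * cos (y t))) (at t within {0..\<tau>})"
    using jacobian_pos[OF t, of "y t"] by (intro tendsto_divide tendsto_const den) auto
  have "eventually (\<lambda>s. 1 + s * g (y s) > 0) (at t within {0..\<tau>})"
    using order_tendstoD(1)[OF den jacobian_pos[OF t]] .
  moreover have "eventually (\<lambda>s. s \<noteq> t) (at t within {0..\<tau>})" by (simp add: eventually_at_filter)
  ultimately have "eventually (\<lambda>s. - sin (y t) / (1 + s * g (y s)) = (y s - y t) / (s - t)) (at t within {0..\<tau>})"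
  proof eventually_elim
    case (elim s)
    have "(y s - y t) + s * (sin (y s) - sin (y t)) + (s - t) * sin (y t) = 0"
      using foot_eq[of s x] foot_eq[of t x] by (simp add: y_def algebra_simps)
    then have "(y s - y t) * (1 + s * g (y s)) = - (s - t) * sin (y t)"
      unfolding g(1) by (simp add: algebra_simps)
    then show ?case using elim by (simp add: divide_simps) (simp add: algebra_simps)
  qed
  then have "((\<lambda>s. (y s - y t) / (s - t)) \<longlongrightarrow> - sin (y t) / (1 + t * cos (y t))) (at t within {0..\<tau>})"
    by (rule Lim_transform_eventually[OF lim])
  then show ?thesis by (simp add: has_field_derivative_iff y_def)
qed

lemma foot_has_derivative_x:
  assumes t: "t \<in> {0..\<tau>}"
  shows "(foot t has_real_derivative inverse (1 + t * cos (foot t x))) (at x)"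
proof (rule DERIV_inverse_function[where f = "\<lambda>y. y + t * sin y" and a = "x - 1" and b = "x + 1"])
  show "((\<lambda>y. y + t * sin y) has_real_derivative 1 + t * cos (foot t x)) (at (foot t x))"
    by (auto intro!: derivative_eq_intros)
  show "1 + t * cos (foot t x) \<noteq> 0" using jacobian_pos[OF t, of "foot t x"] by simp
  show "foot t y + t * sin (foot t y) = y" for y by (rule foot_eq)
  have path: "continuous_on UNIV (\<lambda>y. (t, y))" by (intro continuous_intros)
  have sub: "(\<lambda>y. (t, y)) ` UNIV \<subseteq> {0..\<tau>} \<times> UNIV" using t by auto
  have "continuous_on UNIV (foot t)"
    using continuous_on_compose2[OF foot_continuous path sub] by simp
  then show "isCont (foot t) x" by (simp add: continuous_on_eq_continuous_at)
qed auto

text \<open>The algebra generated by these functions contains the solution and is closed under \<open>\<partial>\<^sub>x\<close>.\<close>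

inductive foot_algebra :: "(real \<Rightarrow> real \<Rightarrow> real) \<Rightarrow> bool" where
  const: "foot_algebra (\<lambda>t x. c)"
| time: "foot_algebra (\<lambda>t x. t)"
| sin: "foot_algebra (\<lambda>t x. sin (foot t x))"
| cos: "foot_algebra (\<lambda>t x. cos (foot t x))"
| inverse: "foot_algebra (\<lambda>t x. inverse (1 + t * cos (foot t x)))"
| add: "foot_algebra f \<Longrightarrow> foot_algebra g \<Longrightarrow> foot_algebra (\<lambda>t x. f t x + g t x)"
| mult: "foot_algebra f \<Longrightarrow> foot_algebra g \<Longrightarrow> foot_algebra (\<lambda>t x. f t x * g t x)"

lemma foot_algebra_deriv:
  "foot_algebra f \<Longrightarrow>
    \<exists>f'. foot_algebra f' \<and> (\<forall>t\<in>{0..\<tau>}. \<forall>x. (f t has_real_derivative f' t x) (at x))"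
proof (induction rule: foot_algebra.induct)
  case (const c)
  show ?case by (intro exI[of _ "\<lambda>t x. 0"] conjI foot_algebra.const) simp
next
  case time
  show ?case by (intro exI[of _ "\<lambda>t x. 0"] conjI foot_algebra.const) simp
next
  case sin
  show ?case
    by (intro exI[of _ "\<lambda>t x. cos (foot t x) * inverse (1 + t * cos (foot t x))"] conjI
        foot_algebra.mult foot_algebra.cos foot_algebra.inverse ballI allI DERIV_chain2[OF DERIV_sin]
        foot_has_derivative_x)
next
  case cos
  have "foot_algebra (\<lambda>t x. - 1 * sin (foot t x) * inverse (1 + t * cos (foot t x)))"
    by (intro foot_algebra.mult foot_algebra.const foot_algebra.sin foot_algebra.inverse)
  moreover have "((\<lambda>x. cos (foot t x)) has_real_derivative
      - 1 * sin (foot t x) * inverse (1 + t * cos (foot t x))) (at x)" if "t \<in> {0..\<tau>}" for t x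
    using DERIV_chain2[OF DERIV_cos foot_has_derivative_x[OF that]] by simp
  ultimately show ?case by blast
next
  case inverse
  let ?R = "\<lambda>t x. inverse (1 + t * cos (foot t x))"
  \<comment> \<open>Two of the three inverse factors come from differentiating the inverse, the
    third from the derivative of the foot. The factor t is the reason for the generator
    \<open>time\<close>.\<close>
  have "foot_algebra (\<lambda>t x. t * sin (foot t x) * ?R t x * ?R t x * ?R t x)"
    by (intro foot_algebra.mult foot_algebra.time foot_algebra.sin foot_algebra.inverse)
  moreover have "((\<lambda>x. ?R t x) has_real_derivative t * sin (foot t x) * ?R t x * ?R t x * ?R t x) (at x)"
    if t: "t \<in> {0..\<tau>}" for t x
  proof -
    have nz: "1 + t * cos (foot t x) \<noteq> 0" using jacobian_pos[OF t, of "foot t x"] by simp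
    have "((\<lambda>x. 1 + t * cos (foot t x)) has_real_derivative - (t * (sin (foot t x) * ?R t x))) (at x)"
      using DERIV_add[OF DERIV_const[of 1] DERIV_cmult[OF DERIV_chain2[OF DERIV_cos foot_has_derivative_x[OF t]], of t]]
      by simp
    from DERIV_inverse'[OF this nz] show ?thesis by (simp add: mult_ac)
  qed
  ultimately show ?case by blast
next
  case (add f g)
  then obtain f' g' where "foot_algebra f'" "foot_algebra g'"
    "\<And>t x. t \<in> {0..\<tau>} \<Longrightarrow> (f t has_real_derivative f' t x) (at x)"
    "\<And>t x. t \<in> {0..\<tau>} \<Longrightarrow> (g t has_real_derivative g' t x) (at x)" by blast
  then show ?case
    by (intro exI[of _ "\<lambda>t x. f' t x + g' t x"] conjI foot_algebra.add ballI allI DERIV_add)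
next
  case (mult f g)
  then obtain f' g' where "foot_algebra f'" "foot_algebra g'"
    "\<And>t x. t \<in> {0..\<tau>} \<Longrightarrow> (f t has_real_derivative f' t x) (at x)"
    "\<And>t x. t \<in> {0..\<tau>} \<Longrightarrow> (g t has_real_derivative g' t x) (at x)" by blast
  then show ?case using mult.hyps
    by (intro exI[of _ "\<lambda>t x. f' t x * g t x + g' t x * f t x"] conjI foot_algebra.add foot_algebra.mult
        ballI allI DERIV_mult)
qed

lemma foot_algebra_continuous:
  "foot_algebra f \<Longrightarrow> continuous_on ({0..\<tau>} \<times> UNIV) (\<lambda>p. f (fst p) (snd p))"
proof (induction rule: foot_algebra.induct)
  case inverse
  have "\<forall>p\<in>{0..\<tau>} \<times> UNIV. 1 + fst p * cos (foot (fst p) (snd p)) \<noteq> 0"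
    using jacobian_pos by (metis less_irrefl mem_Times_iff)
  then show ?case by (intro continuous_intros foot_continuous)
qed (intro continuous_intros foot_continuous; assumption)+

lemma foot_algebra_periodic:
  "foot_algebra f \<Longrightarrow> t \<in> {0..\<tau>} \<Longrightarrow> periodic (f t)"
  by (induction rule: foot_algebra.induct) (simp_all add: periodic_def foot_periodic)

text \<open>Iterated derivatives agree with members of the algebra only for times up to \<tau>, so
  the induction carries an equality restricted to that range.\<close>

lemma foot_algebra_smooth_family:
  assumes "foot_algebra f"
  shows "smooth_family \<tau> f"
proof -
  have smooth: "times_differentiable n (f t)" if "foot_algebra f" "t \<in> {0..\<tau>}" for n f t
    using that(1)
  proof (induction n arbitrary: f)
    case (Suc n)
    then show ?case using foot_algebra_deriv[OF Suc.prems] that(2) times_differentiable_SucI by metis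
  qed simp
  have "\<exists>g. foot_algebra g \<and> (\<forall>t\<in>{0..\<tau>}. (deriv ^^ n) (f t) = g t)" for n
  proof (induction n)
    case 0
    show ?case using assms by auto
  next
    case (Suc n)
    then obtain g where g: "foot_algebra g" "\<And>t. t \<in> {0..\<tau>} \<Longrightarrow> (deriv ^^ n) (f t) = g t" by blast
    obtain g' where g': "foot_algebra g'" "\<And>t x. t \<in> {0..\<tau>} \<Longrightarrow> (g t has_real_derivative g' t x) (at x)"
      using foot_algebra_deriv[OF g(1)] by blast
    have "(deriv ^^ Suc n) (f t) = g' t" if "t \<in> {0..\<tau>}" for t
      using g(2)[OF that] DERIV_imp_deriv[OF g'(2)[OF that]] by auto
    then show ?case using g'(1) by blast
  qed
  note derivs = this
  show ?thesis
    unfolding smooth_family_def smooth_def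
  proof (intro conjI ballI allI)
    fix n
    obtain g where g: "foot_algebra g" "\<And>t. t \<in> {0..\<tau>} \<Longrightarrow> (deriv ^^ n) (f t) = g t"
      using derivs by blast
    show "continuous_on ({0..\<tau>} \<times> UNIV) (\<lambda>(t, x). (deriv ^^ n) (f t) x)"
      by (rule continuous_on_eq[OF foot_algebra_continuous[OF g(1)]]) (auto simp: g(2))
  qed (use assms smooth foot_algebra_periodic in auto)
qed

text \<open>With \<omega> constant in space, transport and diffusion drop out of its equation and
  \<omega>' = - \<alpha>2 \<omega>^2 remains. For u, differentiating sin(foot) in t and in x with
  the two formulas for the foot gives u_t = - u u_x. The solution is smooth, so any \<open>m\<close>
  is allowed.\<close>

lemma local_solution:
  assumes "\<alpha>2 > 0"
  shows "kolmogorov_solution \<nu> \<alpha>1 \<alpha>2 \<alpha>3 \<alpha>4 m \<tau> sin (\<lambda>x. 1) (\<lambda>x. 0)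
    (\<lambda>t x. sin (foot t x)) (\<lambda>t x. 1 / (1 + \<alpha>2 * t)) (\<lambda>t x. 0)"
proof -
  define u where "u t x = sin (foot t x)" for t x
  define w where "w t = 1 / (1 + \<alpha>2 * t)" for t
  have den: "1 + \<alpha>2 * t > 0" if "t \<in> {0..\<tau>}" for t using assms that by (simp add: add_pos_nonneg)
  have w_pos: "w t > 0" if "t \<in> {0..\<tau>}" for t using den[OF that] by (simp add: w_def)
  have w_cont: "continuous_on {0..\<tau>} w"
    unfolding w_def by (intro continuous_intros) (use den in force)
  have u_fam: "smooth_family \<tau> u"
    unfolding u_def[abs_def] by (rule foot_algebra_smooth_family[OF foot_algebra.sin])
  have w_fam: "smooth_family \<tau> (\<lambda>t x. w t)" by (rule smooth_family_const_in_space[OF w_cont])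
  have zero_fam: "smooth_family \<tau> (\<lambda>t x. 0)" by (rule smooth_family_const_in_space) simp
  have u_x: "deriv (u t) x = cos (foot t x) * inverse (1 + t * cos (foot t x))" if "t \<in> {0..\<tau>}" for t x
    unfolding u_def by (intro DERIV_imp_deriv DERIV_chain2[OF DERIV_sin] foot_has_derivative_x that)
  have init: "u 0 = sin" "w 0 = 1" using foot_eq[of 0] by (simp_all add: u_def w_def fun_eq_iff)
  have eq_u: "distr_eq \<tau> u (\<lambda>t x. u t x * deriv (u t) x) (\<lambda>t x. 0)"
  proof (rule distr_eq_classical[OF \<tau>(1) smooth_family_continuous(1)[OF u_fam]])
    show "continuous_on ({0..\<tau>} \<times> UNIV) (\<lambda>(t, x). u t x * deriv (u t) x)"
      using smooth_family_continuous[OF u_fam] unfolding case_prod_beta by (rule continuous_on_mult)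
    show "((\<lambda>t. u t x) has_real_derivative - (u t x * deriv (u t) x)) (at t within {0..\<tau>})"
      if t: "t \<in> {0..\<tau>}" for t x
      using DERIV_chain2[OF DERIV_sin foot_has_derivative_t[OF t]] unfolding u_x[OF t]
      by (simp add: u_def divide_inverse mult_ac)
  qed simp
  have eq_w: "distr_eq \<tau> (\<lambda>t x. w t) (\<lambda>t x. \<alpha>2 * (w t)\<^sup>2) (\<lambda>t x. 0)"
  proof (rule distr_eq_classical[OF \<tau>(1) smooth_family_continuous(1)[OF w_fam]])
    show "continuous_on ({0..\<tau>} \<times> UNIV) (\<lambda>(t, x::real). \<alpha>2 * (w t)\<^sup>2)"
      using smooth_family_continuous(1)[OF w_fam] unfolding case_prod_beta by (intro continuous_intros)
    show "((\<lambda>t. w t) has_real_derivative - (\<alpha>2 * (w t)\<^sup>2)) (at t within {0..\<tau>})" if "t \<in> {0..\<tau>}" for t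
      unfolding w_def using den[OF that]
      by (auto intro!: derivative_eq_intros simp: power2_eq_square field_simps)
  qed simp
  have eq_0: "distr_eq \<tau> (\<lambda>t x. 0) (\<lambda>t x. 0) (\<lambda>t x. 0)"
    by (rule distr_eq_classical[OF \<tau>(1)]) (auto simp: case_prod_beta)
  show ?thesis
    unfolding kolmogorov_solution_def Let_def u_def[symmetric] w_def[symmetric]
    using init w_pos eq_u eq_w eq_0
      smooth_family_regular[OF u_fam] smooth_family_regular[OF w_fam] smooth_family_regular[OF zero_fam]
    by (simp add: fun_eq_iff[of "u 0"] u_def[abs_def, symmetric])
qed

end

theorem theorem1p3:
  fixes \<nu> \<alpha>1 \<alpha>2 \<alpha>3 \<alpha>4 :: real
  assumes "\<nu> > 0" and "\<alpha>1 > 0" and "\<alpha>2 > 0" and "\<alpha>3 > 0" and "\<alpha>4 > 0"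
  shows "\<exists>u0 \<omega>0 k0. smooth_torus u0 \<and> smooth_torus \<omega>0 \<and> smooth_torus k0 \<and>
    (\<forall>m\<ge>2. admissible m u0 \<omega>0 k0 \<and>
       0 < lifespan \<nu> \<alpha>1 \<alpha>2 \<alpha>3 \<alpha>4 m u0 \<omega>0 k0 \<and>
       lifespan \<nu> \<alpha>1 \<alpha>2 \<alpha>3 \<alpha>4 m u0 \<omega>0 k0 < \<infinity>)"
proof (rule exI[of _ sin], rule exI[of _ "\<lambda>x. 1"], rule exI[of _ "\<lambda>x. 0"], intro conjI allI impI)
  have s: "smooth sin" "periodic (sin :: real \<Rightarrow> real)"
    using smooth_sin_affine[of 1 0] by (simp_all add: periodic_def)
  have c: "smooth (\<lambda>x. a)" "periodic (\<lambda>x::real. a :: real)" for a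
    by (simp_all add: periodic_def smooth_const)
  show "smooth_torus sin" "smooth_torus (\<lambda>x. 1)" "smooth_torus (\<lambda>x. 0)"
    by (simp_all add: smooth_torus_iff s c)
  fix m :: nat assume m: "m \<ge> 2"
  show "admissible m sin (\<lambda>x. 1) (\<lambda>x. 0)"
    unfolding admissible_def
    by (auto simp: smooth_sobolev s c smooth_continuous intro!: continuous_intros exI[of _ 1])
  let ?S = "{T. 0 < T \<and> (\<exists>u \<omega> k. kolmogorov_solution \<nu> \<alpha>1 \<alpha>2 \<alpha>3 \<alpha>4 m T sin (\<lambda>x. 1) (\<lambda>x. 0) u \<omega> k)}"
  \<comment> \<open>Any time strictly between 0 and 1 would serve as the witness.\<close>
  have "0 < (1 / 2 :: real) \<and>
      (\<exists>u \<omega> k. kolmogorov_solution \<nu> \<alpha>1 \<alpha>2 \<alpha>3 \<alpha>4 m (1 / 2) sin (\<lambda>x. 1) (\<lambda>x. 0) u \<omega> k)"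
    by (intro conjI exI, simp, rule local_solution) (use assms(3) in simp_all)
  then have "1 / 2 \<in> ?S" by (rule CollectI)
  then have "ereal (1 / 2) \<le> lifespan \<nu> \<alpha>1 \<alpha>2 \<alpha>3 \<alpha>4 m sin (\<lambda>x. 1) (\<lambda>x. 0)"
    unfolding lifespan_def by (intro Sup_upper imageI)
  then show "0 < lifespan \<nu> \<alpha>1 \<alpha>2 \<alpha>3 \<alpha>4 m sin (\<lambda>x. 1) (\<lambda>x. 0)"
    by (rule less_le_trans[rotated]) simp
  \<comment> \<open>Every time in the set lies below the collision time, whichever solution realizes
    it.\<close>
  have "lifespan \<nu> \<alpha>1 \<alpha>2 \<alpha>3 \<alpha>4 m sin (\<lambda>x. 1) (\<lambda>x. 0) \<le> ereal (pi / 2)"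
    unfolding lifespan_def
    by (rule Sup_least) (auto dest!: no_solution_beyond_collision[OF _ m] simp: less_imp_le)
  then show "lifespan \<nu> \<alpha>1 \<alpha>2 \<alpha>3 \<alpha>4 m sin (\<lambda>x. 1) (\<lambda>x. 0) < \<infinity>"
    by (rule le_less_trans) simp
qed

end
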